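(* Consider the linear-quadratic game $\mathcal{G}_{\rm LQ}$ and the notation of the context. Suppose that $M_0\in C^1([0,T];\mathbb{S}^{2N})$, $M_1\in C^1([0,T];\mathbb{S}^{4N})$ and $M_2\in C^1([0,T];\mathbb{R}^{4N})$ satisfy, respectively, $$\dot M_0+A^\top M_0+M_0A+Q=0,\quad M_0(T)=\bar Q;$$ $$\dot M_1+\begin{pmatrix}A&0\\0&A\end{pmatrix}M_1+M_1\begin{pmatrix}A&0\\0&A\end{pmatrix}-K_{M_0,M_1}^\top K_{M_0,M_1}=0,\quad M_1(T)=0;$$ $$\dot M_2+\begin{pmatrix}A&0\\0&A\end{pmatrix}M_2-K_{M_0,M_1}^\top\tilde I M_2=0,\quad M_2(T)=\begin{pmatrix}\mathfrak{p}\\0_{2N}\end{pmatrix}.$$ Define $$u_t^*=-K_{M_0,M_1}(t)\begin{pmatrix}\mathbb{E}[\mathbb{X}_t^{\mathfrak{r},u^*}\mid\mathcal{F}_t]\\\mathbb{E}[\mathfrak{r}\,\mathbb{X}_t^{\mathfrak{r},u^*}\mid\mathcal{F}_t]\end{pmatrix}-\tilde IM_2(t),\qquad t\in[0,T]$$ (a feedback control, $\mathbb{X}^{\mathfrak{r},u^*}$ being the solution of the corresponding closed-loop equation). Assume that $u^*=(u_i^* )_{i\in[N]}$ satisfies $\|u_i^*\|_{\mathcal{H}^2(\mathbb{R})}\le L$ for all $i\in[N]$. Then $u^*$ is an $\alpha_N$-Nash equilibrium of $\mathcal{G}_{\rm LQ}$, with $\alpha_N$ satisfying $$\alpha_N\le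 C\,\frac1N\max_{i\in[N]}\sum_{j\ne i}|q_{ji}-q_{ij}|$$ for a constant $C\ge0$ independent of the cost coefficients $(q_{ij},\gamma_i,d_i)_{i,j\in[N]}$. Moreover, the process $F_t:=\begin{pmatrix}\mathbb{E}[\mathbb{X}_t^{\mathfrak{r},u^*}\mid\mathcal{F}_t]\\\mathbb{E}[\mathfrak{r}\,\mathbb{X}_t^{\mathfrak{r},u^*}\mid\mathcal{F}_t]\end{pmatrix}$, $t\in[0,T]$, satisfies the linear SDE $$\mathrm{d}F_t=\left[\left(\begin{pmatrix}A(t)&0\\0&A(t)\end{pmatrix}-\tilde I^\top K_{M_0,M_1}(t)\right)F_t-\tilde I^\top\tilde IM_2(t)\right]\mathrm{d}t+\begin{pmatrix}\Sigma(t)\\\frac12\Sigma(t)\end{pmatrix}\mathrm{d}W_t,\quad F_0=\begin{pmatrix}\mathbb{X}_0\\\frac12\mathbb{X}_0\end{pmatrix}.$$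
   Context: Let $T\in(0,\infty)$, $[N]=\{1,\dots,N\}$; $(\Omega,\mathcal{F},\mathbb{P})$ is a complete probability space with an $N$-dimensional Brownian motion $W=(W^i)_{i\in[N]}$; $\mathbb{F}=(\mathcal{F}_t)_t$ is its completed natural filtration. $\mathcal{H}^2(E)$ is the space of $E$-valued $\mathbb{F}$-progressively measurable processes with $\|X\|_{\mathcal{H}^2(E)}=\mathbb{E}[\int_0^T|X_s|^2\mathrm{d}s]^{1/2}<\infty$. Game $\mathcal{G}_{\rm LQ}$. For $u\in\mathcal{H}^2(\mathbb{R}^N)$ the state is given by $\mathrm{d}X_{i,t}=(a_i(t)X_{i,t}+u_{i,t})\mathrm{d}t+\sigma_i(t)\mathrm{d}W^i_t$, $X_{i,0}=x_i\in\mathbb{R}$, $i\in[N]$, with continuous $a_i,\sigma_i:[0,T]\to\mathbb{R}$. Player $i$ minimizes $$V_i(u)=\mathbb{E}\Big[\int_0^T\Big(u_{i,t}^2+\frac1N\sum_{j=1}^Nq_{ij}(X^u_{i,t}-X^u_{j,t})^2\Big)\mathrm{d}t+\gamma_i(X^u_{i,T}-d_i)^2\Big]$$ over $\mathcal{A}_i=\{u_i\in\mathcal{H}^2(\mathbb{R}):\|u_i\|_{\mathcal{H}^2(\mathbb{R})}\le L\}$, where $q_{ij},\gamma_i\ge0$, $d_i\in\mathbb{R}$ and $L>0$ is given. A profile $u\in\prod_i\mathcal{A}_i$ is an $\varepsilon$-Nash equilibrium if $V_i((u_i,u_{-i}))\le V_i((u_i',u_{-i}))+\varepsilon$ for all $i\in[N]$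 and $u_i'\in\mathcal{A}_i$. Lifted state. $\mathfrak{r}$ is a random variable uniform on $[0,1]$, independent of $W$. For $u\in\mathcal{H}^2(\mathbb{R}^N)$, $\mathbb{X}^{\mathfrak{r},u}$ is the $\mathbb{R}^{2N}$-valued process (adapted to the filtration generated by $W$ augmented by a $\sigma$-field independent of $W$ for which $\mathfrak{r}$ is measurable) solving $$\mathrm{d}\mathbb{X}_t=(A(t)\mathbb{X}_t+\mathcal{I}_{\mathfrak{r}}u_t)\mathrm{d}t+\Sigma(t)\mathrm{d}W_t,\qquad\mathbb{X}_0=(x_1,\dots,x_N,0_N)^\top,$$ where $\mathcal{I}_{\mathfrak{r}}=\begin{pmatrix}\mathfrak{r}\mathbb{I}_N\\\mathbb{I}_N\end{pmatrix}\in\mathbb{R}^{2N\times N}$, $A(t)=\mathrm{diag}(\tilde A(t),\tilde A(t))$ with $\tilde A(t)=\mathrm{diag}(a_1(t),\dots,a_N(t))$, and $\Sigma(t)=\begin{pmatrix}\sigma(t)\\0_{N\times N}\end{pmatrix}\in\mathbb{R}^{2N\times N}$ with $\sigma(t)=\mathrm{diag}(\sigma_1(t),\dots,\sigma_N(t))$. Matrices. $\mathbb{S}^n$ is the space of symmetric $n\times n$ matrices, $\mathbb{I}_n$ the identity, $0_k$ the zero vector of $\mathbb{R}^k$. $Q=\begin{pmatrix}0&\tilde Q^\top\\\tilde Q&0\end{pmatrix}\in\mathbb{S}^{2N}$ with $\tilde Q_{i,i}=\frac1N\sum_{k\ne i}q_{ik}$ and $\tilde Q_{i,j}=-\frac{q_{ij}}N$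 for $i\ne j$; $\bar Q=\begin{pmatrix}0&\Gamma\\\Gamma&0\end{pmatrix}\in\mathbb{S}^{2N}$ with $\Gamma=\mathrm{diag}(\gamma_1,\dots,\gamma_N)$; $\mathfrak{p}=-(0_N,\gamma_1d_1,\dots,\gamma_Nd_N)^\top\in\mathbb{R}^{2N}$. Further, $$\tilde I=\begin{pmatrix}\tfrac12\mathbb{I}_N&\mathbb{I}_N&\tfrac13\mathbb{I}_N&\tfrac12\mathbb{I}_N\end{pmatrix}\in\mathbb{R}^{N\times4N},\qquad K_{M_0,M_1}=\Big(\begin{pmatrix}0&\mathbb{I}_N\end{pmatrix}M_0\ \ \begin{pmatrix}\mathbb{I}_N&0\end{pmatrix}M_0\Big)+\tilde IM_1:[0,T]\to\mathbb{R}^{N\times4N},$$ where $0$ in $\begin{pmatrix}0&\mathbb{I}_N\end{pmatrix}$ and $\begin{pmatrix}\mathbb{I}_N&0\end{pmatrix}$ is the $N\times N$ zero matrix. *)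

theory Defs
  imports "HOL-Probability.Probability"
begin

text \<open>
  The player set is a finite type \<open>'n\<close>, so \<open>N = CARD('n)\<close>; dimension \<open>2N\<close> is \<open>'n + 'n\<close> and
  dimension \<open>4N\<close> is \<open>('n + 'n) + ('n + 'n)\<close>, blocks being the summands.  A process is a function
  of time and sample point, of which only the times in \<open>{0..T}\<close> matter.
\<close>

section \<open>Block vectors and matrices\<close>

definition hcat :: "'c ^ 'a ^ 'm \<Rightarrow> 'c ^ 'b ^ 'm \<Rightarrow> 'c ^ ('a + 'b) ^ 'm" where
  "hcat P R = (\<chi> i j. case j of Inl k \<Rightarrow> P $ i $ k | Inr k \<Rightarrow> R $ i $ k)"

text \<open>With \<open>'c\<close> a row type this stacks matrices, with \<open>'c = real\<close> it stacks vectors.\<close>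

definition vcat :: "'c ^ 'a \<Rightarrow> 'c ^ 'b \<Rightarrow> 'c ^ ('a + 'b)" where
  "vcat P R = (\<chi> i. case i of Inl k \<Rightarrow> P $ k | Inr k \<Rightarrow> R $ k)"

definition diagm :: "('n \<Rightarrow> real) \<Rightarrow> real ^ 'n ^ 'n" where
  "diagm f = (\<chi> i j. if i = j then f i else 0)"

definition block_diag :: "real ^ 'a ^ 'a \<Rightarrow> real ^ 'a ^ 'a \<Rightarrow> real ^ ('a + 'a) ^ ('a + 'a)" where
  "block_diag P R = vcat (hcat P 0) (hcat 0 R)"

definition block_antidiag :: "real ^ 'a ^ 'a \<Rightarrow> real ^ 'a ^ 'a \<Rightarrow> real ^ ('a + 'a) ^ ('a + 'a)" where
  "block_antidiag P R = vcat (hcat 0 P) (hcat R 0)"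

section \<open>Processes, Brownian motion and the Ito integral\<close>

definition brownian_filtration ::
    "'w measure \<Rightarrow> (real \<Rightarrow> 'w \<Rightarrow> real ^ 'n) \<Rightarrow> real \<Rightarrow> 'w measure" where
  "brownian_filtration M W t =
     sigma (space M) ({W s -` B \<inter> space M | s B. s \<in> {0..t} \<and> B \<in> sets borel} \<union> null_sets M)"

definition brownian_motion ::
    "'w measure \<Rightarrow> real \<Rightarrow> (real \<Rightarrow> 'w \<Rightarrow> real ^ 'n) \<Rightarrow> bool" where
  "brownian_motion M T W \<longleftrightarrow>
     (\<forall>t\<in>{0..T}. W t \<in> borel_measurable M) \<and>
     (AE \<omega> in M. W 0 \<omega> = 0) \<and>
     (AE \<omega> in M. continuous_on {0..T} (\<lambda>t. W t \<omega>)) \<and>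
     (\<forall>s t. 0 \<le> s \<and> s < t \<and> t \<le> T \<longrightarrow>
        prob_space.indep_set M (sets (brownian_filtration M W s))
          {(\<lambda>\<omega>. W t \<omega> - W s \<omega>) -` B \<inter> space M | B. B \<in> sets borel} \<and>
        prob_space.indep_vars M (\<lambda>_. borel) (\<lambda>i \<omega>. (W t \<omega> - W s \<omega>) $ i) UNIV \<and>
        (\<forall>i. distributed M lborel (\<lambda>\<omega>. (W t \<omega> - W s \<omega>) $ i) (normal_density 0 (sqrt (t - s)))))"

definition enlarged_filtration :: "(real \<Rightarrow> 'w measure) \<Rightarrow> 'w measure \<Rightarrow> real \<Rightarrow> 'w measure" where
  "enlarged_filtration F G t = sigma (space G) (sets (F t) \<union> sets G)"

definition adapted ::
    "real \<Rightarrow> (real \<Rightarrow> 'w measure) \<Rightarrow> (real \<Rightarrow> 'w \<Rightarrow> 'b::topological_space) \<Rightarrow> bool" where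
  "adapted T F X \<longleftrightarrow> (\<forall>t\<in>{0..T}. X t \<in> borel_measurable (F t))"

definition progressive ::
    "real \<Rightarrow> (real \<Rightarrow> 'w measure) \<Rightarrow> (real \<Rightarrow> 'w \<Rightarrow> 'b::topological_space) \<Rightarrow> bool" where
  "progressive T F X \<longleftrightarrow>
     (\<forall>t\<in>{0..T}. (\<lambda>(s, \<omega>). X s \<omega>) \<in> borel_measurable (restrict_space borel {0..t} \<Otimes>\<^sub>M F t))"

definition H2_sqnorm :: "'w measure \<Rightarrow> real \<Rightarrow> (real \<Rightarrow> 'w \<Rightarrow> 'b::real_normed_vector) \<Rightarrow> ennreal" where
  "H2_sqnorm M T X =
     (\<integral>\<^sup>+ \<omega>. (\<integral>\<^sup>+ s\<in>{0..T}. ennreal ((norm (X s \<omega>))\<^sup>2) \<partial>lborel) \<partial>M)"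

definition H2_norm :: "'w measure \<Rightarrow> real \<Rightarrow> (real \<Rightarrow> 'w \<Rightarrow> 'b::real_normed_vector) \<Rightarrow> real" where
  "H2_norm M T X = sqrt (enn2real (H2_sqnorm M T X))"

definition H2_space ::
    "'w measure \<Rightarrow> real \<Rightarrow> (real \<Rightarrow> 'w measure) \<Rightarrow> (real \<Rightarrow> 'w \<Rightarrow> 'b::real_normed_vector) set" where
  "H2_space M T F = {X. progressive T F X \<and> H2_sqnorm M T X < \<infinity>}"

text \<open>
  A simple process is a finite sum of terms \<open>\<xi> 1\<^bsub>(a,b]\<^esub>\<close> with \<open>\<xi>\<close> bounded and measurable at time \<open>a\<close>,
  given by the list of the triples \<open>(a, b, \<xi>)\<close>.
\<close>

definition simple_list ::
    "real \<Rightarrow> (real \<Rightarrow> 'w measure) \<Rightarrow> (real \<times> real \<times> ('w \<Rightarrow> 'b::real_normed_vector)) list \<Rightarrow> bool" where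
  "simple_list T F S \<longleftrightarrow>
     (\<forall>(a, b, \<xi>) \<in> set S. 0 \<le> a \<and> a \<le> b \<and> b \<le> T \<and> \<xi> \<in> borel_measurable (F a) \<and>
        (\<exists>B. \<forall>\<omega>\<in>space (F a). norm (\<xi> \<omega>) \<le> B))"

definition simple_process ::
    "(real \<times> real \<times> ('w \<Rightarrow> 'b::real_normed_vector)) list \<Rightarrow> real \<Rightarrow> 'w \<Rightarrow> 'b" where
  "simple_process S t \<omega> = (\<Sum>(a, b, \<xi>)\<leftarrow>S. indicator {a<..b} t *\<^sub>R \<xi> \<omega>)"

definition simple_integral ::
    "(real \<Rightarrow> 'w \<Rightarrow> real ^ 'n) \<Rightarrow> (real \<times> real \<times> ('w \<Rightarrow> real ^ 'n ^ 'm)) list \<Rightarrow>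
     real \<Rightarrow> 'w \<Rightarrow> real ^ 'm" where
  "simple_integral W S t \<omega> = (\<Sum>(a, b, \<xi>)\<leftarrow>S. \<xi> \<omega> *v (W (min b t) \<omega> - W (min a t) \<omega>))"

text \<open>
  \<open>I\<close> is a continuous version of \<open>\<integral>\<^sub>0 H dW\<close>, the \<open>L\<^sup>2\<close> limit of integrals of simple processes
  approximating \<open>H\<close>; the norm of \<open>real ^ 'n ^ 'm\<close> is the Frobenius norm.
\<close>

definition is_ito_integral ::
    "'w measure \<Rightarrow> real \<Rightarrow> (real \<Rightarrow> 'w measure) \<Rightarrow> (real \<Rightarrow> 'w \<Rightarrow> real ^ 'n) \<Rightarrow>
     (real \<Rightarrow> 'w \<Rightarrow> real ^ 'n ^ 'm) \<Rightarrow> (real \<Rightarrow> 'w \<Rightarrow> real ^ 'm) \<Rightarrow> bool" where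
  "is_ito_integral M T F W H I \<longleftrightarrow>
     H \<in> H2_space M T F \<and> adapted T F I \<and> (\<forall>\<omega>\<in>space M. continuous_on {0..T} (\<lambda>t. I t \<omega>)) \<and>
     (\<exists>S. (\<forall>k. simple_list T F (S k)) \<and>
        (\<lambda>k. H2_sqnorm M T (\<lambda>t \<omega>. H t \<omega> - simple_process (S k) t \<omega>)) \<longlonglongrightarrow> 0 \<and>
        (\<forall>t\<in>{0..T}.
           (\<lambda>k::nat. \<integral>\<^sup>+ \<omega>. ennreal ((norm (I t \<omega> - simple_integral W (S k) t \<omega>))\<^sup>2) \<partial>M) \<longlonglongrightarrow> 0))"

text \<open>\<open>X\<close> is a strong solution of \<open>dX\<^sub>t = b(t, \<omega>, X\<^sub>t) dt + S(t) dW\<^sub>t\<close>, \<open>X\<^sub>0 = x\<^sub>0\<close>.\<close>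

definition sde_solution ::
    "'w measure \<Rightarrow> real \<Rightarrow> (real \<Rightarrow> 'w measure) \<Rightarrow> (real \<Rightarrow> 'w \<Rightarrow> real ^ 'n) \<Rightarrow>
     (real \<Rightarrow> 'w \<Rightarrow> real ^ 'm \<Rightarrow> real ^ 'm) \<Rightarrow> (real \<Rightarrow> real ^ 'n ^ 'm) \<Rightarrow> real ^ 'm \<Rightarrow>
     (real \<Rightarrow> 'w \<Rightarrow> real ^ 'm) \<Rightarrow> bool" where
  "sde_solution M T F W b S x0 X \<longleftrightarrow>
     adapted T F X \<and> (\<forall>\<omega>\<in>space M. continuous_on {0..T} (\<lambda>t. X t \<omega>)) \<and>
     (\<exists>I. is_ito_integral M T F W (\<lambda>t \<omega>. S t) I \<and>
        (AE \<omega> in M. \<forall>t\<in>{0..T}.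
           set_integrable lborel {0..t} (\<lambda>s. b s \<omega> (X s \<omega>)) \<and>
           X t \<omega> = x0 + (LINT s:{0..t}|lborel. b s \<omega> (X s \<omega>)) + I t \<omega>))"

definition cond_exp_vec ::
    "'w measure \<Rightarrow> 'w measure \<Rightarrow> ('w \<Rightarrow> real ^ 'm) \<Rightarrow> 'w \<Rightarrow> real ^ 'm" where
  "cond_exp_vec M F Z \<omega> = (\<chi> k. real_cond_exp M F (\<lambda>\<omega>'. Z \<omega>' $ k) \<omega>)"

section \<open>The linear-quadratic game\<close>

definition is_state ::
    "'w measure \<Rightarrow> real \<Rightarrow> (real \<Rightarrow> 'w \<Rightarrow> real ^ 'n) \<Rightarrow> ('n \<Rightarrow> real \<Rightarrow> real) \<Rightarrow> ('n \<Rightarrow> real \<Rightarrow> real) \<Rightarrow>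
     real ^ 'n \<Rightarrow> (real \<Rightarrow> 'w \<Rightarrow> real ^ 'n) \<Rightarrow> (real \<Rightarrow> 'w \<Rightarrow> real ^ 'n) \<Rightarrow> bool" where
  "is_state M T W a \<sigma> x u X \<longleftrightarrow>
     sde_solution M T (brownian_filtration M W) W
       (\<lambda>t \<omega> y. \<chi> i. a i t * y $ i + u t \<omega> $ i) (\<lambda>t. diagm (\<lambda>i. \<sigma> i t)) x X"

text \<open>The state \<open>X\<^sup>u\<close>; solutions exist and are unique up to indistinguishability for \<open>u\<close> in \<open>H\<^sup>2\<close>.\<close>

definition state ::
    "'w measure \<Rightarrow> real \<Rightarrow> (real \<Rightarrow> 'w \<Rightarrow> real ^ 'n) \<Rightarrow> ('n \<Rightarrow> real \<Rightarrow> real) \<Rightarrow> ('n \<Rightarrow> real \<Rightarrow> real) \<Rightarrow>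
     real ^ 'n \<Rightarrow> (real \<Rightarrow> 'w \<Rightarrow> real ^ 'n) \<Rightarrow> (real \<Rightarrow> 'w \<Rightarrow> real ^ 'n)" where
  "state M T W a \<sigma> x u = (SOME X. is_state M T W a \<sigma> x u X)"

definition cost ::
    "'w measure \<Rightarrow> real \<Rightarrow> (real \<Rightarrow> 'w \<Rightarrow> real ^ 'n) \<Rightarrow> ('n \<Rightarrow> real \<Rightarrow> real) \<Rightarrow> ('n \<Rightarrow> real \<Rightarrow> real) \<Rightarrow>
     real ^ 'n \<Rightarrow> ('n \<Rightarrow> 'n \<Rightarrow> real) \<Rightarrow> ('n \<Rightarrow> real) \<Rightarrow> ('n \<Rightarrow> real) \<Rightarrow>
     'n \<Rightarrow> (real \<Rightarrow> 'w \<Rightarrow> real ^ 'n) \<Rightarrow> real" where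
  "cost M T W a \<sigma> x q \<gamma> d i u =
     (let X = state M T W a \<sigma> x u in
      prob_space.expectation M (\<lambda>\<omega>.
        (LINT t:{0..T}|lborel. (u t \<omega> $ i)\<^sup>2
           + 1 / real CARD('n) * (\<Sum>j\<in>UNIV. q i j * (X t \<omega> $ i - X t \<omega> $ j)\<^sup>2))
        + \<gamma> i * (X T \<omega> $ i - d i)\<^sup>2))"

definition admissible ::
    "'w measure \<Rightarrow> real \<Rightarrow> (real \<Rightarrow> 'w \<Rightarrow> real ^ 'n) \<Rightarrow> real \<Rightarrow> (real \<Rightarrow> 'w \<Rightarrow> real) set" where
  "admissible M T W L =
     {v \<in> H2_space M T (brownian_filtration M W). H2_norm M T v \<le> L}"

definition deviate ::
    "(real \<Rightarrow> 'w \<Rightarrow> real ^ 'n) \<Rightarrow> 'n \<Rightarrow> (real \<Rightarrow> 'w \<Rightarrow> real) \<Rightarrow> (real \<Rightarrow> 'w \<Rightarrow> real ^ 'n)" where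
  "deviate u i v = (\<lambda>t \<omega>. \<chi> j. if j = i then v t \<omega> else u t \<omega> $ j)"

definition eps_Nash ::
    "'w measure \<Rightarrow> real \<Rightarrow> (real \<Rightarrow> 'w \<Rightarrow> real ^ 'n) \<Rightarrow> ('n \<Rightarrow> real \<Rightarrow> real) \<Rightarrow> ('n \<Rightarrow> real \<Rightarrow> real) \<Rightarrow>
     real ^ 'n \<Rightarrow> real \<Rightarrow> ('n \<Rightarrow> 'n \<Rightarrow> real) \<Rightarrow> ('n \<Rightarrow> real) \<Rightarrow> ('n \<Rightarrow> real) \<Rightarrow>
     real \<Rightarrow> (real \<Rightarrow> 'w \<Rightarrow> real ^ 'n) \<Rightarrow> bool" where
  "eps_Nash M T W a \<sigma> x L q \<gamma> d \<epsilon> u \<longleftrightarrow>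
     (\<forall>i. (\<lambda>t \<omega>. u t \<omega> $ i) \<in> admissible M T W L) \<and>
     (\<forall>i. \<forall>v\<in>admissible M T W L.
        cost M T W a \<sigma> x q \<gamma> d i u \<le> cost M T W a \<sigma> x q \<gamma> d i (deviate u i v) + \<epsilon>)"

section \<open>The lifted system\<close>

definition matA :: "('n::finite \<Rightarrow> real \<Rightarrow> real) \<Rightarrow> real \<Rightarrow> real ^ ('n + 'n) ^ ('n + 'n)" where
  "matA a t = block_diag (diagm (\<lambda>i. a i t)) (diagm (\<lambda>i. a i t))"

definition matAA ::
    "('n::finite \<Rightarrow> real \<Rightarrow> real) \<Rightarrow> real \<Rightarrow> real ^ (('n + 'n) + ('n + 'n)) ^ (('n + 'n) + ('n + 'n))" where
  "matAA a t = block_diag (matA a t) (matA a t)"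

definition matSigma :: "('n::finite \<Rightarrow> real \<Rightarrow> real) \<Rightarrow> real \<Rightarrow> real ^ 'n ^ ('n + 'n)" where
  "matSigma \<sigma> t = vcat (diagm (\<lambda>i. \<sigma> i t)) 0"

definition matI :: "real \<Rightarrow> real ^ 'n::finite ^ ('n + 'n)" where
  "matI r = vcat (r *\<^sub>R mat 1) (mat 1)"

definition lifted_state ::
    "'w measure \<Rightarrow> real \<Rightarrow> (real \<Rightarrow> 'w \<Rightarrow> real ^ 'n) \<Rightarrow> 'w measure \<Rightarrow> ('w \<Rightarrow> real) \<Rightarrow>
     ('n \<Rightarrow> real \<Rightarrow> real) \<Rightarrow> ('n \<Rightarrow> real \<Rightarrow> real) \<Rightarrow> real ^ 'n \<Rightarrow>
     (real \<Rightarrow> 'w \<Rightarrow> real ^ 'n) \<Rightarrow> (real \<Rightarrow> 'w \<Rightarrow> real ^ ('n + 'n)) \<Rightarrow> bool" where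
  "lifted_state M T W G r a \<sigma> x u X \<longleftrightarrow>
     sde_solution M T (enlarged_filtration (brownian_filtration M W) G) W
       (\<lambda>t \<omega> y. matA a t *v y + matI (r \<omega>) *v u t \<omega>) (matSigma \<sigma>) (vcat x 0) X"

definition cond_moments ::
    "'w measure \<Rightarrow> (real \<Rightarrow> 'w \<Rightarrow> real ^ 'n) \<Rightarrow> ('w \<Rightarrow> real) \<Rightarrow>
     (real \<Rightarrow> 'w \<Rightarrow> real ^ ('n + 'n)) \<Rightarrow> real \<Rightarrow> 'w \<Rightarrow> real ^ (('n + 'n) + ('n + 'n))" where
  "cond_moments M W r X t \<omega> =
     vcat (cond_exp_vec M (brownian_filtration M W t) (X t) \<omega>)
          (cond_exp_vec M (brownian_filtration M W t) (\<lambda>\<omega>'. r \<omega>' *\<^sub>R X t \<omega>') \<omega>)"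

definition matQtilde :: "('n::finite \<Rightarrow> 'n \<Rightarrow> real) \<Rightarrow> real ^ 'n ^ 'n" where
  "matQtilde q = (\<chi> i j. if i = j then (\<Sum>k\<in>UNIV - {i}. q i k) / real CARD('n)
                         else - q i j / real CARD('n))"

definition matQ :: "('n::finite \<Rightarrow> 'n \<Rightarrow> real) \<Rightarrow> real ^ ('n + 'n) ^ ('n + 'n)" where
  "matQ q = block_antidiag (transpose (matQtilde q)) (matQtilde q)"

definition matQbar :: "('n::finite \<Rightarrow> real) \<Rightarrow> real ^ ('n + 'n) ^ ('n + 'n)" where
  "matQbar \<gamma> = block_antidiag (diagm \<gamma>) (diagm \<gamma>)"

definition vecp :: "('n::finite \<Rightarrow> real) \<Rightarrow> ('n \<Rightarrow> real) \<Rightarrow> real ^ ('n + 'n)" where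
  "vecp \<gamma> d = - vcat 0 (\<chi> i. \<gamma> i * d i)"

definition Itilde :: "real ^ (('n::finite + 'n) + ('n + 'n)) ^ 'n" where
  "Itilde = hcat (hcat ((1/2) *\<^sub>R mat 1) (mat 1)) (hcat ((1/3) *\<^sub>R mat 1) ((1/2) *\<^sub>R mat 1))"

definition matK ::
    "(real \<Rightarrow> real ^ ('n::finite + 'n) ^ ('n + 'n)) \<Rightarrow>
     (real \<Rightarrow> real ^ (('n + 'n) + ('n + 'n)) ^ (('n + 'n) + ('n + 'n))) \<Rightarrow>
     real \<Rightarrow> real ^ (('n + 'n) + ('n + 'n)) ^ 'n" where
  "matK M0 M1 t =
     hcat (hcat (0 :: real ^ 'n ^ 'n) (mat 1) ** M0 t) (hcat (mat 1) (0 :: real ^ 'n ^ 'n) ** M0 t)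
     + Itilde ** M1 t"

definition C1_deriv :: "real \<Rightarrow> (real \<Rightarrow> 'b::real_normed_vector) \<Rightarrow> (real \<Rightarrow> 'b) \<Rightarrow> bool" where
  "C1_deriv T f f' \<longleftrightarrow>
     continuous_on {0..T} f' \<and> (\<forall>t\<in>{0..T}. (f has_vector_derivative f' t) (at t within {0..T}))"

definition M0_equation ::
    "real \<Rightarrow> ('n::finite \<Rightarrow> real \<Rightarrow> real) \<Rightarrow> ('n \<Rightarrow> 'n \<Rightarrow> real) \<Rightarrow> ('n \<Rightarrow> real) \<Rightarrow>
     (real \<Rightarrow> real ^ ('n + 'n) ^ ('n + 'n)) \<Rightarrow> bool" where
  "M0_equation T a q \<gamma> M0 \<longleftrightarrow>
     (\<forall>t\<in>{0..T}. transpose (M0 t) = M0 t) \<and>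
     (\<exists>M0'. C1_deriv T M0 M0' \<and>
        (\<forall>t\<in>{0..T}. M0' t + transpose (matA a t) ** M0 t + M0 t ** matA a t + matQ q = 0)) \<and>
     M0 T = matQbar \<gamma>"

definition M1_equation ::
    "real \<Rightarrow> ('n::finite \<Rightarrow> real \<Rightarrow> real) \<Rightarrow> (real \<Rightarrow> real ^ ('n + 'n) ^ ('n + 'n)) \<Rightarrow>
     (real \<Rightarrow> real ^ (('n + 'n) + ('n + 'n)) ^ (('n + 'n) + ('n + 'n))) \<Rightarrow> bool" where
  "M1_equation T a M0 M1 \<longleftrightarrow>
     (\<forall>t\<in>{0..T}. transpose (M1 t) = M1 t) \<and>
     (\<exists>M1'. C1_deriv T M1 M1' \<and>
        (\<forall>t\<in>{0..T}. M1' t + matAA a t ** M1 t + M1 t ** matAA a t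
                      - transpose (matK M0 M1 t) ** matK M0 M1 t = 0)) \<and>
     M1 T = 0"

definition M2_equation ::
    "real \<Rightarrow> ('n::finite \<Rightarrow> real \<Rightarrow> real) \<Rightarrow> ('n \<Rightarrow> real) \<Rightarrow> ('n \<Rightarrow> real) \<Rightarrow>
     (real \<Rightarrow> real ^ ('n + 'n) ^ ('n + 'n)) \<Rightarrow>
     (real \<Rightarrow> real ^ (('n + 'n) + ('n + 'n)) ^ (('n + 'n) + ('n + 'n))) \<Rightarrow>
     (real \<Rightarrow> real ^ (('n + 'n) + ('n + 'n))) \<Rightarrow> bool" where
  "M2_equation T a \<gamma> d M0 M1 M2 \<longleftrightarrow>
     (\<exists>M2'. C1_deriv T M2 M2' \<and>
        (\<forall>t\<in>{0..T}. M2' t + matAA a t *v M2 t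
                      - transpose (matK M0 M1 t) *v (Itilde *v M2 t) = 0)) \<and>
     M2 T = vcat (vecp \<gamma> d) 0"

text \<open>
  The closed loop: \<open>u\<close> is a progressive version of the feedback control, \<open>X\<close> its lifted state.
  Conditional expectations at a fixed time are only defined almost surely.
\<close>

definition closed_loop ::
    "'w measure \<Rightarrow> real \<Rightarrow> (real \<Rightarrow> 'w \<Rightarrow> real ^ 'n) \<Rightarrow> 'w measure \<Rightarrow> ('w \<Rightarrow> real) \<Rightarrow>
     ('n \<Rightarrow> real \<Rightarrow> real) \<Rightarrow> ('n \<Rightarrow> real \<Rightarrow> real) \<Rightarrow> real ^ 'n \<Rightarrow>
     (real \<Rightarrow> real ^ ('n + 'n) ^ ('n + 'n)) \<Rightarrow>
     (real \<Rightarrow> real ^ (('n + 'n) + ('n + 'n)) ^ (('n + 'n) + ('n + 'n))) \<Rightarrow>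
     (real \<Rightarrow> real ^ (('n + 'n) + ('n + 'n))) \<Rightarrow>
     (real \<Rightarrow> 'w \<Rightarrow> real ^ 'n) \<Rightarrow> (real \<Rightarrow> 'w \<Rightarrow> real ^ ('n + 'n)) \<Rightarrow> bool" where
  "closed_loop M T W G r a \<sigma> x M0 M1 M2 u X \<longleftrightarrow>
     u \<in> H2_space M T (brownian_filtration M W) \<and>
     lifted_state M T W G r a \<sigma> x u X \<and>
     (\<forall>t\<in>{0..T}. AE \<omega> in M.
        u t \<omega> = - (matK M0 M1 t *v cond_moments M W r X t \<omega>) - Itilde *v M2 t)"

end

(* Write A = diag(a_i), Q for the matrix Qtilde, X for the state of the game and Y for the lower block of the
   lifted state, which does not depend on r. The conditional moments are F = (X - Y/2, Y, X/2 - Y/6, Y/2).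
   Since K Itilde^T is symmetric, the Riccati system says that theta = K F + Itilde M2 = -u satisfies
     d theta = - (A theta + Q X + (Q^T - Q) Y / 2) dt + martingale,   theta(T) = Gamma (X_T - d).
   For a deviation h of player i let y' = a_i y + h, y(0) = 0. Pairing y with theta shows that the derivative
   of V_i at u in direction h is
     (1/N) sum_{j /= i} (q_ji - q_ij) E int y Y_j dt,
   and convexity of V_i together with energy estimates for y and Y_j, which involve only L, T and a,
   gives the claim. No Ito formula is needed: y is absolutely continuous, so the stochastic part J of F
   enters only through E [z_T J_T] = E int z' J dt, a consequence of the martingale property of J. *)

theory Submission
  imports Defs
begin

section \<open>Linear equations with integrable data\<close>

text \<open>The noise is additive, so each component of a state equation reads X = c + int (a X + h)
  + I with a continuous path I. Subtracting two such equations with the same I leaves a scalar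
  linear equation with integrable data, solved by an integrating factor; existence, uniqueness and
  energy bounds are thus obtained path by path, without fixed points or Gronwall. The obstacle is to
  know that I is the same: the lifted state lives in the enlarged filtration, the game state in the
  Brownian one, and \<open>state\<close> is an arbitrary choice. A continuous deterministic
  integrand has one fixed sequence of step functions, and this pins I down up to
  indistinguishability. The existence of the noise is read off from the lifted state that the closed
  loop provides. The weights 1/2, 1, 1/3, 1/2 in \<open>Itilde\<close> are E r, 1, E r^2, E r, the
  averages of the input matrices of the pair (Z, r Z) with Z the lifted state. That E r occurs twice
  is what makes K Itilde^T symmetric.\<close>

lemma integral_product_split:
  fixes f g :: "real \<Rightarrow> real"
  assumes f: "integrable lborel f" and g: "integrable lborel g"
  shows "(\<integral>x. f x \<partial>lborel) * (\<integral>x. g x \<partial>lborel) =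
    (\<integral>x. f x * (\<integral>y. indicator {..x} y * g y \<partial>lborel) \<partial>lborel) +
    (\<integral>y. (\<integral>x. indicator {..y} x * f x \<partial>lborel) * g y \<partial>lborel)"
proof -
  have [measurable]: "f \<in> borel_measurable borel" "g \<in> borel_measurable borel"
    using f g by (auto dest: borel_measurable_integrable)
  have fg: "integrable (lborel \<Otimes>\<^sub>M lborel) (\<lambda>(x, y). f x * g y)"
  proof (rule lborel_pair.Fubini_integrable)
    show "integrable lborel (\<lambda>x. \<integral>y. norm (case (x, y) of (x, y) \<Rightarrow> f x * g y) \<partial>lborel)"
      using f by (simp add: norm_mult abs_mult)
    show "AE x in lborel. integrable lborel (\<lambda>y. case (x, y) of (x, y) \<Rightarrow> f x * g y)"
      using g by simp
  qed measurable
  have le: "integrable (lborel \<Otimes>\<^sub>M lborel) (\<lambda>(x, y). f x * (indicator {..x} y * g y))"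
    by (rule Bochner_Integration.integrable_bound[OF fg]) (auto simp: indicator_def split_beta')
  have gt: "integrable (lborel \<Otimes>\<^sub>M lborel) (\<lambda>(x, y). (indicator {..<y} x * f x) * g y)"
    by (rule Bochner_Integration.integrable_bound[OF fg]) (auto simp: indicator_def split_beta')
  \<comment> \<open>Fubini for f(x) g(y), with the plane cut along the diagonal into y <= x and x <
    y. Nothing beyond integrability enters, since controls have no better regularity in
    time.\<close>
  have "(\<integral>x. f x \<partial>lborel) * (\<integral>x. g x \<partial>lborel) = (\<integral>x. (\<integral>y. f x * g y \<partial>lborel) \<partial>lborel)"
    by simp
  also have "\<dots> = (\<integral>(x, y). f x * g y \<partial>(lborel \<Otimes>\<^sub>M lborel))"
    using lborel_pair.integral_fst[OF fg] by (simp add: split_beta')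
  also have "\<dots> = (\<integral>z. (case z of (x, y) \<Rightarrow> f x * (indicator {..x} y * g y)) +
      (case z of (x, y) \<Rightarrow> (indicator {..<y} x * f x) * g y) \<partial>(lborel \<Otimes>\<^sub>M lborel))"
    by (rule Bochner_Integration.integral_cong) (auto simp: indicator_def)
  also have "\<dots> = (\<integral>(x, y). f x * (indicator {..x} y * g y) \<partial>(lborel \<Otimes>\<^sub>M lborel)) +
      (\<integral>(x, y). (indicator {..<y} x * f x) * g y \<partial>(lborel \<Otimes>\<^sub>M lborel))"
    by (rule Bochner_Integration.integral_add[OF le gt])
  also have "(\<integral>(x, y). f x * (indicator {..x} y * g y) \<partial>(lborel \<Otimes>\<^sub>M lborel)) =
      (\<integral>x. f x * (\<integral>y. indicator {..x} y * g y \<partial>lborel) \<partial>lborel)"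
    using lborel_pair.integral_fst[OF le] by simp
  also have "(\<integral>(x, y). (indicator {..<y} x * f x) * g y \<partial>(lborel \<Otimes>\<^sub>M lborel)) =
      (\<integral>y. (\<integral>x. indicator {..<y} x * f x \<partial>lborel) * g y \<partial>lborel)"
    using lborel_pair.integral_snd[OF gt] by simp
  \<comment> \<open>The strict half plane becomes a closed one because a single point is a null set;
    the two summands of the claim then have the same shape.\<close>
  also have "(\<lambda>y. \<integral>x. indicator {..<y} x * f x \<partial>lborel) = (\<lambda>y. \<integral>x. indicator {..y} x * f x \<partial>lborel)"
  proof
    fix y :: real
    have "AE x in lborel. x \<noteq> y" by (rule AE_lborel_singleton)
    then show "(\<integral>x. indicator {..<y} x * f x \<partial>lborel) = (\<integral>x. indicator {..y} x * f x \<partial>lborel)"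
      by (intro integral_cong_AE) (auto simp: indicator_def elim!: eventually_mono)
  qed
  finally show ?thesis .
qed

lemma continuous_on_indefinite_LINT:
  fixes f :: "real \<Rightarrow> real"
  assumes "set_integrable lborel {0..T} f"
  shows "continuous_on {0..T} (\<lambda>t. LINT s:{0..t}|lborel. f s)"
proof -
  have "continuous_on {0..T} (\<lambda>t. integral {0..t} f)"
    by (intro indefinite_integral_continuous_1 set_borel_integral_eq_integral assms)
  then show ?thesis
    by (rule continuous_on_eq)
      (auto intro!: set_borel_integral_eq_integral(2)[symmetric] set_integrable_subset[OF assms])
qed

lemma set_integrable_mult_continuous:
  fixes f g :: "real \<Rightarrow> real"
  assumes f: "set_integrable lborel {0..T} f" and g: "continuous_on {0..T} g"
  shows "set_integrable lborel {0..T} (\<lambda>s. f s * g s)"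
proof -
  have "bounded (g ` {0..T})"
    by (intro compact_imp_bounded compact_continuous_image g) auto
  then obtain B where B: "\<And>s. s \<in> {0..T} \<Longrightarrow> \<bar>g s\<bar> \<le> B"
    by (metis bounded_iff imageI real_norm_def)
  have gm: "set_borel_measurable lborel {0..T} g"
    using set_measurable_continuous_on[OF _ g] by (auto simp: set_borel_measurable_def)
  have "integrable lborel (\<lambda>s. (indicator {0..T} s *\<^sub>R f s) * (indicator {0..T} s *\<^sub>R g s))"
  proof (rule Bochner_Integration.integrable_bound)
    show "integrable lborel (\<lambda>s. B * (indicator {0..T} s *\<^sub>R f s))"
      using f by (simp add: set_integrable_def)
    show "(\<lambda>s. (indicator {0..T} s *\<^sub>R f s) * (indicator {0..T} s *\<^sub>R g s)) \<in> borel_measurable lborel"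
      using f gm by (auto simp: set_integrable_def set_borel_measurable_def)
    show "AE s in lborel. norm ((indicator {0..T} s *\<^sub>R f s) * (indicator {0..T} s *\<^sub>R g s))
        \<le> norm (B * (indicator {0..T} s *\<^sub>R f s))"
    proof (intro AE_I2)
      fix s
      show "norm ((indicator {0..T} s *\<^sub>R f s) * (indicator {0..T} s *\<^sub>R g s))
        \<le> norm (B * (indicator {0..T} s *\<^sub>R f s))"
        using mult_right_mono[OF order_trans[OF B[of s] abs_ge_self], of "\<bar>f s\<bar>"]
        by (auto simp: indicator_def abs_mult mult.commute)
    qed
  qed
  then show ?thesis
    unfolding set_integrable_def
    by (rule Bochner_Integration.integrable_cong[THEN iffD1, rotated -1]) (auto simp: indicator_def)
qed

text \<open>The product rule for absolutely continuous functions, each presented as a constant plus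
  an indefinite integral. Derivatives exist only almost everywhere, so the rule is taken from
  \<open>integral_product_split\<close>, with the integrands extended by zero outside the
  interval.\<close>

lemma LINT_mult_by_parts:
  fixes f g :: "real \<Rightarrow> real"
  assumes f: "set_integrable lborel {0..t} f" and g: "set_integrable lborel {0..t} g"
  shows "(c + (LINT s:{0..t}|lborel. f s)) * (d + (LINT s:{0..t}|lborel. g s)) =
    c * d + (LINT s:{0..t}|lborel. f s * (d + (LINT r:{0..s}|lborel. g r)) +
      (c + (LINT r:{0..s}|lborel. f r)) * g s)" (is "_ = _ + ?R")
proof -
  let ?f = "\<lambda>s. indicator {0..t} s * f s" and ?g = "\<lambda>s. indicator {0..t} s * g s"
  let ?F = "\<lambda>s. LINT r:{0..s}|lborel. f r" and ?G = "\<lambda>s. LINT r:{0..s}|lborel. g r"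
  have fi: "integrable lborel ?f" and gi: "integrable lborel ?g"
    using f g by (simp_all add: set_integrable_def)
  have G: "(\<integral>y. indicator {..x} y * ?g y \<partial>lborel) = ?G x" if "x \<le> t" for x
    unfolding set_lebesgue_integral_def
    by (rule Bochner_Integration.integral_cong) (use that in \<open>auto simp: indicator_def\<close>)
  have F: "(\<integral>y. indicator {..x} y * ?f y \<partial>lborel) = ?F x" if "x \<le> t" for x
    unfolding set_lebesgue_integral_def
    by (rule Bochner_Integration.integral_cong) (use that in \<open>auto simp: indicator_def\<close>)
  have iF: "set_integrable lborel {0..t} (\<lambda>s. g s * ?F s)"
    by (intro set_integrable_mult_continuous g continuous_on_indefinite_LINT f)
  have iG: "set_integrable lborel {0..t} (\<lambda>s. f s * ?G s)"
    by (intro set_integrable_mult_continuous g continuous_on_indefinite_LINT f)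
  have "?F t * ?G t = (LINT s:{0..t}|lborel. f s * ?G s) + (LINT s:{0..t}|lborel. g s * ?F s)"
  proof -
    have "?F t * ?G t = (\<integral>x. ?f x * (\<integral>y. indicator {..x} y * ?g y \<partial>lborel) \<partial>lborel) +
      (\<integral>y. (\<integral>x. indicator {..y} x * ?f x \<partial>lborel) * ?g y \<partial>lborel)"
      using integral_product_split[OF fi gi] by (simp add: set_lebesgue_integral_def)
    also have "(\<integral>x. ?f x * (\<integral>y. indicator {..x} y * ?g y \<partial>lborel) \<partial>lborel) = (LINT s:{0..t}|lborel. f s * ?G s)"
      unfolding set_lebesgue_integral_def[of _ "{0..t}"]
      by (rule Bochner_Integration.integral_cong) (auto simp: G[symmetric] indicator_def[of "{0..t}"])
    also have "(\<integral>y. (\<integral>x. indicator {..y} x * ?f x \<partial>lborel) * ?g y \<partial>lborel) = (LINT s:{0..t}|lborel. g s * ?F s)"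
      unfolding set_lebesgue_integral_def[of _ "{0..t}"]
      by (rule Bochner_Integration.integral_cong) (auto simp: F[symmetric] indicator_def[of "{0..t}"])
    finally show ?thesis .
  qed
  moreover have "?R = (LINT s:{0..t}|lborel. (d * f s + f s * ?G s) + (c * g s + g s * ?F s))"
    by (rule set_lebesgue_integral_cong) (auto simp: algebra_simps)
  then have "?R = d * ?F t + (LINT s:{0..t}|lborel. f s * ?G s) +
      (c * ?G t + (LINT s:{0..t}|lborel. g s * ?F s))"
    using f g iF iG by (simp add: set_integral_add)
  ultimately show ?thesis by (simp add: algebra_simps)
qed

lemma LINT_FTC:
  fixes f f' :: "real \<Rightarrow> real"
  assumes "0 \<le> t" "continuous_on {0..t} f'"
    and "\<And>s. s \<in> {0..t} \<Longrightarrow> (f has_vector_derivative f' s) (at s within {0..t})"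
  shows "f t = f 0 + (LINT s:{0..t}|lborel. f' s)" and "set_integrable lborel {0..t} f'"
proof -
  show i: "set_integrable lborel {0..t} f'"
    using borel_integrable_compact[OF compact_Icc assms(2)] by (simp add: set_integrable_def)
  have "(f' has_integral f t - f 0) {0..t}"
    using assms by (intro fundamental_theorem_of_calculus) auto
  then show "f t = f 0 + (LINT s:{0..t}|lborel. f' s)"
    using set_borel_integral_eq_integral(2)[OF i] by (simp add: integral_unique)
qed

lemma LINT_0: "(LINT s:{0::real}|lborel. f s) = (0::real)"
proof -
  have "AE s in lborel. s \<noteq> (0::real)" by (rule AE_lborel_singleton)
  then have "AE s in lborel. indicator {0} s *\<^sub>R f s = (0::real)"
    by (auto elim!: eventually_mono)
  then show ?thesis
    unfolding set_lebesgue_integral_def by (rule integral_eq_zero_AE)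
qed

text \<open>Cauchy-Schwarz against the constant 1, read off from the nonnegative integral of the
  square of |h| minus its mean. The mean divides by T, hence the separate case T = 0.\<close>

lemma LINT_abs_square_le:
  fixes h :: "real \<Rightarrow> real"
  assumes h: "set_integrable lborel {0..T} h" "set_integrable lborel {0..T} (\<lambda>s. (h s)\<^sup>2)" and T: "0 \<le> T"
  shows "(LINT s:{0..T}|lborel. \<bar>h s\<bar>)\<^sup>2 \<le> T * (LINT s:{0..T}|lborel. (h s)\<^sup>2)"
proof (cases "T = 0")
  case True
  then show ?thesis by (simp add: LINT_0)
next
  case False
  let ?m = "(LINT s:{0..T}|lborel. \<bar>h s\<bar>)"
  have c: "set_integrable lborel {0..T} (\<lambda>s. c)" for c :: real
    using borel_integrable_compact[of "{0..T}" "\<lambda>_. c"] by (simp add: set_integrable_def del: integrable_mult_left_iff)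
  have "0 \<le> (LINT s:{0..T}|lborel. (\<bar>h s\<bar> - ?m / T)\<^sup>2)"
    unfolding set_lebesgue_integral_def by (intro Bochner_Integration.integral_nonneg) (auto simp: indicator_def)
  also have "\<dots> = (LINT s:{0..T}|lborel. (h s)\<^sup>2 - (2 * ?m / T) * \<bar>h s\<bar> + (?m / T)\<^sup>2)"
    by (simp add: power2_diff algebra_simps)
  also have "\<dots> = (LINT s:{0..T}|lborel. (h s)\<^sup>2) - (2 * ?m / T) * ?m + (LINT s:{0..T}|lborel. (?m / T)\<^sup>2)"
    by (subst set_integral_add set_integral_diff; (intro set_integral_diff set_integrable_mult_right set_integrable_abs h c)?)+ simp
  also have "(LINT s:{0..T}|lborel. (?m / T)\<^sup>2) = (?m / T)\<^sup>2 * T"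
    using T by (simp add: set_lebesgue_integral_def)
  finally show ?thesis using T False by (simp add: field_simps power2_eq_square)
qed

section \<open>Integrating factors and the scalar linear equation\<close>

definition int_factor :: "(real \<Rightarrow> real) \<Rightarrow> real \<Rightarrow> real" where
  "int_factor a t = exp (LINT s:{0..t}|lborel. a s)"

lemma int_factor_pos [simp]: "0 < int_factor a t"
  by (simp add: int_factor_def)

lemma int_factor_nz [simp]: "int_factor a t \<noteq> 0"
  using int_factor_pos[of a t] by linarith

context
  fixes a :: "real \<Rightarrow> real" and T :: real
  assumes a: "continuous_on {0..T} a"
begin

lemma continuous_set_integrable: "set_integrable lborel {0..T} a"
  using borel_integrable_compact[OF compact_Icc a] by (simp add: set_integrable_def)

lemma continuous_on_int_factor: "continuous_on {0..T} (int_factor a)"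
  unfolding int_factor_def
  by (intro continuous_intros continuous_on_indefinite_LINT continuous_set_integrable)

lemma indefinite_LINT_deriv:
  assumes "s \<in> {0..T}"
  shows "((\<lambda>t. LINT r:{0..t}|lborel. a r) has_vector_derivative a s) (at s within {0..T})"
proof (rule has_vector_derivative_transform[where f="\<lambda>t. integral {0..t} a"])
  show "((\<lambda>t. integral {0..t} a) has_vector_derivative a s) (at s within {0..T})"
    using integral_has_vector_derivative[OF a] assms by auto
  show "(LINT r:{0..t}|lborel. a r) = integral {0..t} a" if "t \<in> {0..T}" for t
    using that by (intro set_borel_integral_eq_integral(2)
        set_integrable_subset[OF continuous_set_integrable]) auto
qed (use assms in auto)

lemma int_factor_deriv:
  assumes "s \<in> {0..T}"
  shows "(int_factor a has_vector_derivative a s * int_factor a s) (at s within {0..T})"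
  using indefinite_LINT_deriv[OF assms] unfolding int_factor_def
  by (auto simp: has_real_derivative_iff_has_vector_derivative[symmetric] intro!: derivative_eq_intros)

lemma int_factor_inverse_deriv:
  assumes "s \<in> {0..T}"
  shows "((\<lambda>t. inverse (int_factor a t)) has_vector_derivative - a s * inverse (int_factor a s)) (at s within {0..T})"
  using indefinite_LINT_deriv[OF assms] unfolding int_factor_def
  by (auto simp: has_real_derivative_iff_has_vector_derivative[symmetric] exp_minus[symmetric] intro!: derivative_eq_intros)

lemma int_factor_0: "int_factor a 0 = 1"
  by (simp add: int_factor_def LINT_0)

lemma continuous_on_inverse_int_factor: "continuous_on {0..T} (\<lambda>s. inverse (int_factor a s))"
  by (intro continuous_on_inverse continuous_on_int_factor) simp

lemma int_factor_eq:
  assumes "t \<in> {0..T}"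
  shows "int_factor a t = 1 + (LINT s:{0..t}|lborel. a s * int_factor a s)"
proof -
  have "continuous_on {0..t} (\<lambda>s. a s * int_factor a s)"
    using assms by (intro continuous_intros continuous_on_subset[OF a]
        continuous_on_subset[OF continuous_on_int_factor]) auto
  moreover have "(int_factor a has_vector_derivative a s * int_factor a s) (at s within {0..t})"
    if "s \<in> {0..t}" for s
    using that assms by (intro has_vector_derivative_within_subset[OF int_factor_deriv]) auto
  ultimately show ?thesis
    using LINT_FTC(1)[of t "\<lambda>s. a s * int_factor a s" "int_factor a"] assms by (simp add: int_factor_0)
qed

lemma int_factor_inverse_eq:
  assumes "t \<in> {0..T}"
  shows "inverse (int_factor a t) = 1 + (LINT s:{0..t}|lborel. - a s * inverse (int_factor a s))"
proof -
  have "continuous_on {0..t} (\<lambda>s. - a s * inverse (int_factor a s))"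
    using assms by (intro continuous_intros continuous_on_subset[OF a]
        continuous_on_subset[OF continuous_on_int_factor]) auto
  moreover have "((\<lambda>s. inverse (int_factor a s)) has_vector_derivative - a s * inverse (int_factor a s)) (at s within {0..t})"
    if "s \<in> {0..t}" for s
    using that assms by (intro has_vector_derivative_within_subset[OF int_factor_inverse_deriv]) auto
  ultimately show ?thesis
    using LINT_FTC(1)[of t "\<lambda>s. - a s * inverse (int_factor a s)" "\<lambda>s. inverse (int_factor a s)"] assms
    by (simp add: int_factor_0)
qed

text \<open>Variation of constants. Both factors in the formula for y are indefinite integrals, so
  the product rule applies and its terms regroup into a y + h.\<close>

lemma linear_ode_solution:
  assumes h: "set_integrable lborel {0..T} h"
    and y: "\<And>t. t \<in> {0..T} \<Longrightarrow> y t =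
      int_factor a t * (c + (LINT s:{0..t}|lborel. inverse (int_factor a s) * h s))"
  shows "continuous_on {0..T} y"
    and "t \<in> {0..T} \<Longrightarrow> y t = c + (LINT s:{0..t}|lborel. a s * y s + h s)"
proof -
  let ?E = "int_factor a"
  have iE: "set_integrable lborel {0..T} (\<lambda>s. inverse (?E s) * h s)"
    using set_integrable_mult_continuous[OF h continuous_on_inverse[OF continuous_on_int_factor]]
    by (simp add: mult.commute)
  show "continuous_on {0..T} y"
    by (subst continuous_on_cong[OF refl y])
      (auto intro!: continuous_intros continuous_on_int_factor continuous_on_indefinite_LINT iE)
  show "y t = c + (LINT s:{0..t}|lborel. a s * y s + h s)" if t: "t \<in> {0..T}"
  proof -
    have E: "?E s = 1 + (LINT r:{0..s}|lborel. a r * ?E r)" if "s \<in> {0..t}" for s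
      using that t by (intro int_factor_eq) auto
    have iaE: "set_integrable lborel {0..T} (\<lambda>s. a s * ?E s)"
      by (intro set_integrable_mult_continuous continuous_set_integrable continuous_on_int_factor)
    have "y t = (c + (LINT s:{0..t}|lborel. inverse (?E s) * h s)) * (1 + (LINT r:{0..t}|lborel. a r * ?E r))"
      using y[OF t] E[of t] t by (simp add: mult.commute)
    also have "\<dots> = c + (LINT s:{0..t}|lborel. inverse (?E s) * h s * (1 + (LINT r:{0..s}|lborel. a r * ?E r)) +
        (c + (LINT r:{0..s}|lborel. inverse (?E r) * h r)) * (a s * ?E s))"
      using t by (subst LINT_mult_by_parts) (auto intro: set_integrable_subset[OF iE] set_integrable_subset[OF iaE])
    also have "\<dots> = c + (LINT s:{0..t}|lborel. a s * y s + h s)"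
      using t by (intro arg_cong[where f="(+) c"] set_lebesgue_integral_cong)
        (auto simp: E[symmetric] y field_simps)
    finally show ?thesis .
  qed
qed

text \<open>Multiplying y by the inverse integrating factor and applying the product rule cancels
  every term with a, so the product is an explicit integral of h. The formula gives uniqueness and
  all later bounds at once.\<close>

lemma linear_ode_unique:
  assumes h: "set_integrable lborel {0..T} h" and yc: "continuous_on {0..T} y"
    and y: "\<And>t. t \<in> {0..T} \<Longrightarrow> y t = c + (LINT s:{0..t}|lborel. a s * y s + h s)"
    and t: "t \<in> {0..T}"
  shows "y t = int_factor a t * (c + (LINT s:{0..t}|lborel. inverse (int_factor a s) * h s))"
proof -
  let ?E = "\<lambda>t. inverse (int_factor a t)"
  have Ec: "continuous_on {0..T} ?E"
    by (intro continuous_on_inverse continuous_on_int_factor) simp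
  have E: "?E s = 1 + (LINT r:{0..s}|lborel. - a r * ?E r)" if "s \<in> {0..t}" for s
    using that t by (intro int_factor_inverse_eq) auto
  have iaE: "set_integrable lborel {0..T} (\<lambda>s. - a s * ?E s)"
    using set_integrable_mult_right[of "- 1", OF set_integrable_mult_continuous[OF continuous_set_integrable Ec]]
    by simp
  have iay: "set_integrable lborel {0..T} (\<lambda>s. a s * y s + h s)"
    by (intro set_integral_add set_integrable_mult_continuous continuous_set_integrable yc h)
  have "y t * ?E t = (c + (LINT s:{0..t}|lborel. a s * y s + h s)) * (1 + (LINT r:{0..t}|lborel. - a r * ?E r))"
    using y[OF t] E[of t] t by simp
  also have "\<dots> = c + (LINT s:{0..t}|lborel. (a s * y s + h s) * (1 + (LINT r:{0..s}|lborel. - a r * ?E r)) +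
      (c + (LINT r:{0..s}|lborel. a r * y r + h r)) * (- a s * ?E s))"
    using t by (subst LINT_mult_by_parts) (auto intro: set_integrable_subset[OF iay] set_integrable_subset[OF iaE, simplified])
  also have "\<dots> = c + (LINT s:{0..t}|lborel. ?E s * h s)"
  proof (intro arg_cong[where f="(+) c"] set_lebesgue_integral_cong allI impI)
    fix s assume s: "s \<in> {0..t}"
    then have s': "s \<in> {0..T}" using t by auto
    then show "(a s * y s + h s) * (1 + (LINT r:{0..s}|lborel. - a r * ?E r)) +
      (c + (LINT r:{0..s}|lborel. a r * y r + h r)) * (- a s * ?E s) = ?E s * h s"
      unfolding E[OF s, symmetric] y[OF s', symmetric] by (simp add: algebra_simps)
  qed simp
  finally show ?thesis by (simp add: field_simps)
qed

text \<open>B is chosen before h, y and t and depends on a and T alone, through the bounds of the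
  integrating factor and of its inverse on a compact interval. The final constant inherits its
  independence of the cost coefficients from this order of quantifiers.\<close>

lemma linear_ode_bound:
  "\<exists>B\<ge>0. \<forall>h y t. set_integrable lborel {0..T} h \<and> set_integrable lborel {0..T} (\<lambda>s. (h s)\<^sup>2) \<and>
     t \<in> {0..T} \<and> y t = int_factor a t * (LINT s:{0..t}|lborel. inverse (int_factor a s) * h s) \<longrightarrow>
     (y t)\<^sup>2 \<le> B * (LINT s:{0..T}|lborel. (h s)\<^sup>2)"
proof -
  let ?E = "int_factor a"
  have Ec: "continuous_on {0..T} (\<lambda>s. inverse (?E s))"
    by (intro continuous_on_inverse continuous_on_int_factor) simp
  have "bounded (?E ` {0..T})" "bounded ((\<lambda>s. inverse (?E s)) ` {0..T})"
    by (intro compact_imp_bounded compact_continuous_image continuous_on_int_factor Ec; simp)+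
  then obtain B1 B2 where B: "\<And>s. s \<in> {0..T} \<Longrightarrow> \<bar>?E s\<bar> \<le> B1"
    "\<And>s. s \<in> {0..T} \<Longrightarrow> \<bar>inverse (?E s)\<bar> \<le> B2"
    by (metis (no_types, lifting) bounded_iff imageI real_norm_def)
  show ?thesis
  \<comment> \<open>The square comes from squaring the pointwise bound, the factor T from
    Cauchy-Schwarz in time. The absolute value is there because the sign of T is known only once
    some t lies in the interval.\<close>
  proof (intro exI[of _ "(B1 * B2)\<^sup>2 * \<bar>T\<bar>"] conjI allI impI; (elim conjE)?)
    fix h y :: "real \<Rightarrow> real" and t
    assume h: "set_integrable lborel {0..T} h" "set_integrable lborel {0..T} (\<lambda>s. (h s)\<^sup>2)"
      and t: "t \<in> {0..T}" and y: "y t = ?E t * (LINT s:{0..t}|lborel. inverse (?E s) * h s)"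
    have T: "0 \<le> T" and B0: "0 \<le> B1" "0 \<le> B2"
      using t order_trans[OF abs_ge_zero B(1)[OF t]] order_trans[OF abs_ge_zero B(2)[OF t]] by auto
    have iE: "set_integrable lborel {0..T} (\<lambda>s. inverse (?E s) * h s)"
      using set_integrable_mult_continuous[OF h(1) Ec] by (simp add: mult.commute)
    have "\<bar>LINT s:{0..t}|lborel. inverse (?E s) * h s\<bar> \<le> (LINT s:{0..T}|lborel. B2 * \<bar>h s\<bar>)"
    proof -
      have "\<bar>LINT s:{0..t}|lborel. inverse (?E s) * h s\<bar> \<le> (\<integral>s. \<bar>indicator {0..t} s *\<^sub>R (inverse (?E s) * h s)\<bar> \<partial>lborel)"
        unfolding set_lebesgue_integral_def using integral_norm_bound[of lborel] by simp
      also have "\<dots> \<le> (LINT s:{0..T}|lborel. B2 * \<bar>h s\<bar>)"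
        unfolding set_lebesgue_integral_def
      proof (rule integral_mono)
        show "integrable lborel (\<lambda>s. \<bar>indicator {0..t} s *\<^sub>R (inverse (?E s) * h s)\<bar>)"
          using set_integrable_subset[OF iE, of "{0..t}"] t by (intro integrable_abs) (auto simp: set_integrable_def)
        show "integrable lborel (\<lambda>s. indicator {0..T} s *\<^sub>R (B2 * \<bar>h s\<bar>))"
          using set_integrable_mult_right[of B2, OF set_integrable_abs[OF h(1)]] by (simp add: set_integrable_def)
        show "\<bar>indicator {0..t} s *\<^sub>R (inverse (?E s) * h s)\<bar> \<le> indicator {0..T} s *\<^sub>R (B2 * \<bar>h s\<bar>)" for s
          using B(2)[of s] t B0(2) by (auto simp: indicator_def abs_mult intro!: mult_right_mono)
      qed
      finally show ?thesis .
    qed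
    also have "\<dots> = B2 * (LINT s:{0..T}|lborel. \<bar>h s\<bar>)" by simp
    finally have "\<bar>y t\<bar> \<le> B1 * (B2 * (LINT s:{0..T}|lborel. \<bar>h s\<bar>))"
      unfolding y abs_mult using B(1)[OF t] B0 by (intro mult_mono) auto
    then have "\<bar>y t\<bar>\<^sup>2 \<le> (B1 * (B2 * (LINT s:{0..T}|lborel. \<bar>h s\<bar>)))\<^sup>2"
      by (intro power_mono) auto
    also have "\<dots> = (B1 * B2)\<^sup>2 * (LINT s:{0..T}|lborel. \<bar>h s\<bar>)\<^sup>2"
      by (simp add: power_mult_distrib)
    also have "\<dots> \<le> (B1 * B2)\<^sup>2 * (T * (LINT s:{0..T}|lborel. (h s)\<^sup>2))"
      by (intro mult_left_mono LINT_abs_square_le h T) auto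
    finally show "(y t)\<^sup>2 \<le> (B1 * B2)\<^sup>2 * \<bar>T\<bar> * (LINT s:{0..T}|lborel. (h s)\<^sup>2)"
      using T by (simp add: mult.assoc)
  qed auto
qed

end

section \<open>Brownian increments\<close>

locale brownian = prob_space M for M :: "'w measure" +
  fixes T :: real and W :: "real \<Rightarrow> 'w \<Rightarrow> real ^ 'n"
  assumes T_pos: "0 < T" and complete_M: "complete_measure M" and BM: "brownian_motion M T W"
begin

abbreviation FW :: "real \<Rightarrow> 'w measure" where "FW \<equiv> brownian_filtration M W"

lemma W_meas: "t \<in> {0..T} \<Longrightarrow> W t \<in> borel_measurable M"
  using BM by (auto simp: brownian_motion_def)

lemma FW_gen_subset: "{W s -` B \<inter> space M | s B. s \<in> {0..t} \<and> B \<in> sets borel} \<union> null_sets M \<subseteq> Pow (space M)"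
  by (auto dest: null_setsD2 sets.sets_into_space)

lemma space_FW [simp]: "space (FW t) = space M"
  using FW_gen_subset by (simp add: brownian_filtration_def space_measure_of)

lemma sets_FW: "sets (FW t) = sigma_sets (space M)
    ({W s -` B \<inter> space M | s B. s \<in> {0..t} \<and> B \<in> sets borel} \<union> null_sets M)"
  using FW_gen_subset by (simp add: brownian_filtration_def sets_measure_of)

lemma null_in_FW: "N \<in> null_sets M \<Longrightarrow> N \<in> sets (FW t)"
  unfolding sets_FW by auto

lemma FW_mono: "s \<le> t \<Longrightarrow> sets (FW s) \<subseteq> sets (FW t)"
  unfolding sets_FW by (intro sigma_sets_mono') fastforce

lemma subalgebra_FW:
  assumes "t \<in> {0..T}"
  shows "subalgebra M (FW t)"
proof -
  have "W s -` B \<inter> space M \<in> sets M" if "s \<in> {0..t}" "B \<in> sets borel" for s B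
    using W_meas[of s] that assms by (auto intro: measurable_sets)
  then show ?thesis
    unfolding subalgebra_def sets_FW by (auto intro!: sets.sigma_sets_subset)
qed

lemma W_meas_FW: "s \<in> {0..t} \<Longrightarrow> W s \<in> borel_measurable (FW t)"
  by (intro measurableI) (auto simp: sets_FW)

lemma measurable_FW_M: "t \<in> {0..T} \<Longrightarrow> X \<in> borel_measurable (FW t) \<Longrightarrow> X \<in> borel_measurable M"
  using subalgebra_FW measurable_from_subalg by blast

lemma measurable_FW_mono: "s \<le> t \<Longrightarrow> X \<in> borel_measurable (FW s) \<Longrightarrow> X \<in> borel_measurable (FW t)"
  using FW_mono[of s t] by (auto simp: measurable_def)

lemma null_subset: "N \<in> null_sets M \<Longrightarrow> A \<subseteq> N \<Longrightarrow> A \<in> null_sets M"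
  using complete_M by (auto simp: complete_measure_def intro: null_sets_subset)

text \<open>Every \<open>FW t\<close> contains all null sets, and by completeness every subset of a
  null set is one. Changing a variable on a null set therefore never destroys adaptedness.\<close>

lemma measurable_FW_AE:
  assumes Y: "Y \<in> borel_measurable (FW t)" and ae: "AE \<omega> in M. X \<omega> = Y \<omega>"
  shows "X \<in> borel_measurable (FW t)"
proof (rule measurableI)
  obtain N where N: "N \<in> null_sets M" "{\<omega>\<in>space M. X \<omega> \<noteq> Y \<omega>} \<subseteq> N"
    using AE_E[OF ae] by (metis (mono_tags, lifting) null_setsI)
  fix B :: "'a set" assume "B \<in> sets borel"
  then have "Y -` B \<inter> space M \<in> sets (FW t)"
    using measurable_sets[OF Y] by simp
  moreover have "X -` B \<inter> space M = (Y -` B \<inter> space M - N) \<union> (X -` B \<inter> space M \<inter> N)"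
    using N(2) by auto
  ultimately show "X -` B \<inter> space (FW t) \<in> sets (FW t)"
    using null_in_FW[OF N(1), of t] null_in_FW[OF null_subset[OF N(1)], of "X -` B \<inter> space M \<inter> N" t]
    by (metis Int_lower2 sets.Diff sets.Un space_FW)
qed simp

definition dW :: "real \<Rightarrow> real \<Rightarrow> 'n \<Rightarrow> 'w \<Rightarrow> real" where
  "dW s t j \<omega> = W t \<omega> $ j - W s \<omega> $ j"

lemma dW_same [simp]: "dW s s j = (\<lambda>\<omega>. 0)"
  by (simp add: dW_def fun_eq_iff)

text \<open>Gaussian moments for equal indices, independence of the components for different ones.
  The case s = t is apart because the normal density would have deviation zero.\<close>

lemma dW_moments:
  assumes "0 \<le> s" "s \<le> t" "t \<le> T"
  shows "integrable M (dW s t i)" "expectation (dW s t i) = 0"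
    "integrable M (\<lambda>\<omega>. dW s t i \<omega> * dW s t j \<omega>)"
    "expectation (\<lambda>\<omega>. dW s t i \<omega> * dW s t j \<omega>) = (if i = j then t - s else 0)"
proof -
  have "((integrable M (dW s t i) \<and> expectation (dW s t i) = 0) \<and>
      integrable M (\<lambda>\<omega>. dW s t i \<omega> * dW s t j \<omega>)) \<and>
      expectation (\<lambda>\<omega>. dW s t i \<omega> * dW s t j \<omega>) = (if i = j then t - s else 0)"
  proof (cases "s = t")
  case True
  then show ?thesis
    by simp
next
  case False
  then have st: "s < t" using assms by simp
  have D: "distributed M lborel (dW s t i) (normal_density 0 (sqrt (t - s)))" for i
    using BM st assms by (auto simp: brownian_motion_def dW_def[abs_def])
  have ind: "indep_vars (\<lambda>_. borel) (\<lambda>i \<omega>. dW s t i \<omega>) UNIV"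
    using BM st assms by (auto simp: brownian_motion_def dW_def[abs_def])
  have sq: "0 < sqrt (t - s)" using st by simp
  have i1: "integrable M (dW s t i)" for i
    using distributed_integrable[OF D, of "\<lambda>x. x" i] integrable_normal_moment_nz_1[OF sq, of 0]
    by simp
  have e1: "expectation (dW s t i) = 0" for i
    using distributed_integral[OF D, of "\<lambda>x. x" i] integral_normal_moment_nz_1[OF sq, of 0]
    by simp
  have i2: "integrable M (\<lambda>\<omega>. (dW s t i \<omega>)\<^sup>2)" for i
    using distributed_integrable[OF D, of "\<lambda>x. x\<^sup>2" i] integrable_normal_moment[OF sq, of 0 2]
    by simp
  have e2: "expectation (\<lambda>\<omega>. (dW s t i \<omega>)\<^sup>2) = t - s" for i
    using distributed_integral[OF D, of "\<lambda>x. x\<^sup>2" i] integral_normal_moment_even[OF sq, of 0 1] st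
    by (simp add: power2_eq_square field_simps)
  show ?thesis
  proof (cases "i = j")
    case True
    then show ?thesis using i1 e1 i2[of j] e2[of j] by (simp add: power2_eq_square)
  next
    case False
    have ind2: "indep_vars (\<lambda>_. borel) (\<lambda>i \<omega>. dW s t i \<omega>) {i, j}"
      by (rule indep_vars_subset[OF ind]) auto
    have "expectation (\<lambda>\<omega>. \<Prod>k\<in>{i, j}. dW s t k \<omega>) = (\<Prod>k\<in>{i, j}. expectation (dW s t k))"
      by (rule indep_vars_lebesgue_integral[OF _ ind2 i1]) simp
    moreover have "integrable M (\<lambda>\<omega>. \<Prod>k\<in>{i, j}. dW s t k \<omega>)"
      by (rule indep_vars_integrable[OF _ ind2 i1]) simp
    ultimately show ?thesis using False i1 e1 by simp
  qed
  qed
  then show "integrable M (dW s t i)"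
    "expectation (dW s t i) = 0"
    "integrable M (\<lambda>\<omega>. dW s t i \<omega> * dW s t j \<omega>)"
    "expectation (\<lambda>\<omega>. dW s t i \<omega> * dW s t j \<omega>) = (if i = j then t - s else 0)"
    by simp_all
qed

end

text \<open>What the isometry needs to know of a filtration, isolated because it is used for
  \<open>FW\<close> and again for the filtration enlarged by the sigma-field that carries
  \<open>r\<close>.\<close>

locale brownian_wrt = brownian M T W for M :: "'w measure" and T and W :: "real \<Rightarrow> 'w \<Rightarrow> real ^ 'n" +
  fixes Fil :: "real \<Rightarrow> 'w measure"
  assumes subalgebra_Fil: "t \<in> {0..T} \<Longrightarrow> subalgebra M (Fil t)"
    and Fil_mono: "0 \<le> s \<Longrightarrow> s \<le> t \<Longrightarrow> t \<le> T \<Longrightarrow> sets (Fil s) \<subseteq> sets (Fil t)"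
    and W_meas_Fil: "t \<in> {0..T} \<Longrightarrow> W t \<in> borel_measurable (Fil t)"
    and indep_Fil: "0 \<le> s \<Longrightarrow> s < t \<Longrightarrow> t \<le> T \<Longrightarrow>
      indep_set (sets (Fil s)) {(\<lambda>\<omega>. W t \<omega> - W s \<omega>) -` B \<inter> space M | B. B \<in> sets borel}"
begin

lemma space_Fil: "t \<in> {0..T} \<Longrightarrow> space (Fil t) = space M"
  using subalgebra_Fil by (auto simp: subalgebra_def)

lemma measurable_Fil_M: "t \<in> {0..T} \<Longrightarrow> X \<in> borel_measurable (Fil t) \<Longrightarrow> X \<in> borel_measurable M"
  using subalgebra_Fil measurable_from_subalg by blast

lemma measurable_Fil_mono:
  "0 \<le> s \<Longrightarrow> s \<le> t \<Longrightarrow> t \<le> T \<Longrightarrow> X \<in> borel_measurable (Fil s) \<Longrightarrow> X \<in> borel_measurable (Fil t)"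
  using Fil_mono[of s t] space_Fil[of s] space_Fil[of t] by (auto simp: measurable_def)

lemma dW_meas_Fil:
  assumes "0 \<le> s" "s \<le> t" "t \<le> T"
  shows "dW s t j \<in> borel_measurable (Fil t)"
proof -
  have "W s \<in> borel_measurable (Fil t)" "W t \<in> borel_measurable (Fil t)"
    using assms by (auto intro!: measurable_Fil_mono[of s t] W_meas_Fil)
  then show ?thesis
    unfolding dW_def by (auto intro!: borel_measurable_diff measurable_compose[OF _ borel_measurable_nth])
qed

text \<open>Passes from independence of sigma-fields to independence of variables. The function g of
  the whole increment covers both uses at once: one component, and the product of two
  components.\<close>

lemma indep_increment:
  assumes st: "0 \<le> s" "s < t" "t \<le> T" and Z: "Z \<in> borel_measurable (Fil s)"
    and g: "g \<in> borel_measurable borel"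
  shows "indep_var borel Z borel (\<lambda>\<omega>. g (W t \<omega> - W s \<omega>) :: real)"
proof -
  have Zm: "Z \<in> borel_measurable M" using measurable_Fil_M[OF _ Z] st by simp
  have Wm: "(\<lambda>\<omega>. W t \<omega> - W s \<omega>) \<in> borel_measurable M"
    using W_meas[of s] W_meas[of t] st by auto
  have "indep_set (sets (Fil s)) {(\<lambda>\<omega>. W t \<omega> - W s \<omega>) -` B \<inter> space M | B. B \<in> sets borel}"
    using indep_Fil[of s t] st by simp
  then have "indep_set {Z -` A \<inter> space M |A. A \<in> sets borel}
      {(\<lambda>\<omega>. g (W t \<omega> - W s \<omega>)) -` A \<inter> space M |A. A \<in> sets borel}"
    unfolding indep_set_def
  proof (rule indep_sets_mono_sets)
    fix b :: bool
    show "case_bool {Z -` A \<inter> space M |A. A \<in> sets borel}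
      {(\<lambda>\<omega>. g (W t \<omega> - W s \<omega>)) -` A \<inter> space M |A. A \<in> sets borel} b
      \<subseteq> case_bool (sets (Fil s)) {(\<lambda>\<omega>. W t \<omega> - W s \<omega>) -` B \<inter> space M | B. B \<in> sets borel} b"
    proof (cases b)
      case True
      then show ?thesis using measurable_sets[OF Z] space_Fil[of s] st by auto
    next
      case False
      have "(\<lambda>\<omega>. g (W t \<omega> - W s \<omega>)) -` A \<inter> space M = (\<lambda>\<omega>. W t \<omega> - W s \<omega>) -` (g -` A) \<inter> space M"
        "A \<in> sets borel \<Longrightarrow> g -` A \<in> sets borel" for A
        using measurable_sets_borel[OF g] by auto
      then show ?thesis using False by auto blast
    qed
  qed
  moreover have "Int_stable {X -` A \<inter> space M |A. A \<in> sets S}" for X :: "'w \<Rightarrow> 'c" and S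
  proof (safe intro!: Int_stableI)
    fix A B assume "A \<in> sets S" "B \<in> sets S"
    then show "\<exists>C. (X -` A \<inter> space M) \<inter> (X -` B \<inter> space M) = (X -` C \<inter> space M) \<and> C \<in> sets S"
      by (intro exI[of _ "A \<inter> B"]) auto
  qed
  ultimately show ?thesis
    unfolding indep_var_eq using Zm measurable_compose[OF Wm g]
    by (intro conjI indep_set_sigma_sets)
qed

text \<open>The conditional first and second moments of an increment given \<open>Fil s\<close>, in
  weak form: tested against Z instead of written as conditional expectations.\<close>

lemma dW_orthogonal:
  assumes st: "0 \<le> s" "s \<le> t" "t \<le> T" and Z: "Z \<in> borel_measurable (Fil s)" "integrable M Z"
  shows "integrable M (\<lambda>\<omega>. Z \<omega> * dW s t i \<omega>)" "expectation (\<lambda>\<omega>. Z \<omega> * dW s t i \<omega>) = 0"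
    "integrable M (\<lambda>\<omega>. Z \<omega> * (dW s t i \<omega> * dW s t j \<omega>))"
    "expectation (\<lambda>\<omega>. Z \<omega> * (dW s t i \<omega> * dW s t j \<omega>)) = (if i = j then (t - s) * expectation Z else 0)"
proof -
  have "((integrable M (\<lambda>\<omega>. Z \<omega> * dW s t i \<omega>) \<and> expectation (\<lambda>\<omega>. Z \<omega> * dW s t i \<omega>) = 0) \<and>
    integrable M (\<lambda>\<omega>. Z \<omega> * (dW s t i \<omega> * dW s t j \<omega>))) \<and>
    expectation (\<lambda>\<omega>. Z \<omega> * (dW s t i \<omega> * dW s t j \<omega>)) = (if i = j then (t - s) * expectation Z else 0)"
  proof (cases "s = t")
  case True
  then show ?thesis
    by simp
next
  case False
  then have lt: "s < t" using st by simp
  have d: "dW s t i = (\<lambda>\<omega>. (W t \<omega> - W s \<omega>) $ i)" for i by (simp add: dW_def fun_eq_iff)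
  have 1: "indep_var borel Z borel (dW s t i)"
    unfolding d by (rule indep_increment[OF st(1) lt st(3) Z(1), of "\<lambda>x. x $ i"]) measurable
  have 2: "indep_var borel Z borel (\<lambda>\<omega>. dW s t i \<omega> * dW s t j \<omega>)"
    unfolding d by (rule indep_increment[OF st(1) lt st(3) Z(1), of "\<lambda>x. x $ i * x $ j"]) measurable
  note m = dW_moments[OF st]
  show ?thesis
    using indep_var_lebesgue_integral[OF 1 Z(2) m(1)] indep_var_integrable[OF 1 Z(2) m(1)]
      indep_var_lebesgue_integral[OF 2 Z(2) m(3)] indep_var_integrable[OF 2 Z(2) m(3)] m(2,4)
    by simp
  qed
  then show "integrable M (\<lambda>\<omega>. Z \<omega> * dW s t i \<omega>)"
    "expectation (\<lambda>\<omega>. Z \<omega> * dW s t i \<omega>) = 0"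
    "integrable M (\<lambda>\<omega>. Z \<omega> * (dW s t i \<omega> * dW s t j \<omega>))"
    "expectation (\<lambda>\<omega>. Z \<omega> * (dW s t i \<omega> * dW s t j \<omega>)) = (if i = j then (t - s) * expectation Z else 0)"
    by simp_all
qed

lemma integrable_bounded_Fil:
  assumes "t \<in> {0..T}" "Z \<in> borel_measurable (Fil t)" "\<And>\<omega>. \<omega> \<in> space M \<Longrightarrow> \<bar>Z \<omega>\<bar> \<le> (B :: real)"
  shows "integrable M (Z :: 'w \<Rightarrow> real)"
  using assms measurable_Fil_M[OF assms(1,2)] by (intro integrable_const_bound[of _ B]) auto

text \<open>The value is the length of the overlap of the two intervals times E of the product of
  the coefficients. Both increments are cut at c and at the end of the overlap; only the common
  piece contributes, since every other product contains an increment that lies after all other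
  factors.\<close>

lemma dW_pair_aux:
  assumes ab: "0 \<le> a" "a \<le> b" "b \<le> T" and cd: "a \<le> c" "c \<le> d" "d \<le> T"
    and \<xi>: "\<xi> \<in> borel_measurable (Fil a)" "\<And>\<omega>. \<omega> \<in> space M \<Longrightarrow> \<bar>\<xi> \<omega>\<bar> \<le> B"
    and \<eta>: "\<eta> \<in> borel_measurable (Fil c)" "\<And>\<omega>. \<omega> \<in> space M \<Longrightarrow> \<bar>\<eta> \<omega>\<bar> \<le> B'"
  shows "has_bochner_integral M (\<lambda>\<omega>. (\<xi> \<omega> * dW a b i \<omega>) * (\<eta> \<omega> * dW c d j \<omega>))
    (if i = j then max 0 (min b d - max a c) * expectation (\<lambda>\<omega>. \<xi> \<omega> * \<eta> \<omega>) else 0)"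
proof -
  let ?Z = "\<lambda>\<omega>. \<xi> \<omega> * \<eta> \<omega>"
  have Zb: "\<bar>?Z \<omega>\<bar> \<le> B * B'" if "\<omega> \<in> space M" for \<omega>
    using \<xi>(2)[OF that] \<eta>(2)[OF that] by (auto simp: abs_mult intro!: mult_mono)
  have Zm: "?Z \<in> borel_measurable (Fil t)" if "c \<le> t" "t \<le> T" for t
    using measurable_Fil_mono[of a t \<xi>] measurable_Fil_mono[of c t \<eta>] that ab cd \<xi> \<eta> by auto
  have Zi: "integrable M ?Z"
    using integrable_bounded_Fil[OF _ Zm Zb, of c] ab cd by auto
  \<comment> \<open>A product whose last factor is a later increment has mean zero: the preceding
    factors are measurable at its starting time v.\<close>
  have mixed: "has_bochner_integral M (\<lambda>\<omega>. ?Z \<omega> * dW p q k \<omega> * dW v w l \<omega>) 0"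
    if *: "0 \<le> p" "p \<le> q" "q \<le> v" "v \<le> w" "w \<le> T" "c \<le> v" and
      Y: "(\<lambda>\<omega>. ?Z \<omega> * dW p q k \<omega>) \<in> borel_measurable (Fil v)" for p q v w k l
  proof -
    have "integrable M (\<lambda>\<omega>. ?Z \<omega> * dW p q k \<omega>)"
    proof (rule Bochner_Integration.integrable_bound)
      show "integrable M (\<lambda>\<omega>. (B * B') * dW p q k \<omega>)"
        using dW_moments(1)[of p q k] * by auto
      show "(\<lambda>\<omega>. ?Z \<omega> * dW p q k \<omega>) \<in> borel_measurable M"
        using measurable_Fil_M[OF _ Y] * by auto
      show "AE \<omega> in M. norm (?Z \<omega> * dW p q k \<omega>) \<le> norm ((B * B') * dW p q k \<omega>)"
      proof (intro AE_I2)
        fix \<omega> assume "\<omega> \<in> space M"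
        from mult_right_mono[OF order_trans[OF Zb[OF this] abs_ge_self], of "\<bar>dW p q k \<omega>\<bar>"]
        show "norm (?Z \<omega> * dW p q k \<omega>) \<le> norm ((B * B') * dW p q k \<omega>)"
          by (simp only: real_norm_def abs_mult)
      qed
    qed
    with dW_orthogonal[of v w, OF _ _ _ Y] show ?thesis
      using * by (auto simp: has_bochner_integral_iff)
  qed
  have mZ: "(\<lambda>\<omega>. ?Z \<omega> * dW p q k \<omega>) \<in> borel_measurable (Fil v)" if "0 \<le> p" "p \<le> q" "q \<le> v" "c \<le> v" "v \<le> T" for p q v k
    using Zm[of v] that measurable_Fil_mono[OF _ _ _ dW_meas_Fil[of p q k], of v] by auto
  show ?thesis
  proof (cases "b \<le> c")
    case True
    have "has_bochner_integral M (\<lambda>\<omega>. ?Z \<omega> * dW a b i \<omega> * dW c d j \<omega>) 0"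
      using ab cd True by (intro mixed mZ) auto
    moreover have "max 0 (min b d - max a c) = 0" using True ab cd by (auto simp: min_def max_def)
    ultimately show ?thesis by (simp only: if_cancel mult_zero_left) (simp add: mult_ac)
  next
    case False
    \<comment> \<open>The right end of the overlap; the left end is c, because a <= c.\<close>
    define e where "e = min b d"
    have e: "c \<le> e" "e \<le> b" "e \<le> d" "e \<le> T" using False cd by (auto simp: e_def)
    have 1: "has_bochner_integral M (\<lambda>\<omega>. ?Z \<omega> * dW a c i \<omega> * dW c d j \<omega>) 0"
      using ab cd by (intro mixed mZ) auto
    have 2: "has_bochner_integral M (\<lambda>\<omega>. ?Z \<omega> * (dW c e i \<omega> * dW c e j \<omega>))
        (if i = j then (e - c) * expectation ?Z else 0)"
      using dW_orthogonal(3,4)[of c e ?Z i j] Zm[of c] Zi e cd ab by (auto simp: has_bochner_integral_iff)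
    have 3: "has_bochner_integral M (\<lambda>\<omega>. ?Z \<omega> * dW c e i \<omega> * dW e d j \<omega>) 0"
      using ab cd e by (intro mixed mZ) auto
    have 4: "has_bochner_integral M (\<lambda>\<omega>. ?Z \<omega> * dW c e j \<omega> * dW e b i \<omega>) 0"
      using ab cd e by (intro mixed mZ) auto
    \<comment> \<open>Since e is one of b and d, one of the two increments after e is taken over a
      single point.\<close>
    have 0: "dW e b i \<omega> * dW e d j \<omega> = 0" for \<omega>
      by (cases "b \<le> d") (auto simp: e_def min_def)
    have "(\<xi> \<omega> * dW a b i \<omega>) * (\<eta> \<omega> * dW c d j \<omega>) =
        ((?Z \<omega> * dW a c i \<omega> * dW c d j \<omega> + ?Z \<omega> * (dW c e i \<omega> * dW c e j \<omega>)) +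
        ?Z \<omega> * dW c e i \<omega> * dW e d j \<omega>) + ?Z \<omega> * dW c e j \<omega> * dW e b i \<omega>" for \<omega>
    proof -
      have "dW a b i \<omega> = dW a c i \<omega> + (dW c e i \<omega> + dW e b i \<omega>)" "dW c d j \<omega> = dW c e j \<omega> + dW e d j \<omega>"
        by (simp_all add: dW_def)
      then have "(\<xi> \<omega> * dW a b i \<omega>) * (\<eta> \<omega> * dW c d j \<omega>) = ?Z \<omega> * dW a c i \<omega> * dW c d j \<omega> +
          ?Z \<omega> * ((dW c e i \<omega> + dW e b i \<omega>) * (dW c e j \<omega> + dW e d j \<omega>))"
        by (simp add: algebra_simps)
      then show ?thesis using 0[of \<omega>] by (simp add: algebra_simps)
    qed
    moreover have "max 0 (min b d - max a c) = e - c"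
      using False cd ab e by (auto simp: e_def max_def)
    ultimately show ?thesis
      using has_bochner_integral_add[OF has_bochner_integral_add[OF has_bochner_integral_add[OF 1 2] 3] 4]
      by (simp only: add_0_left add_0_right)
  qed
qed

lemma dW_pair:
  assumes ab: "0 \<le> a" "a \<le> b" "b \<le> T" and cd: "0 \<le> c" "c \<le> d" "d \<le> T"
    and \<xi>: "\<xi> \<in> borel_measurable (Fil a)" "\<And>\<omega>. \<omega> \<in> space M \<Longrightarrow> \<bar>\<xi> \<omega>\<bar> \<le> B"
    and \<eta>: "\<eta> \<in> borel_measurable (Fil c)" "\<And>\<omega>. \<omega> \<in> space M \<Longrightarrow> \<bar>\<eta> \<omega>\<bar> \<le> B'"
  shows "has_bochner_integral M (\<lambda>\<omega>. (\<xi> \<omega> * dW a b i \<omega>) * (\<eta> \<omega> * dW c d j \<omega>))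
    (if i = j then max 0 (min b d - max a c) * expectation (\<lambda>\<omega>. \<xi> \<omega> * \<eta> \<omega>) else 0)"
proof (cases "a \<le> c")
  case True
  then show ?thesis using dW_pair_aux[OF ab _ _ _ \<xi> \<eta>] cd by simp
next
  case False
  then have "c \<le> a" by simp
  from dW_pair_aux[OF cd this ab(2,3) \<eta> \<xi>, of j i] show ?thesis
    by (auto simp: mult.commute min.commute max.commute split: if_splits)
qed

text \<open>Both integrals stopped at t. If an interval starts after t, its stopped increment
  vanishes, and \<open>max 0\<close> makes the overlap length vanish as well.\<close>

lemma dW_pair_min:
  assumes ab: "0 \<le> a" "a \<le> b" "b \<le> T" and cd: "0 \<le> c" "c \<le> d" "d \<le> T" and t: "t \<in> {0..T}"
    and \<xi>: "\<xi> \<in> borel_measurable (Fil a)" "\<And>\<omega>. \<omega> \<in> space M \<Longrightarrow> \<bar>\<xi> \<omega>\<bar> \<le> B"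
    and \<eta>: "\<eta> \<in> borel_measurable (Fil c)" "\<And>\<omega>. \<omega> \<in> space M \<Longrightarrow> \<bar>\<eta> \<omega>\<bar> \<le> B'"
  shows "has_bochner_integral M (\<lambda>\<omega>. (\<xi> \<omega> * dW (min a t) (min b t) i \<omega>) * (\<eta> \<omega> * dW (min c t) (min d t) j \<omega>))
    (if i = j then max 0 (min t (min b d) - max a c) * expectation (\<lambda>\<omega>. \<xi> \<omega> * \<eta> \<omega>) else 0)"
proof (cases "a \<le> t \<and> c \<le> t")
  case True
  then have m: "min a t = a" "min c t = c" "min t (min b d) = min (min b t) (min d t)"
    by (auto simp: min_def)
  show ?thesis
    unfolding m using ab cd t True by (intro dW_pair[OF _ _ _ _ _ _ \<xi> \<eta>]) auto
next
  case False
  then have "min t (min b d) - max a c \<le> 0" by (auto simp: min_def max_def)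
  then have *: "max 0 (min t (min b d) - max a c) = 0" by simp
  from False show ?thesis
  proof (cases "a \<le> t")
    case True
    then have "min c t = t" "min d t = t" using False cd by auto
    then show ?thesis using * by (simp add: has_bochner_integral_zero)
  next
    case a: False
    then have "min a t = t" "min b t = t" using ab by auto
    then show ?thesis using * by (simp add: has_bochner_integral_zero)
  qed
qed

end

section \<open>The Brownian filtration and its independent enlargement\<close>

context brownian
begin

lemma brownian_wrt_FW: "brownian_wrt M T W FW"
proof unfold_locales
  show "indep_set (sets (FW s)) {(\<lambda>\<omega>. W t \<omega> - W s \<omega>) -` B \<inter> space M | B. B \<in> sets borel}"
    if "0 \<le> s" "s < t" "t \<le> T" for s t
    using BM that by (auto simp: brownian_motion_def)
qed (use subalgebra_FW FW_mono W_meas_FW in auto)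

text \<open>An independent enlargement keeps increments independent of the past. It suffices to
  check this on intersections of a set of \<open>FW s\<close> with a set of \<open>G\<close>, which
  are stable under intersection and generate the enlarged field. Independence of \<open>G\<close>
  from all of \<open>FW T\<close> is what is used, because the increment looks beyond s.\<close>

lemma enlarged_wrt:
  assumes G: "subalgebra M G" and ind: "indep_set (sets G) (sets (FW T))"
  shows "space (enlarged_filtration FW G s) = space M"
    and "sets (enlarged_filtration FW G s) = sigma_sets (space M) (sets (FW s) \<union> sets G)"
    and "brownian_wrt M T W (enlarged_filtration FW G)"
proof -
  let ?E = "enlarged_filtration FW G"
  have sG: "space G = space M" "sets G \<subseteq> sets M" using G by (auto simp: subalgebra_def)
  have P: "sets (FW s) \<union> sets G \<subseteq> Pow (space M)" for s
    using sets.sets_into_space[of _ "FW s"] sets.sets_into_space[of _ G] sG by fastforce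
  show sp: "space (?E s) = space M" for s
    using P by (simp add: enlarged_filtration_def sG space_measure_of)
  show se: "sets (?E s) = sigma_sets (space M) (sets (FW s) \<union> sets G)" for s
    using P by (simp add: enlarged_filtration_def sG sets_measure_of)
  have ssub: "sets (FW s) \<subseteq> sets (?E s)" for s
    unfolding se by auto
  show "brownian_wrt M T W ?E"
  proof unfold_locales
    fix t assume t: "t \<in> {0..T}"
    show "subalgebra M (?E t)"
      using subalgebra_FW[OF t] sG unfolding subalgebra_def sp se
      by (auto intro!: sets.sigma_sets_subset)
    show "W t \<in> borel_measurable (?E t)"
      using W_meas_FW[of t t] t ssub[of t] sp by (auto simp: measurable_def)
  next
    fix s t assume "0 \<le> s" "s \<le> t" "t \<le> T"
    then show "sets (?E s) \<subseteq> sets (?E t)"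
      unfolding se using FW_mono[of s t] by (intro sigma_sets_mono') auto
  next
    fix s t assume st: "0 \<le> s" "s < t" "t \<le> T"
    let ?D = "{(\<lambda>\<omega>. W t \<omega> - W s \<omega>) -` B \<inter> space M | B. B \<in> sets borel}"
    let ?P = "{A \<inter> B | A B. A \<in> sets (FW s) \<and> B \<in> sets G}"
    have FsM: "sets (FW s) \<subseteq> sets M" using subalgebra_FW[of s] st by (auto simp: subalgebra_def)
    have Wd: "(\<lambda>\<omega>. W t \<omega> - W s \<omega>) \<in> borel_measurable (FW T)"
      using W_meas_FW[of s T] W_meas_FW[of t T] st by auto
    then have D: "?D \<subseteq> sets (FW T)"
      using measurable_sets[OF Wd] by auto
    have TM: "sets (FW T) \<subseteq> sets M" using subalgebra_FW[of T] T_pos by (auto simp: subalgebra_def)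
    have i1: "indep_set (sets (FW s)) ?D" using BM st by (auto simp: brownian_motion_def)
    have "indep_set ?P ?D"
    proof (rule indep_setI)
      show "?P \<subseteq> events" using FsM sG by auto
      show "?D \<subseteq> events" using D TM by auto
      fix P C assume "P \<in> ?P" and C: "C \<in> ?D"
      then obtain A B where AB: "A \<in> sets (FW s)" "B \<in> sets G" "P = A \<inter> B" by auto
      have A: "A \<in> sets (FW T)" using AB FW_mono[of s T] st by auto
      \<comment> \<open>First B is split off from A and C together, both being events of
        \<open>FW T\<close>; then A and C separate by the Brownian property; finally A and B are
        rejoined by a second use of the independence of \<open>G\<close>.\<close>
      have "prob (P \<inter> C) = prob (B \<inter> (A \<inter> C))" using AB by (simp add: Int_ac)
      also have "\<dots> = prob B * prob (A \<inter> C)"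
        using A C D AB by (intro indep_setD[OF ind]) auto
      also have "prob (A \<inter> C) = prob A * prob C"
        using AB C by (intro indep_setD[OF i1]) auto
      also have "prob B * (prob A * prob C) = prob (B \<inter> A) * prob C"
        using indep_setD[OF ind AB(2) A] by simp
      finally show "prob (P \<inter> C) = prob P * prob C" using AB by (simp add: Int_commute)
    qed
    moreover have "Int_stable ?P"
      by (intro Int_stableI) (clarsimp, metis (no_types, lifting) Int_assoc Int_left_commute sets.Int)
    moreover have "Int_stable ?D"
    proof (safe intro!: Int_stableI)
      fix A B :: "(real^'n) set" assume "A \<in> sets borel" "B \<in> sets borel"
      then show "\<exists>C. ((\<lambda>\<omega>. W t \<omega> - W s \<omega>) -` A \<inter> space M) \<inter> ((\<lambda>\<omega>. W t \<omega> - W s \<omega>) -` B \<inter> space M) =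
          (\<lambda>\<omega>. W t \<omega> - W s \<omega>) -` C \<inter> space M \<and> C \<in> sets borel"
        by (intro exI[of _ "A \<inter> B"]) auto
    qed
    ultimately have "indep_set (sigma_sets (space M) ?P) (sigma_sets (space M) ?D)"
      by (rule indep_set_sigma_sets)
    moreover have "sets (?E s) \<subseteq> sigma_sets (space M) ?P"
      unfolding se
    proof (rule sigma_sets_mono)
      have "A = A \<inter> space M" if "A \<in> sets (FW s) \<or> A \<in> sets G" for A
        using that P[of s] by auto
      then have "sets (FW s) \<union> sets G \<subseteq> ?P"
        using sets.top[of G] sets.top[of "FW s"] sG by auto
      then show "sets (FW s) \<union> sets G \<subseteq> sigma_sets (space M) ?P" by auto
    qed
    ultimately show "indep_set (sets (?E s)) ?D"
      unfolding indep_set_def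
      by (elim indep_sets_mono_sets) (auto split: bool.split)
  qed
qed

end

section \<open>Isometry for simple integrals\<close>

lemma norm_square_vec: "(norm (A :: real ^ 'm))\<^sup>2 = (\<Sum>i\<in>UNIV. (A $ i)\<^sup>2)"
  unfolding power2_norm_eq_inner by (simp add: inner_vec_def power2_eq_square)

lemma norm_square_matrix: "(norm (A :: real ^ 'n ^ 'm))\<^sup>2 = (\<Sum>i\<in>UNIV. \<Sum>j\<in>UNIV. (A $ i $ j)\<^sup>2)"
  unfolding power2_norm_eq_inner by (simp add: inner_vec_def power2_eq_square)

lemma norm_square_add_le: "(norm (x + y))\<^sup>2 \<le> 2 * (norm x)\<^sup>2 + 2 * (norm (y :: 'a::real_normed_vector))\<^sup>2"
proof -
  have "(norm (x + y))\<^sup>2 \<le> (norm x + norm y)\<^sup>2"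
    by (intro power_mono norm_triangle_ineq) simp
  also have "\<dots> \<le> 2 * (norm x)\<^sup>2 + 2 * (norm y)\<^sup>2"
    using zero_le_power2[of "norm x - norm y"] by (simp add: power2_eq_square algebra_simps)
  finally show ?thesis .
qed

lemma borel_measurable_vec_nth:
  fixes f :: "'a \<Rightarrow> 'b::topological_space ^ 'm"
  shows "f \<in> borel_measurable M \<Longrightarrow> (\<lambda>x. f x $ i) \<in> borel_measurable M"
  by (erule measurable_compose) (intro borel_measurable_continuous_onI continuous_intros)

lemma borel_measurable_vecI:
  fixes f :: "'a \<Rightarrow> real ^ 'm"
  assumes "\<And>i. (\<lambda>x. f x $ i) \<in> borel_measurable M"
  shows "f \<in> borel_measurable M"
  unfolding borel_measurable_euclidean_space[of f]
proof
  fix b :: "real ^ 'm" assume "b \<in> Basis"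
  then obtain i where "b = axis i 1" by (auto simp: Basis_vec_def)
  then show "(\<lambda>x. f x \<bullet> b) \<in> borel_measurable M"
    using assms[of i] by (simp add: inner_axis)
qed

lemma simple_process_nth:
  "simple_process S t \<omega> = (\<Sum>k<length S. indicator {fst (S ! k)<..fst (snd (S ! k))} t *\<^sub>R snd (snd (S ! k)) \<omega>)"
  by (simp add: simple_process_def sum_list_sum_nth split_beta' lessThan_atLeast0)

lemma simple_integral_nth:
  "simple_integral W S t \<omega> = (\<Sum>k<length S. snd (snd (S ! k)) \<omega> *v
     (W (min (fst (snd (S ! k))) t) \<omega> - W (min (fst (S ! k)) t) \<omega>))"
  by (simp add: simple_integral_def sum_list_sum_nth split_beta' lessThan_atLeast0)

text \<open>The same overlap length as in \<open>dW_pair_min\<close>, now as a time integral of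
  indicators. That the two numbers agree is the isometry for a pair of terms. Nonnegative left ends
  ensure that the interval from 0 to t cuts only on the right.\<close>

lemma has_bochner_integral_overlap:
  assumes "0 \<le> a" "0 \<le> c"
  shows "has_bochner_integral lborel
    (\<lambda>s. indicator {0..t} s * (indicator {a<..b} s * indicator {c<..d} s)) (max 0 (min t (min b d) - max a (c :: real)))"
proof -
  let ?I = "{max a c<..min t (min b d)}"
  have "has_bochner_integral lborel (indicator {l<..u}) (max 0 (u - l))" for l u :: real
  proof (cases "l \<le> u")
    case True
    then show ?thesis
      using has_bochner_integral_real_indicator[of "{l<..u}" lborel] by (simp add: max_def)
  next
    case False
    then have "indicator {l<..u} = (\<lambda>_. 0 :: real)" by (auto simp: fun_eq_iff)
    then show ?thesis using False by (simp add: max_def has_bochner_integral_zero)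
  qed
  moreover have "(\<lambda>s. indicator {0..t} s * (indicator {a<..b} s * indicator {c<..d} s)) = (indicator ?I :: real \<Rightarrow> real)"
  proof
    fix s
    show "indicator {0..t} s * (indicator {a<..b} s * indicator {c<..d} s) = (indicator ?I s :: real)"
    proof (cases "max a c < s")
      case True
      then have "0 \<le> s" "a < s" "c < s" using assms by auto
      then show ?thesis by (simp add: indicator_def)
    next
      case False
      then show ?thesis by (auto simp: indicator_def)
    qed
  qed
  ultimately show ?thesis by simp
qed

text \<open>Appending negated coefficients represents a difference of simple processes by a single
  list, so the isometry applies to differences.\<close>

definition neg_list :: "(real \<times> real \<times> ('w \<Rightarrow> 'b::real_normed_vector)) list \<Rightarrow> (real \<times> real \<times> ('w \<Rightarrow> 'b)) list" where
  "neg_list S = map (\<lambda>(a, b, \<xi>). (a, b, \<lambda>\<omega>. - \<xi> \<omega>)) S"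

lemma simple_list_diff: "simple_list T F S \<Longrightarrow> simple_list T F S' \<Longrightarrow> simple_list T F (S @ neg_list S')"
proof -
  assume S: "simple_list T F S" "simple_list T F S'"
  have "(a, b, \<xi>) \<in> set (S @ neg_list S') \<Longrightarrow>
      (a, b, \<xi>) \<in> set S \<or> (\<exists>\<eta>. (a, b, \<eta>) \<in> set S' \<and> \<xi> = (\<lambda>\<omega>. - \<eta> \<omega>))" for a b \<xi>
    by (auto simp: neg_list_def)
  moreover have "(\<lambda>\<omega>. - \<eta> \<omega>) \<in> borel_measurable N" if "\<eta> \<in> borel_measurable N" for \<eta> :: "'a \<Rightarrow> 'b" and N
    using borel_measurable_continuous_on[OF continuous_on_minus[OF continuous_on_id] that] by simp
  ultimately show ?thesis
    using S unfolding simple_list_def by (smt (verit, ccfv_threshold) case_prodD case_prodI2 norm_minus_cancel prod_cases3)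
qed

lemma simple_process_diff: "simple_process (S @ neg_list S') t \<omega> = simple_process S t \<omega> - simple_process S' t \<omega>"
  by (induction S') (auto simp: simple_process_def neg_list_def split_beta')

lemma minus_matrix_vector_mult: "(- A) *v x = - (A *v (x :: real ^ 'n))"
  by (simp add: matrix_vector_mult_def vec_eq_iff sum_negf)

lemma simple_integral_diff: "simple_integral W (S @ neg_list S') t \<omega> = simple_integral W S t \<omega> - simple_integral W S' t \<omega>"
  by (induction S') (auto simp: simple_integral_def neg_list_def split_beta' minus_matrix_vector_mult algebra_simps)

context brownian_wrt
begin

lemma simple_list_nthD:
  assumes "simple_list T Fil S" "k < length S"
  shows "0 \<le> fst (S ! k)" "fst (S ! k) \<le> fst (snd (S ! k))" "fst (snd (S ! k)) \<le> T"
    "snd (snd (S ! k)) \<in> borel_measurable (Fil (fst (S ! k)))"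
    "\<exists>B. \<forall>\<omega>\<in>space M. norm (snd (snd (S ! k)) \<omega>) \<le> B"
proof -
  have "S ! k \<in> set S" using assms by simp
  then show 1: "0 \<le> fst (S ! k)" "fst (S ! k) \<le> fst (snd (S ! k))" "fst (snd (S ! k)) \<le> T"
    "snd (snd (S ! k)) \<in> borel_measurable (Fil (fst (S ! k)))"
    using assms(1) unfolding simple_list_def by (auto simp: split_beta')
  show "\<exists>B. \<forall>\<omega>\<in>space M. norm (snd (snd (S ! k)) \<omega>) \<le> B"
    using bspec[OF assms(1)[unfolded simple_list_def] \<open>S ! k \<in> set S\<close>] space_Fil[of "fst (S ! k)"] 1(1-3)
    by (simp add: split_beta')
qed

text \<open>The intervals of a simple list may overlap, so both sides are expanded over pairs of
  terms. Each pair contributes overlap length times E of the product of coefficients: on the left by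
  \<open>dW_pair_min\<close>, on the right by integrating indicators in time.\<close>

lemma simple_isometry:
  fixes S :: "(real \<times> real \<times> ('w \<Rightarrow> real ^ 'n ^ 'm)) list"
  assumes S: "simple_list T Fil S" and t: "t \<in> {0..T}"
  shows "(\<integral>\<^sup>+ \<omega>. ennreal ((norm (simple_integral W S t \<omega>))\<^sup>2) \<partial>M) =
    (\<integral>\<^sup>+ \<omega>. (\<integral>\<^sup>+ s\<in>{0..t}. ennreal ((norm (simple_process S s \<omega>))\<^sup>2) \<partial>lborel) \<partial>M)"
proof -
  define N where "N = length S"
  define a where "a k = fst (S ! k)" for k
  define b where "b k = fst (snd (S ! k))" for k
  define \<xi> where "\<xi> k = snd (snd (S ! k))" for k
  define ov where "ov k l = max 0 (min t (min (b k) (b l)) - max (a k) (a l))" for k l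
  have ab: "0 \<le> a k" "a k \<le> b k" "b k \<le> T" "\<xi> k \<in> borel_measurable (Fil (a k))"
    and ex: "\<exists>B. \<forall>\<omega>\<in>space M. norm (\<xi> k \<omega>) \<le> B" if "k < N" for k
    using simple_list_nthD[OF S] that by (auto simp: a_def b_def \<xi>_def N_def)
  from ex have "\<forall>k. \<exists>B. k < N \<longrightarrow> (\<forall>\<omega>\<in>space M. norm (\<xi> k \<omega>) \<le> B)" by blast
  then obtain B where B: "\<And>k \<omega>. k < N \<Longrightarrow> \<omega> \<in> space M \<Longrightarrow> norm (\<xi> k \<omega>) \<le> B k"
    by metis
  have \<xi>b: "\<bar>\<xi> k \<omega> $ i $ j\<bar> \<le> B k" if "k < N" "\<omega> \<in> space M" for k \<omega> i j
    using Finite_Cartesian_Product.norm_nth_le[of "\<xi> k \<omega> $ i" j] Finite_Cartesian_Product.norm_nth_le[of "\<xi> k \<omega>" i] B[OF that] by simp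
  have \<xi>m: "(\<lambda>\<omega>. \<xi> k \<omega> $ i $ j) \<in> borel_measurable (Fil (a k))" if "k < N" for k i j
    using ab(4)[OF that] by (intro borel_measurable_vec_nth)
  \<comment> \<open>The time integral of the squared norm along one path, already evaluated; that it
    is this integral is shown below under the name \<open>path\<close>.\<close>
  define Q where "Q \<omega> = (\<Sum>i\<in>UNIV. \<Sum>j\<in>UNIV. \<Sum>k<N. \<Sum>l<N. ov k l * (\<xi> k \<omega> $ i $ j * \<xi> l \<omega> $ i $ j))" for \<omega>
  let ?E = "\<lambda>i j k l. expectation (\<lambda>\<omega>. \<xi> k \<omega> $ i $ j * \<xi> l \<omega> $ i $ j)"
  let ?V = "\<Sum>i\<in>UNIV. \<Sum>j\<in>UNIV. \<Sum>k<N. \<Sum>l<N. ov k l * ?E i j k l"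
  have "integrable M (\<lambda>\<omega>. \<xi> k \<omega> $ i $ j * \<xi> l \<omega> $ i $ j)" if "k < N" "l < N" for k l i j
  proof (rule integrable_const_bound[of _ "B k * B l"])
    show "AE \<omega> in M. norm (\<xi> k \<omega> $ i $ j * \<xi> l \<omega> $ i $ j) \<le> B k * B l"
      using \<xi>b[OF that(1)] \<xi>b[OF that(2)]
      by (intro AE_I2) (auto simp: abs_mult intro!: mult_mono order_trans[OF abs_ge_zero])
    show "(\<lambda>\<omega>. \<xi> k \<omega> $ i $ j * \<xi> l \<omega> $ i $ j) \<in> borel_measurable M"
      using measurable_Fil_M[OF _ \<xi>m[OF that(1)]] measurable_Fil_M[OF _ \<xi>m[OF that(2)]] ab[OF that(1)] ab[OF that(2)]
      by (intro borel_measurable_times) auto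
  qed
  then have hQ: "has_bochner_integral M Q ?V"
    unfolding Q_def by (intro has_bochner_integral_sum has_bochner_integral_mult_right) (auto intro: has_bochner_integral_integrable)
  let ?d = "\<lambda>k j \<omega>. dW (min (a k) t) (min (b k) t) j \<omega>"
  have comp: "simple_integral W S t \<omega> $ i = (\<Sum>(k, j)\<in>{..<N} \<times> UNIV. \<xi> k \<omega> $ i $ j * ?d k j \<omega>)" for i \<omega>
    by (simp add: simple_integral_nth sum.cartesian_product[symmetric] matrix_vector_mult_def dW_def
        N_def a_def b_def \<xi>_def)
  have "has_bochner_integral M (\<lambda>\<omega>. (norm (simple_integral W S t \<omega>))\<^sup>2)
    (\<Sum>i\<in>UNIV. \<Sum>(k, j)\<in>{..<N} \<times> UNIV. \<Sum>(l, j')\<in>{..<N} \<times> UNIV. if j = j' then ov k l * ?E i j k l else 0)"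
  proof -
    have "has_bochner_integral M (\<lambda>\<omega>. (\<xi> k \<omega> $ i $ j * ?d k j \<omega>) * (\<xi> l \<omega> $ i $ j' * ?d l j' \<omega>))
      (if j = j' then ov k l * ?E i j k l else 0)" if "k < N" "l < N" for i j j' k l
      using dW_pair_min[OF ab(1-3)[OF that(1)] ab(1-3)[OF that(2)] t \<xi>m[OF that(1)] \<xi>b[OF that(1)] \<xi>m[OF that(2)] \<xi>b[OF that(2)],
          where i=j and j=j'] by (cases "j = j'") (auto simp: ov_def)
    then show ?thesis
      unfolding norm_square_vec comp power2_eq_square[of "sum _ _"] sum_product
      by (intro has_bochner_integral_sum) (auto intro!: has_bochner_integral_sum)
  qed
  moreover have "(\<Sum>(k, j)\<in>{..<N} \<times> UNIV. \<Sum>(l, j')\<in>{..<N} \<times> UNIV. if j = j' then ov k l * ?E i j k l else 0)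
      = (\<Sum>j\<in>UNIV. \<Sum>k<N. \<Sum>l<N. ov k l * ?E i j k l)" for i
    unfolding sum.cartesian_product[symmetric] by (subst sum.swap) simp
  ultimately have hI: "has_bochner_integral M (\<lambda>\<omega>. (norm (simple_integral W S t \<omega>))\<^sup>2) ?V"
    by simp
  have path: "(\<integral>\<^sup>+ s\<in>{0..t}. ennreal ((norm (simple_process S s \<omega>))\<^sup>2) \<partial>lborel) = ennreal (Q \<omega>) \<and> 0 \<le> Q \<omega>" for \<omega>
  proof -
    have sq: "indicator {0..t} s * (norm (simple_process S s \<omega>))\<^sup>2 = (\<Sum>i\<in>UNIV. \<Sum>j\<in>UNIV. \<Sum>k<N. \<Sum>l<N.
        (indicator {0..t} s * (indicator {a k<..b k} s * indicator {a l<..b l} s)) * (\<xi> k \<omega> $ i $ j * \<xi> l \<omega> $ i $ j))" for s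
    proof -
      have gen: "c * (\<Sum>k<N. p k * y k)\<^sup>2 = (\<Sum>k<N. \<Sum>l<N. (c * (p k * p l)) * (y k * y l))"
        for c :: real and p y :: "nat \<Rightarrow> real"
        by (simp add: power2_eq_square sum_product sum_distrib_left mult_ac)
      have "simple_process S s \<omega> $ i $ j = (\<Sum>k<N. indicator {a k<..b k} s * \<xi> k \<omega> $ i $ j)" for i j
        unfolding simple_process_nth N_def a_def b_def \<xi>_def by (simp only: sum_component vector_scaleR_component real_scaleR_def)
      then show ?thesis
        unfolding norm_square_matrix by (simp only: sum_distrib_left gen)
    qed
    have "has_bochner_integral lborel (\<lambda>s. indicator {0..t} s * (norm (simple_process S s \<omega>))\<^sup>2) (Q \<omega>)"
      unfolding sq Q_def ov_def
      by (intro has_bochner_integral_sum has_bochner_integral_mult_left has_bochner_integral_overlap) (use ab in auto)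
    then have i: "integrable lborel (\<lambda>s. indicator {0..t} s * (norm (simple_process S s \<omega>))\<^sup>2)"
      and v: "(\<integral>s. indicator {0..t} s * (norm (simple_process S s \<omega>))\<^sup>2 \<partial>lborel) = Q \<omega>"
      by (auto simp: has_bochner_integral_iff)
    have "(\<integral>\<^sup>+ s\<in>{0..t}. ennreal ((norm (simple_process S s \<omega>))\<^sup>2) \<partial>lborel) =
        (\<integral>\<^sup>+ s. ennreal (indicator {0..t} s * (norm (simple_process S s \<omega>))\<^sup>2) \<partial>lborel)"
      by (intro nn_integral_cong) (auto simp: indicator_def)
    also have "\<dots> = ennreal (Q \<omega>)"
      using nn_integral_eq_integral[OF i] v by simp
    finally show ?thesis
      unfolding v[symmetric] by (simp add: Bochner_Integration.integral_nonneg)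
  qed
  show ?thesis
  proof -
    have "(\<integral>\<^sup>+ \<omega>. ennreal ((norm (simple_integral W S t \<omega>))\<^sup>2) \<partial>M) = ennreal ?V"
      using nn_integral_eq_integral[OF integrable.intros[OF hI]] has_bochner_integral_integral_eq[OF hI] by simp
    moreover have "(\<integral>\<^sup>+ \<omega>. ennreal (Q \<omega>) \<partial>M) = ennreal ?V"
      using nn_integral_eq_integral[OF integrable.intros[OF hQ]] has_bochner_integral_integral_eq[OF hQ] path by simp
    ultimately show ?thesis using path by simp
  qed
qed

lemma simple_isometry_le:
  fixes S :: "(real \<times> real \<times> ('w \<Rightarrow> real ^ 'n ^ 'm)) list"
  assumes S: "simple_list T Fil S" and t: "t \<in> {0..T}"
  shows "(\<integral>\<^sup>+ \<omega>. ennreal ((norm (simple_integral W S t \<omega>))\<^sup>2) \<partial>M) \<le> H2_sqnorm M T (simple_process S)"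
  unfolding simple_isometry[OF assms] H2_sqnorm_def
  by (intro nn_integral_mono) (use t in \<open>auto simp: indicator_def\<close>)

lemma simple_integral_meas:
  assumes S: "simple_list T Fil S" and t: "t \<in> {0..T}"
  shows "simple_integral W S t \<in> borel_measurable (Fil t)"
  unfolding simple_integral_nth
proof (intro borel_measurable_sum)
  fix k assume "k \<in> {..<length S}"
  then have k: "k < length S" by simp
  note * = simple_list_nthD[OF S k]
  let ?a = "fst (S ! k)" and ?b = "fst (snd (S ! k))" and ?x = "snd (snd (S ! k))"
  show "(\<lambda>\<omega>. ?x \<omega> *v (W (min ?b t) \<omega> - W (min ?a t) \<omega>)) \<in> borel_measurable (Fil t)"
  proof (cases "?a \<le> t")
    case True
    have "?x \<in> borel_measurable (Fil t)" "W (min ?b t) \<in> borel_measurable (Fil t)" "W (min ?a t) \<in> borel_measurable (Fil t)"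
      using True * t by (auto intro!: measurable_Fil_mono[OF _ _ _ *(4)] measurable_Fil_mono[OF _ _ _ W_meas_Fil])
    then show ?thesis
      by (intro borel_measurable_vecI)
        (auto simp: matrix_vector_mult_def intro!: borel_measurable_sum borel_measurable_times borel_measurable_vec_nth
          borel_measurable_diff)
  next
    case False
    then have "min ?a t = t" "min ?b t = t" using * by auto
    then show ?thesis by simp
  qed
qed

end

section \<open>Time as a finite measure space, and joint measurability\<close>

abbreviation lborel_on :: "real \<Rightarrow> real measure" where
  "lborel_on T \<equiv> restrict_space lborel {0..T}"

lemma finite_measure_lborel_on: "finite_measure (lborel_on T)"
  by (rule finite_measureI) (simp add: emeasure_restrict_space emeasure_lborel_Icc_eq)

lemma LINT_lborel_on:
  fixes f :: "real \<Rightarrow> 'b::{banach, second_countable_topology}"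
  shows "(LINT s:{0..T}|lborel. f s) = (\<integral>s. f s \<partial>lborel_on T)"
  by (simp add: set_lebesgue_integral_def integral_restrict_space)

lemma set_integrable_lborel_on:
  fixes f :: "real \<Rightarrow> 'b::{banach, second_countable_topology}"
  shows "set_integrable lborel {0..T} f \<longleftrightarrow> integrable (lborel_on T) f"
  by (simp add: set_integrable_eq)

lemma nn_integral_lborel_on: "(\<integral>\<^sup>+ s\<in>{0..T}. f s \<partial>lborel) = (\<integral>\<^sup>+ s. f s \<partial>lborel_on T)"
  by (simp add: nn_integral_restrict_space)

lemma sets_lborel_on: "sets (lborel_on T) = sets (restrict_space borel {0..T})"
  by (intro sets_restrict_space_cong) simp

text \<open>The sample point comes first and time second, as in the product measure used below and
  opposite to \<open>progressive\<close>.\<close>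

definition jointly_measurable ::
    "'w measure \<Rightarrow> real \<Rightarrow> (real \<Rightarrow> 'w \<Rightarrow> 'b::topological_space) \<Rightarrow> bool" where
  "jointly_measurable M T X \<longleftrightarrow> (\<lambda>(\<omega>, s). X s \<omega>) \<in> borel_measurable (M \<Otimes>\<^sub>M lborel_on T)"

lemma H2_sqnorm_pair:
  fixes X :: "real \<Rightarrow> 'w \<Rightarrow> 'b::{real_normed_vector, second_countable_topology}"
  assumes "jointly_measurable M T X"
  shows "H2_sqnorm M T X = (\<integral>\<^sup>+ (\<omega>, s). ennreal ((norm (X s \<omega>))\<^sup>2) \<partial>(M \<Otimes>\<^sub>M lborel_on T))"
proof -
  interpret finite_measure "lborel_on T" by (rule finite_measure_lborel_on)
  have "(\<lambda>(\<omega>, s). ennreal ((norm (X s \<omega>))\<^sup>2)) = (\<lambda>z. ennreal ((norm (case z of (\<omega>, s) \<Rightarrow> X s \<omega>))\<^sup>2))"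
    by auto
  then have m: "(\<lambda>(\<omega>, s). ennreal ((norm (X s \<omega>))\<^sup>2)) \<in> borel_measurable (M \<Otimes>\<^sub>M lborel_on T)"
    using assms unfolding jointly_measurable_def by simp
  show ?thesis
    using nn_integral_fst[OF m] by (simp add: H2_sqnorm_def nn_integral_lborel_on)
qed

text \<open>A triangle inequality for squares, paid for with the factor 2, so that no roots of
  extended reals occur. Joint measurability is demanded because additivity of the integral over the
  product measure needs it.\<close>

lemma H2_sqnorm_diff_le:
  fixes X Y Z :: "real \<Rightarrow> 'w \<Rightarrow> 'b::{real_normed_vector, second_countable_topology}"
  assumes m: "jointly_measurable M T X" "jointly_measurable M T Y" "jointly_measurable M T Z"
  shows "H2_sqnorm M T (\<lambda>t \<omega>. Y t \<omega> - Z t \<omega>) \<le>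
    2 * H2_sqnorm M T (\<lambda>t \<omega>. X t \<omega> - Y t \<omega>) + 2 * H2_sqnorm M T (\<lambda>t \<omega>. X t \<omega> - Z t \<omega>)"
proof -
  let ?P = "M \<Otimes>\<^sub>M lborel_on T"
  have d: "jointly_measurable M T (\<lambda>t \<omega>. X t \<omega> - Y t \<omega>)" if "jointly_measurable M T X" "jointly_measurable M T Y"
    for X Y :: "real \<Rightarrow> 'w \<Rightarrow> 'b"
    using that borel_measurable_diff[of "\<lambda>(\<omega>, s). X s \<omega>" ?P "\<lambda>(\<omega>, s). Y s \<omega>"]
    unfolding jointly_measurable_def by (simp add: split_beta')
  have n: "(\<lambda>(\<omega>, s). ennreal ((norm (X s \<omega>))\<^sup>2)) \<in> borel_measurable ?P" if "jointly_measurable M T X"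
    for X :: "real \<Rightarrow> 'w \<Rightarrow> 'b"
    using that unfolding jointly_measurable_def by (simp add: split_beta')
  have "(norm (Y t \<omega> - Z t \<omega>))\<^sup>2 \<le> 2 * (norm (X t \<omega> - Y t \<omega>))\<^sup>2 + 2 * (norm (X t \<omega> - Z t \<omega>))\<^sup>2" for t \<omega>
    using norm_square_add_le[of "Y t \<omega> - X t \<omega>" "X t \<omega> - Z t \<omega>"] by (simp add: norm_minus_commute)
  then have "(\<integral>\<^sup>+ (\<omega>, s). ennreal ((norm (Y s \<omega> - Z s \<omega>))\<^sup>2) \<partial>?P) \<le>
      (\<integral>\<^sup>+ z. 2 * (case z of (\<omega>, s) \<Rightarrow> ennreal ((norm (X s \<omega> - Y s \<omega>))\<^sup>2)) +
        2 * (case z of (\<omega>, s) \<Rightarrow> ennreal ((norm (X s \<omega> - Z s \<omega>))\<^sup>2)) \<partial>?P)"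
    by (intro nn_integral_mono) (auto simp flip: ennreal_plus ennreal_mult' ennreal_numeral intro!: ennreal_leI)
  also have "\<dots> = 2 * (\<integral>\<^sup>+ (\<omega>, s). ennreal ((norm (X s \<omega> - Y s \<omega>))\<^sup>2) \<partial>?P) +
      2 * (\<integral>\<^sup>+ (\<omega>, s). ennreal ((norm (X s \<omega> - Z s \<omega>))\<^sup>2) \<partial>?P)"
    using n[OF d[OF m(1,2)]] n[OF d[OF m(1,3)]]
    by (simp add: nn_integral_add nn_integral_cmult)
  finally show ?thesis
    by (simp add: H2_sqnorm_pair d m)
qed

lemma jointly_measurable_continuous:
  fixes H :: "real \<Rightarrow> 'b::topological_space"
  assumes "continuous_on {0..T} H"
  shows "jointly_measurable M T (\<lambda>t \<omega>. H t)"
proof -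
  have "H \<in> borel_measurable (lborel_on T)"
    using borel_measurable_continuous_on_restrict[OF assms] measurable_cong_sets[OF sets_lborel_on refl] by blast
  then show ?thesis
    unfolding jointly_measurable_def by (simp add: split_beta')
qed

text \<open>Left-endpoint sampling on a grid of \<open>Suc k\<close> equal cells, so that k = 0 is
  harmless. The coefficients do not depend on the sample point, hence the list is simple for every
  filtration.\<close>

definition step_list :: "real \<Rightarrow> (real \<Rightarrow> 'b) \<Rightarrow> nat \<Rightarrow> (real \<times> real \<times> ('w \<Rightarrow> 'b)) list" where
  "step_list T H k = map (\<lambda>i. (T * real i / real (Suc k), T * real (Suc i) / real (Suc k), \<lambda>\<omega>. H (T * real i / real (Suc k)))) [0..<Suc k]"

lemma step_list_nth:
  "simple_process (step_list T H k) t \<omega> =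
    (\<Sum>i<Suc k. indicator {T * real i / real (Suc k)<..T * real (Suc i) / real (Suc k)} t *\<^sub>R H (T * real i / real (Suc k)))"
  "simple_integral W (step_list T H' k) t \<omega> =
    (\<Sum>i<Suc k. H' (T * real i / real (Suc k)) *v (W (min (T * real (Suc i) / real (Suc k)) t) \<omega> - W (min (T * real i / real (Suc k)) t) \<omega>))"
  unfolding simple_process_def simple_integral_def step_list_def
  by (simp_all add: comp_def interv_sum_list_conv_sum_set_nat lessThan_atLeast0 del: upt_Suc)

lemma grid_le: "0 < T \<Longrightarrow> i \<le> Suc k \<Longrightarrow> T * real i / real (Suc k) \<le> T"
  using mult_left_mono[of "real i" "real (Suc k)" T] by (simp add: divide_le_eq)

lemma simple_list_step:
  assumes "0 < T" shows "simple_list T F (step_list T H k)"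
proof -
  have "T * real i / real (Suc k) \<le> T * real (Suc i) / real (Suc k)" for i
    using assms by (intro divide_right_mono mult_left_mono) auto
  moreover have "T * real (Suc i) / real (Suc k) \<le> T" if "i < Suc k" for i
    using grid_le[OF assms, of "Suc i" k] that by simp
  ultimately show ?thesis
    unfolding simple_list_def step_list_def using assms grid_le[OF assms, of k k] by (auto simp del: of_nat_Suc)
qed

lemma sum_indicator_grid:
  "(\<Sum>i<n. indicator {T * real i / real (Suc k)<..T * real (Suc i) / real (Suc k)} t :: real) =
    indicator {0<..T * real n / real (Suc k)} t" if "0 < T"
proof (induction n)
  case (Suc n)
  have "T * real n / real (Suc k) \<le> T * real (Suc n) / real (Suc k)" "0 \<le> T * real n / real (Suc k)"
    using that by (auto intro!: divide_right_mono mult_left_mono)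
  then show ?case
    unfolding sum.lessThan_Suc Suc.IH by (auto simp: indicator_def simp del: of_nat_Suc)
qed simp

text \<open>Uniform continuity on the compact interval. Time 0 is excluded because the left-open
  cells miss it, so the step process is 0 there whatever H is.\<close>

lemma step_process_approx:
  fixes H :: "real \<Rightarrow> 'b::real_normed_vector"
  assumes T: "0 < T" and H: "continuous_on {0..T} H" and e: "0 < e"
  shows "\<forall>\<^sub>F k in sequentially. \<forall>t\<in>{0<..T}. norm (H t - simple_process (step_list T H k) t \<omega>) \<le> e"
proof -
  have "uniformly_continuous_on {0..T} H"
    by (rule compact_uniformly_continuous[OF H]) simp
  then obtain \<delta> where \<delta>: "0 < \<delta>" "\<And>s t. s \<in> {0..T} \<Longrightarrow> t \<in> {0..T} \<Longrightarrow> dist t s < \<delta> \<Longrightarrow> dist (H t) (H s) < e"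
    using e unfolding uniformly_continuous_on_def by metis
  have "(\<lambda>k. T / real (Suc k)) \<longlonglongrightarrow> 0"
    using LIMSEQ_Suc[OF lim_const_over_n[of T]] by simp
  then have "\<forall>\<^sub>F k in sequentially. T / real (Suc k) < \<delta>"
    using \<delta>(1) by (rule order_tendstoD)
  then show ?thesis
  proof (rule eventually_mono, intro ballI)
    fix k t assume k: "T / real (Suc k) < \<delta>" and t: "t \<in> {0<..T}"
    let ?I = "\<lambda>i. indicator {T * real i / real (Suc k)<..T * real (Suc i) / real (Suc k)} t :: real"
    \<comment> \<open>Exactly one cell contains t: the indicators form a partition of unity, over
      which H t can be distributed and compared with the samples.\<close>
    have one: "(\<Sum>i<Suc k. ?I i) = 1"
      using t T by (subst sum_indicator_grid) auto
    have "H t - simple_process (step_list T H k) t \<omega> = (\<Sum>i<Suc k. ?I i) *\<^sub>R H t - (\<Sum>i<Suc k. ?I i *\<^sub>R H (T * real i / real (Suc k)))"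
      unfolding step_list_nth one by simp
    also have "\<dots> = (\<Sum>i<Suc k. ?I i *\<^sub>R (H t - H (T * real i / real (Suc k))))"
      by (simp only: scaleR_sum_left sum_subtractf[symmetric] scaleR_diff_right)
    finally have "norm (H t - simple_process (step_list T H k) t \<omega>) \<le> (\<Sum>i<Suc k. norm (?I i *\<^sub>R (H t - H (T * real i / real (Suc k)))))"
      by (simp only: norm_sum)
    also have "\<dots> \<le> (\<Sum>i<Suc k. ?I i * e)"
    proof (rule sum_mono)
      fix i assume i: "i \<in> {..<Suc k}"
      show "norm (?I i *\<^sub>R (H t - H (T * real i / real (Suc k)))) \<le> ?I i * e"
      proof (cases "t \<in> {T * real i / real (Suc k)<..T * real (Suc i) / real (Suc k)}")
        case True
        have "T * real (Suc i) / real (Suc k) - T * real i / real (Suc k) = T / real (Suc k)"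
          by (simp add: diff_divide_distrib[symmetric] algebra_simps)
        then have "dist t (T * real i / real (Suc k)) < \<delta>"
          using True k by (auto simp: dist_real_def simp del: of_nat_Suc)
        moreover have "T * real i / real (Suc k) \<in> {0..T}"
          using T i grid_le[of T i k] by (simp del: of_nat_Suc)
        ultimately have "dist (H t) (H (T * real i / real (Suc k))) < e"
          using \<delta>(2) t by simp
        then show ?thesis using True by (simp add: dist_norm)
      next
        case False
        then have "?I i = 0" by (rule indicator_simps(2))
        then show ?thesis by simp
      qed
    qed
    also have "\<dots> = e" by (simp only: sum_distrib_right[symmetric] one mult_1)
    finally show "norm (H t - simple_process (step_list T H k) t \<omega>) \<le> e" .
  qed
qed

lemma step_process_bound:
  fixes H :: "real \<Rightarrow> 'b::real_normed_vector"
  assumes T: "0 < T" and B: "\<And>t. t \<in> {0..T} \<Longrightarrow> norm (H t) \<le> B"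
  shows "norm (simple_process (step_list T H k) t \<omega>) \<le> B"
proof -
  let ?I = "\<lambda>i. indicator {T * real i / real (Suc k)<..T * real (Suc i) / real (Suc k)} t :: real"
  have B0: "0 \<le> B" using order_trans[OF norm_ge_zero B[of 0]] T by simp
  have "norm (simple_process (step_list T H k) t \<omega>) \<le> (\<Sum>i<Suc k. norm (?I i *\<^sub>R H (T * real i / real (Suc k))))"
    unfolding step_list_nth by (rule norm_sum)
  also have "\<dots> \<le> (\<Sum>i<Suc k. ?I i * B)"
  proof (rule sum_mono)
    fix i assume i: "i \<in> {..<Suc k}"
    then have "T * real i / real (Suc k) \<in> {0..T}"
      using T grid_le[of T i k] by (simp del: of_nat_Suc)
    then show "norm (?I i *\<^sub>R H (T * real i / real (Suc k))) \<le> ?I i * B"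
      using B by (auto simp: indicator_def)
  qed
  also have "\<dots> = (\<Sum>i<Suc k. ?I i) * B" by (simp only: sum_distrib_right)
  also have "\<dots> \<le> B" unfolding sum_indicator_grid[OF T] using B0 by (simp add: indicator_def)
  finally show ?thesis .
qed

lemma ennreal_tendsto_0I:
  fixes f :: "nat \<Rightarrow> ennreal"
  assumes "\<And>e. 0 < e \<Longrightarrow> \<forall>\<^sub>F k in sequentially. f k \<le> ennreal e"
  shows "f \<longlonglongrightarrow> 0"
proof (rule order_tendstoI)
  fix a :: ennreal assume "0 < a"
  then obtain e :: real where e: "0 < e" "ennreal e < a"
    by (cases a) (auto intro: that[of 1] simp: ennreal_less_iff dest: dense)
  show "\<forall>\<^sub>F k in sequentially. f k < a"
    using assms[OF e(1)] by (rule eventually_mono) (use e(2) in auto)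
qed simp

context brownian
begin

lemma H2_sqnorm_step:
  assumes H: "continuous_on {0..T} H"
  shows "(\<lambda>k. H2_sqnorm M T (\<lambda>t \<omega>. H t - simple_process (step_list T H k) t \<omega>)) \<longlonglongrightarrow> 0"
proof (rule ennreal_tendsto_0I)
  fix e :: real assume e: "0 < e"
  \<comment> \<open>The level is the root of e / T so that its square, integrated over time, gives
    e. The sample point is \<open>undefined\<close> because the step process does not depend on
    it.\<close>
  have "\<forall>\<^sub>F k in sequentially. \<forall>t\<in>{0<..T}. norm (H t - simple_process (step_list T H k) t undefined) \<le> sqrt (e / T)"
    using e T_pos by (intro step_process_approx H) auto
  then show "\<forall>\<^sub>F k in sequentially. H2_sqnorm M T (\<lambda>t \<omega>. H t - simple_process (step_list T H k) t \<omega>) \<le> ennreal e"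
  proof (rule eventually_mono)
    fix k assume k: "\<forall>t\<in>{0<..T}. norm (H t - simple_process (step_list T H k) t undefined) \<le> sqrt (e / T)"
    have le: "(norm (H t - simple_process (step_list T H k) t \<omega>))\<^sup>2 \<le> e / T" if "t \<in> {0<..T}" for t \<omega>
      using power_mono[of "norm (H t - simple_process (step_list T H k) t \<omega>)" "sqrt (e / T)" 2] k that e T_pos
      unfolding step_list_nth by simp
    have "(\<integral>\<^sup>+ s\<in>{0..T}. ennreal ((norm (H s - simple_process (step_list T H k) s \<omega>))\<^sup>2) \<partial>lborel) \<le> ennreal e" for \<omega>
    proof -
      have "AE s in lborel. s \<noteq> (0::real)" by (rule AE_lborel_singleton)
      then have "(\<integral>\<^sup>+ s\<in>{0..T}. ennreal ((norm (H s - simple_process (step_list T H k) s \<omega>))\<^sup>2) \<partial>lborel) \<le>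
          (\<integral>\<^sup>+ s\<in>{0..T}. ennreal (e / T) \<partial>lborel)"
        by (intro nn_integral_mono_AE) (auto elim!: eventually_mono simp: indicator_def intro!: ennreal_leI le)
      also have "\<dots> = ennreal (e / T) * ennreal T"
        using T_pos by (simp add: nn_integral_cmult_indicator)
      also have "\<dots> = ennreal e" using e T_pos by (simp add: ennreal_mult[symmetric])
      finally show ?thesis .
    qed
    then have "H2_sqnorm M T (\<lambda>t \<omega>. H t - simple_process (step_list T H k) t \<omega>) \<le> (\<integral>\<^sup>+ \<omega>. ennreal e \<partial>M)"
      unfolding H2_sqnorm_def by (intro nn_integral_mono)
    then show "H2_sqnorm M T (\<lambda>t \<omega>. H t - simple_process (step_list T H k) t \<omega>) \<le> ennreal e"
      by (simp add: emeasure_space_1)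
  qed
qed

end

context brownian_wrt
begin

lemma jointly_measurable_simple:
  fixes S :: "(real \<times> real \<times> ('w \<Rightarrow> 'b::euclidean_space)) list"
  assumes "simple_list T Fil S"
  shows "jointly_measurable M T (simple_process S)"
proof -
  have "(\<lambda>(\<omega>, s). indicator {fst (S ! k)<..fst (snd (S ! k))} s *\<^sub>R snd (snd (S ! k)) \<omega>)
      \<in> borel_measurable (M \<Otimes>\<^sub>M lborel_on T)" if "k < length S" for k
  proof -
    have x: "snd (snd (S ! k)) \<in> borel_measurable M"
      using simple_list_nthD[OF assms that] measurable_Fil_M[of "fst (S ! k)"] by simp
    have "(\<lambda>s. indicator {fst (S ! k)<..fst (snd (S ! k))} s :: real) \<in> borel_measurable (lborel_on T)"
      by (intro measurable_restrict_space1) simp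
    then show ?thesis
      unfolding split_beta' by (intro borel_measurable_scaleR measurable_compose[OF measurable_snd] measurable_compose[OF measurable_fst x]) 
  qed
  then show ?thesis
    unfolding jointly_measurable_def simple_process_nth split_beta'
    by (intro borel_measurable_sum) auto
qed

end

section \<open>Wiener integrals of deterministic integrands\<close>

lemma nn_square_diff_triangle:
  fixes X Y Z :: "'w \<Rightarrow> 'b::euclidean_space"
  assumes [measurable]: "X \<in> borel_measurable M" "Y \<in> borel_measurable M" "Z \<in> borel_measurable M"
  shows "(\<integral>\<^sup>+ \<omega>. ennreal ((norm (X \<omega> - Z \<omega>))\<^sup>2) \<partial>M) \<le>
    2 * (\<integral>\<^sup>+ \<omega>. ennreal ((norm (X \<omega> - Y \<omega>))\<^sup>2) \<partial>M) + 2 * (\<integral>\<^sup>+ \<omega>. ennreal ((norm (Y \<omega> - Z \<omega>))\<^sup>2) \<partial>M)"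
proof -
  have "(norm (X \<omega> - Z \<omega>))\<^sup>2 \<le> 2 * (norm (X \<omega> - Y \<omega>))\<^sup>2 + 2 * (norm (Y \<omega> - Z \<omega>))\<^sup>2" for \<omega>
    using norm_square_add_le[of "X \<omega> - Y \<omega>" "Y \<omega> - Z \<omega>"] by simp
  then have "(\<integral>\<^sup>+ \<omega>. ennreal ((norm (X \<omega> - Z \<omega>))\<^sup>2) \<partial>M) \<le>
      (\<integral>\<^sup>+ \<omega>. 2 * ennreal ((norm (X \<omega> - Y \<omega>))\<^sup>2) + 2 * ennreal ((norm (Y \<omega> - Z \<omega>))\<^sup>2) \<partial>M)"
    by (intro nn_integral_mono) (auto simp flip: ennreal_plus ennreal_mult' ennreal_numeral intro!: ennreal_leI)
  also have "\<dots> = 2 * (\<integral>\<^sup>+ \<omega>. ennreal ((norm (X \<omega> - Y \<omega>))\<^sup>2) \<partial>M) + 2 * (\<integral>\<^sup>+ \<omega>. ennreal ((norm (Y \<omega> - Z \<omega>))\<^sup>2) \<partial>M)"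
    by (simp add: nn_integral_add nn_integral_cmult)
  finally show ?thesis .
qed

lemma integrable_mult_square:
  fixes f g :: "'a \<Rightarrow> real"
  assumes [measurable]: "f \<in> borel_measurable N" "g \<in> borel_measurable N"
    and f: "integrable N (\<lambda>x. (f x)\<^sup>2)" and g: "integrable N (\<lambda>x. (g x)\<^sup>2)"
  shows "integrable N (\<lambda>x. f x * g x)"
proof (rule Bochner_Integration.integrable_bound)
  show "integrable N (\<lambda>x. (f x)\<^sup>2 + (g x)\<^sup>2)" using f g by simp
  show "AE x in N. norm (f x * g x) \<le> norm ((f x)\<^sup>2 + (g x)\<^sup>2)"
  proof (intro AE_I2)
    fix x
    have "0 \<le> (\<bar>f x\<bar> - \<bar>g x\<bar>)\<^sup>2" by simp
    then have "2 * (\<bar>f x\<bar> * \<bar>g x\<bar>) \<le> (f x)\<^sup>2 + (g x)\<^sup>2"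
      by (simp add: power2_diff)
    moreover have "0 \<le> \<bar>f x\<bar> * \<bar>g x\<bar>" by simp
    ultimately have "\<bar>f x\<bar> * \<bar>g x\<bar> \<le> (f x)\<^sup>2 + (g x)\<^sup>2" by linarith
    then show "norm (f x * g x) \<le> norm ((f x)\<^sup>2 + (g x)\<^sup>2)" by (simp add: abs_mult)
  qed
qed measurable

lemma tendsto_2_ennreal: "f \<longlonglongrightarrow> (0 :: ennreal) \<Longrightarrow> (\<lambda>k. 2 * f k) \<longlonglongrightarrow> 0"
  using ennreal_tendsto_cmult[of 2 f 0 sequentially] by simp

context brownian_wrt
begin

lemma simple_integral_close:
  fixes S S' :: "(real \<times> real \<times> ('w \<Rightarrow> real ^ 'n ^ 'm)) list"
  assumes S: "simple_list T Fil S" "simple_list T Fil S'" and t: "t \<in> {0..T}"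
  shows "(\<integral>\<^sup>+ \<omega>. ennreal ((norm (simple_integral W S t \<omega> - simple_integral W S' t \<omega>))\<^sup>2) \<partial>M) \<le>
    H2_sqnorm M T (\<lambda>t \<omega>. simple_process S t \<omega> - simple_process S' t \<omega>)"
proof -
  have "(\<integral>\<^sup>+ \<omega>. ennreal ((norm (simple_integral W (S @ neg_list S') t \<omega>))\<^sup>2) \<partial>M) \<le>
    H2_sqnorm M T (simple_process (S @ neg_list S'))"
    by (rule simple_isometry_le[OF simple_list_diff[OF S] t])
  moreover have "simple_process (S @ neg_list S') = (\<lambda>t \<omega>. simple_process S t \<omega> - simple_process S' t \<omega>)"
    by (intro ext) (rule simple_process_diff)
  ultimately show ?thesis by (simp add: simple_integral_diff)
qed

text \<open>The definition of the Ito integral only offers some approximating sequence, depending on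
  the filtration. Since that sequence and the step functions both approximate H, the isometry makes
  their integrals asymptotically equal, and the fixed step functions may be used instead.\<close>

lemma ito_step_limit:
  fixes H :: "real \<Rightarrow> real ^ 'n ^ 'm"
  assumes I: "is_ito_integral M T Fil W (\<lambda>t \<omega>. H t) I" and H: "continuous_on {0..T} H" and t: "t \<in> {0..T}"
  shows "(\<lambda>k. \<integral>\<^sup>+ \<omega>. ennreal ((norm (I t \<omega> - simple_integral W (step_list T H k) t \<omega>))\<^sup>2) \<partial>M) \<longlonglongrightarrow> 0"
proof -
  obtain S where S: "\<And>k. simple_list T Fil (S k)"
    and S0: "(\<lambda>k. H2_sqnorm M T (\<lambda>t \<omega>. H t - simple_process (S k) t \<omega>)) \<longlonglongrightarrow> 0"
    and I0: "(\<lambda>k. \<integral>\<^sup>+ \<omega>. ennreal ((norm (I t \<omega> - simple_integral W (S k) t \<omega>))\<^sup>2) \<partial>M) \<longlonglongrightarrow> 0"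
    and Im: "I t \<in> borel_measurable (Fil t)"
    using I t unfolding is_ito_integral_def adapted_def by blast
  let ?H = "\<lambda>k. step_list T H k"
  have step: "simple_list T Fil (?H k)" for k
    using simple_list_step T_pos by blast
  note m = measurable_Fil_M[OF t]
  have 1: "(\<integral>\<^sup>+ \<omega>. ennreal ((norm (I t \<omega> - simple_integral W (?H k) t \<omega>))\<^sup>2) \<partial>M) \<le>
      2 * (\<integral>\<^sup>+ \<omega>. ennreal ((norm (I t \<omega> - simple_integral W (S k) t \<omega>))\<^sup>2) \<partial>M) +
      2 * (2 * H2_sqnorm M T (\<lambda>t \<omega>. H t - simple_process (S k) t \<omega>) +
        2 * H2_sqnorm M T (\<lambda>t \<omega>. H t - simple_process (?H k) t \<omega>))" for k
  proof -
    have "(\<integral>\<^sup>+ \<omega>. ennreal ((norm (simple_integral W (S k) t \<omega> - simple_integral W (?H k) t \<omega>))\<^sup>2) \<partial>M) \<le>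
      2 * H2_sqnorm M T (\<lambda>t \<omega>. H t - simple_process (S k) t \<omega>) + 2 * H2_sqnorm M T (\<lambda>t \<omega>. H t - simple_process (?H k) t \<omega>)"
      by (intro order_trans[OF simple_integral_close[OF S step t]] H2_sqnorm_diff_le
          jointly_measurable_continuous[OF H] jointly_measurable_simple S step)
    then show ?thesis
      using nn_square_diff_triangle[OF m[OF Im] m[OF simple_integral_meas[OF S t]] m[OF simple_integral_meas[OF step t]]]
      by (meson add_left_mono mult_left_mono order_trans zero_le)
  qed
  have "(\<lambda>k. 2 * (\<integral>\<^sup>+ \<omega>. ennreal ((norm (I t \<omega> - simple_integral W (S k) t \<omega>))\<^sup>2) \<partial>M) +
      2 * (2 * H2_sqnorm M T (\<lambda>t \<omega>. H t - simple_process (S k) t \<omega>) +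
        2 * H2_sqnorm M T (\<lambda>t \<omega>. H t - simple_process (?H k) t \<omega>))) \<longlonglongrightarrow> 0 + (0 + 0)"
    unfolding distrib_left by (intro tendsto_add tendsto_2_ennreal I0 S0 H2_sqnorm_step H)
  then show ?thesis
    using tendsto_sandwich[OF _ always_eventually[OF allI[OF 1]] tendsto_const, of 0] by simp
qed

end

section \<open>Mean square limits and Wiener integrals in the Brownian filtration\<close>

context brownian
begin

lemma L2_limit_AE_subseq:
  fixes Y :: "'w \<Rightarrow> 'b::euclidean_space"
  assumes Y: "Y \<in> borel_measurable M" and Z: "\<And>k. Z k \<in> borel_measurable M"
    and lim: "(\<lambda>k. \<integral>\<^sup>+ \<omega>. ennreal ((norm (Y \<omega> - Z k \<omega>))\<^sup>2) \<partial>M) \<longlonglongrightarrow> 0"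
  shows "\<exists>r :: nat \<Rightarrow> nat. AE \<omega> in M. (\<lambda>k. Z (r k) \<omega>) \<longlonglongrightarrow> Y \<omega>"
proof -
  let ?f = "\<lambda>k. \<integral>\<^sup>+ \<omega>. ennreal ((norm (Y \<omega> - Z k \<omega>))\<^sup>2) \<partial>M"
  have "\<forall>\<^sub>F k in sequentially. ?f k < 1"
    using lim by (rule order_tendstoD) simp
  \<comment> \<open>Dropping the first n terms makes each squared difference integrable, as is
    required for extracting an almost surely convergent subsequence.\<close>
  then obtain n where n: "\<And>k. n \<le> k \<Longrightarrow> ?f k < 1"
    unfolding eventually_sequentially by blast
  let ?u = "\<lambda>k \<omega>. (norm (Y \<omega> - Z (n + k) \<omega>))\<^sup>2"
  have m: "?u k \<in> borel_measurable M" for k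
    using Y Z[of "n + k"] by simp
  have int: "integrable M (?u k)" for k
    using n[of "n + k"] m[of k] by (intro integrableI_bounded) (auto simp: less_top intro: less_trans)
  have "(\<lambda>k. ?f (n + k)) \<longlonglongrightarrow> 0"
    using LIMSEQ_ignore_initial_segment[OF lim, of n] by (simp add: add.commute)
  moreover have "?f (n + k) = ennreal (\<integral>\<omega>. norm (?u k \<omega>) \<partial>M)" for k
    using nn_integral_eq_integral[OF int[of k]] by simp
  ultimately have "(\<lambda>k. ennreal (\<integral>\<omega>. norm (?u k \<omega>) \<partial>M)) \<longlonglongrightarrow> ennreal 0"
    by simp
  then have "(\<lambda>k. \<integral>\<omega>. norm (?u k \<omega>) \<partial>M) \<longlonglongrightarrow> 0"
    by (subst (asm) tendsto_ennreal_iff) (auto intro!: always_eventually Bochner_Integration.integral_nonneg)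
  from tendsto_L1_AE_subseq[OF int this] obtain r
    where r: "AE \<omega> in M. (\<lambda>k. ?u (r k) \<omega>) \<longlonglongrightarrow> 0" by blast
  have "AE \<omega> in M. (\<lambda>k. Z (n + r k) \<omega>) \<longlonglongrightarrow> Y \<omega>"
    using r
  proof (eventually_elim)
    case (elim \<omega>)
    then have "(\<lambda>k. sqrt ((norm (Y \<omega> - Z (n + r k) \<omega>))\<^sup>2)) \<longlonglongrightarrow> sqrt 0"
      by (intro tendsto_real_sqrt)
    then show ?case
      by (subst LIM_zero_iff[symmetric], subst tendsto_norm_zero_iff[symmetric]) (simp add: norm_minus_commute)
  qed
  then show ?thesis by (intro exI[of _ "\<lambda>k. n + r k"])
qed

text \<open>A subsequence converges almost surely, so Y agrees almost surely with an
  \<open>FW t\<close>-measurable limit, and null sets do not matter by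
  \<open>measurable_FW_AE\<close>. This brings integrals built in a larger filtration back into the
  Brownian one.\<close>

lemma L2_limit_measurable_FW:
  fixes Y :: "'w \<Rightarrow> 'b::euclidean_space"
  assumes t: "t \<in> {0..T}" and Y: "Y \<in> borel_measurable M" and Z: "\<And>k. Z k \<in> borel_measurable (FW t)"
    and lim: "(\<lambda>k. \<integral>\<^sup>+ \<omega>. ennreal ((norm (Y \<omega> - Z k \<omega>))\<^sup>2) \<partial>M) \<longlonglongrightarrow> 0"
  shows "Y \<in> borel_measurable (FW t)"
proof -
  obtain r where r: "AE \<omega> in M. (\<lambda>k. Z (r k) \<omega>) \<longlonglongrightarrow> Y \<omega>"
    using L2_limit_AE_subseq[OF Y measurable_FW_M[OF t Z] lim] by blast
  have "(\<lambda>\<omega>. lim (\<lambda>k. Z (r k) \<omega>)) \<in> borel_measurable (FW t)"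
    using Z by (intro borel_measurable_lim_metric)
  moreover have "AE \<omega> in M. Y \<omega> = lim (\<lambda>k. Z (r k) \<omega>)"
    using r by eventually_elim (rule limI[symmetric])
  ultimately show ?thesis by (rule measurable_FW_AE)
qed

text \<open>
  Using the same deterministic step functions for every filtration, noise given with respect to the
  enlarged filtration can be recognised as an integral with respect to the Brownian one.
\<close>

definition wiener_integral :: "(real \<Rightarrow> real ^ 'n ^ 'm) \<Rightarrow> (real \<Rightarrow> 'w \<Rightarrow> real ^ 'm) \<Rightarrow> bool" where
  "wiener_integral H I \<longleftrightarrow> adapted T FW I \<and> (\<forall>\<omega>\<in>space M. continuous_on {0..T} (\<lambda>t. I t \<omega>)) \<and>
    (\<forall>t\<in>{0..T}. (\<lambda>k. \<integral>\<^sup>+ \<omega>. ennreal ((norm (I t \<omega> - simple_integral W (step_list T H k) t \<omega>))\<^sup>2) \<partial>M) \<longlonglongrightarrow> 0)"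

lemma step_integral_meas:
  fixes H :: "real \<Rightarrow> real ^ 'n ^ 'm"
  assumes "t \<in> {0..T}"
  shows "simple_integral W (step_list T H k) t \<in> borel_measurable (FW t)"
proof -
  interpret FW: brownian_wrt M T W FW by (rule brownian_wrt_FW)
  show ?thesis by (intro FW.simple_integral_meas simple_list_step T_pos assms)
qed

text \<open>At each time the integral is a mean square limit of step integrals, which involve
  nothing but W. It is therefore adapted to \<open>FW\<close> even if it was formed with respect to
  a larger filtration.\<close>

lemma wiener_integralI:
  fixes H :: "real \<Rightarrow> real ^ 'n ^ 'm"
  assumes "brownian_wrt M T W Fil" and I: "is_ito_integral M T Fil W (\<lambda>t \<omega>. H t) I" and H: "continuous_on {0..T} H"
  shows "wiener_integral H I"
proof -
  interpret brownian_wrt M T W Fil by fact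
  have "I t \<in> borel_measurable (FW t)" if t: "t \<in> {0..T}" for t
  proof (rule L2_limit_measurable_FW[OF t _ step_integral_meas[OF t] ito_step_limit[OF I H t]])
    show "I t \<in> borel_measurable M"
      using I t measurable_Fil_M[OF t] unfolding is_ito_integral_def adapted_def by blast
  qed
  then show ?thesis
    using I ito_step_limit[OF I H] unfolding wiener_integral_def is_ito_integral_def adapted_def by blast
qed

lemma progressive_continuous:
  fixes H :: "real \<Rightarrow> 'b::topological_space"
  assumes H: "continuous_on {0..T} H"
  shows "progressive T F (\<lambda>t \<omega>. H t)"
  unfolding progressive_def
proof
  fix t assume "t \<in> {0..T}"
  then have "H \<in> borel_measurable (restrict_space borel {0..t})"
    by (intro borel_measurable_continuous_on_restrict continuous_on_subset[OF H]) auto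
  then show "(\<lambda>(s, \<omega>). H s) \<in> borel_measurable (restrict_space borel {0..t} \<Otimes>\<^sub>M F t)"
    unfolding split_beta' by (rule measurable_compose[OF measurable_fst])
qed

lemma H2_sqnorm_bounded:
  assumes B: "\<And>t \<omega>. t \<in> {0..T} \<Longrightarrow> \<omega> \<in> space M \<Longrightarrow> norm (X t \<omega>) \<le> B"
  shows "H2_sqnorm M T X \<le> ennreal (B\<^sup>2 * T)"
proof -
  have "H2_sqnorm M T X \<le> (\<integral>\<^sup>+ \<omega>. (\<integral>\<^sup>+ s\<in>{0..T}. ennreal (B\<^sup>2) \<partial>lborel) \<partial>M)"
    unfolding H2_sqnorm_def
    by (intro nn_integral_mono) (use B in \<open>auto simp: indicator_def intro!: ennreal_leI power_mono\<close>)
  also have "\<dots> = ennreal (B\<^sup>2 * T)"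
    using T_pos by (simp add: nn_integral_cmult_indicator emeasure_space_1 ennreal_mult)
  finally show ?thesis .
qed

lemma continuous_bounded:
  fixes H :: "real \<Rightarrow> 'b::real_normed_vector"
  assumes "continuous_on {0..T} H"
  obtains B where "\<And>t. t \<in> {0..T} \<Longrightarrow> norm (H t) \<le> B"
proof -
  have "bounded (H ` {0..T})"
    by (intro compact_imp_bounded compact_continuous_image assms) simp
  then show ?thesis using that unfolding bounded_iff by blast
qed

lemma wiener_integral_ito:
  fixes H :: "real \<Rightarrow> real ^ 'n ^ 'm"
  assumes I: "wiener_integral H I" and H: "continuous_on {0..T} H"
  shows "is_ito_integral M T FW W (\<lambda>t \<omega>. H t) I"
  unfolding is_ito_integral_def
proof (intro conjI exI[of _ "step_list T H"])
  obtain B where B: "\<And>t. t \<in> {0..T} \<Longrightarrow> norm (H t) \<le> B" using continuous_bounded[OF H] by blast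
  have "H2_sqnorm M T (\<lambda>t \<omega>. H t) \<le> ennreal (B\<^sup>2 * T)"
    by (intro H2_sqnorm_bounded B)
  then show "(\<lambda>t \<omega>. H t) \<in> H2_space M T FW"
    unfolding H2_space_def using progressive_continuous[OF H]
    by (auto simp: less_top[symmetric] top_unique)
qed (use I H2_sqnorm_step[OF H] T_pos in \<open>auto simp: wiener_integral_def simple_list_step\<close>)

text \<open>Carries noise through constant matrices: with projections it extracts the blocks of the
  lifted noise, and with \<open>Enoise\<close> it builds the noise of the filtered process.\<close>

lemma wiener_integral_linear:
  fixes H :: "real \<Rightarrow> real ^ 'n ^ 'm" and B :: "real ^ 'm ^ 'k"
  assumes I: "wiener_integral H I"
  shows "wiener_integral (\<lambda>t. B ** H t) (\<lambda>t \<omega>. B *v I t \<omega>)"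
  unfolding wiener_integral_def
proof (intro conjI ballI)
  have lin: "bounded_linear ((*v) B)" by (rule matrix_vector_mul_bounded_linear)
  show "adapted T FW (\<lambda>t \<omega>. B *v I t \<omega>)"
    unfolding adapted_def
  proof
    fix t assume "t \<in> {0..T}"
    then show "(\<lambda>\<omega>. B *v I t \<omega>) \<in> borel_measurable (FW t)"
      using I unfolding wiener_integral_def adapted_def
      by (intro measurable_compose[OF _ borel_measurable_continuous_onI[OF linear_continuous_on[OF lin]]]) auto
  qed
  show "continuous_on {0..T} (\<lambda>t. B *v I t \<omega>)" if "\<omega> \<in> space M" for \<omega>
    using I that unfolding wiener_integral_def by (intro bounded_linear.continuous_on[OF lin]) auto
  obtain K where K: "0 \<le> K" "\<And>x. norm (B *v x) \<le> K * norm x"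
    using bounded_linear.nonneg_bounded[OF lin] by (auto simp: mult.commute)
  fix t assume t: "t \<in> {0..T}"
  let ?f = "\<lambda>k. \<integral>\<^sup>+ \<omega>. ennreal ((norm (I t \<omega> - simple_integral W (step_list T H k) t \<omega>))\<^sup>2) \<partial>M"
  have "?f \<longlonglongrightarrow> 0" using I t unfolding wiener_integral_def by auto
  then have 0: "(\<lambda>k. ennreal (K\<^sup>2) * ?f k) \<longlonglongrightarrow> 0"
    using ennreal_tendsto_cmult[of "ennreal (K\<^sup>2)" ?f 0 sequentially] by simp
  have le: "(\<integral>\<^sup>+ \<omega>. ennreal ((norm (B *v I t \<omega> - simple_integral W (step_list T (\<lambda>t. B ** H t) k) t \<omega>))\<^sup>2) \<partial>M) \<le> ennreal (K\<^sup>2) * ?f k" for k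
  proof -
    have Im: "I t \<in> borel_measurable M" using I t measurable_FW_M[OF t] unfolding wiener_integral_def adapted_def by blast
    have "simple_integral W (step_list T (\<lambda>t. B ** H t) k) t \<omega> = B *v simple_integral W (step_list T H k) t \<omega>" for \<omega>
      unfolding step_list_nth
      by (simp only: linear_sum[OF bounded_linear.linear[OF lin]] matrix_vector_mul_assoc)
    then have "(\<integral>\<^sup>+ \<omega>. ennreal ((norm (B *v I t \<omega> - simple_integral W (step_list T (\<lambda>t. B ** H t) k) t \<omega>))\<^sup>2) \<partial>M)
        = (\<integral>\<^sup>+ \<omega>. ennreal ((norm (B *v (I t \<omega> - simple_integral W (step_list T H k) t \<omega>)))\<^sup>2) \<partial>M)"
      by (simp add: matrix_vector_mult_diff_distrib)
    also have "\<dots> \<le> (\<integral>\<^sup>+ \<omega>. ennreal (K\<^sup>2) * ennreal ((norm (I t \<omega> - simple_integral W (step_list T H k) t \<omega>))\<^sup>2) \<partial>M)"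
    proof (rule nn_integral_mono)
      fix \<omega>
      show "ennreal ((norm (B *v (I t \<omega> - simple_integral W (step_list T H k) t \<omega>)))\<^sup>2) \<le>
          ennreal (K\<^sup>2) * ennreal ((norm (I t \<omega> - simple_integral W (step_list T H k) t \<omega>))\<^sup>2)"
        unfolding ennreal_mult[symmetric, OF zero_le_power2 zero_le_power2] power_mult_distrib[symmetric]
        by (intro ennreal_leI power_mono K(2) norm_ge_zero)
    qed
    also have "\<dots> = ennreal (K\<^sup>2) * ?f k"
      using Im measurable_FW_M[OF t step_integral_meas[OF t]] by (intro nn_integral_cmult) measurable
    finally show ?thesis .
  qed
  show "(\<lambda>k. \<integral>\<^sup>+ \<omega>. ennreal ((norm (B *v I t \<omega> - simple_integral W (step_list T (\<lambda>t. B ** H t) k) t \<omega>))\<^sup>2) \<partial>M) \<longlonglongrightarrow> 0"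
    using tendsto_sandwich[OF _ always_eventually[OF allI[OF le]] tendsto_const 0] by simp
qed

lemma indistinguishable:
  fixes X Y :: "real \<Rightarrow> 'w \<Rightarrow> 'b::metric_space"
  assumes X: "\<And>\<omega>. \<omega> \<in> space M \<Longrightarrow> continuous_on {0..T} (\<lambda>t. X t \<omega>)"
    and Y: "\<And>\<omega>. \<omega> \<in> space M \<Longrightarrow> continuous_on {0..T} (\<lambda>t. Y t \<omega>)"
    and ae: "\<And>t. t \<in> {0..T} \<Longrightarrow> AE \<omega> in M. X t \<omega> = Y t \<omega>"
  shows "AE \<omega> in M. \<forall>t\<in>{0..T}. X t \<omega> = Y t \<omega>"
proof -
  obtain D :: "real set" where D: "countable D" "D \<subseteq> {0..T}" "{0..T} \<subseteq> closure D"
    using separable[of "{0..T}"] by auto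
  have "AE \<omega> in M. \<forall>t\<in>D. X t \<omega> = Y t \<omega>"
    using D(1,2) ae by (subst AE_ball_countable) auto
  then show ?thesis
    using AE_space
  proof eventually_elim
    case (elim \<omega>)
    show ?case
    proof
      fix t assume "t \<in> {0..T}"
      then obtain x where x: "\<And>n. x n \<in> D" "x \<longlonglongrightarrow> t"
        using D(3) by (metis closure_sequential subsetD)
      have "(\<lambda>n. X (x n) \<omega>) \<longlonglongrightarrow> X t \<omega>" "(\<lambda>n. Y (x n) \<omega>) \<longlonglongrightarrow> Y t \<omega>"
        using X[OF elim(2)] Y[OF elim(2)] x D(2) \<open>t \<in> {0..T}\<close> unfolding continuous_on_sequentially comp_def by blast+
      moreover have "(\<lambda>n. X (x n) \<omega>) = (\<lambda>n. Y (x n) \<omega>)" using elim(1) x by auto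
      ultimately show "X t \<omega> = Y t \<omega>" using LIMSEQ_unique by metis
    qed
  qed
qed

text \<open>Both are limits of the same step integrals, so they agree almost surely at each time;
  continuity of paths then gives one null set for all times. This is the payoff of fixing the
  approximating sequence.\<close>

lemma wiener_integral_unique:
  fixes H :: "real \<Rightarrow> real ^ 'n ^ 'm"
  assumes I: "wiener_integral H I" and J: "wiener_integral H J"
  shows "AE \<omega> in M. \<forall>t\<in>{0..T}. I t \<omega> = J t \<omega>"
proof (rule indistinguishable)
  fix t assume t: "t \<in> {0..T}"
  have m: "I t \<in> borel_measurable M" "J t \<in> borel_measurable M"
    using I J t measurable_FW_M[OF t] unfolding wiener_integral_def adapted_def by blast+
  let ?f = "\<lambda>I k. \<integral>\<^sup>+ \<omega>. ennreal ((norm (I t \<omega> - simple_integral W (step_list T H k) t \<omega>))\<^sup>2) \<partial>M"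
  have "?f I \<longlonglongrightarrow> 0" "?f J \<longlonglongrightarrow> 0" using I J t unfolding wiener_integral_def by auto
  then have "(\<lambda>k. 2 * ?f I k + 2 * ?f J k) \<longlonglongrightarrow> 0 + 0"
    by (intro tendsto_add tendsto_2_ennreal)
  moreover have "(\<integral>\<^sup>+ \<omega>. ennreal ((norm (I t \<omega> - J t \<omega>))\<^sup>2) \<partial>M) \<le> 2 * ?f I k + 2 * ?f J k" for k
    using nn_square_diff_triangle[OF m(1) measurable_FW_M[OF t step_integral_meas[OF t]] m(2), of H k]
    by (simp add: norm_minus_commute)
  ultimately have "(\<integral>\<^sup>+ \<omega>. ennreal ((norm (I t \<omega> - J t \<omega>))\<^sup>2) \<partial>M) \<le> 0"
    by (intro LIMSEQ_le_const[of _ 0]) auto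
  then have "AE \<omega> in M. ennreal ((norm (I t \<omega> - J t \<omega>))\<^sup>2) = 0"
    using m by (subst (asm) le_zero_eq, subst (asm) nn_integral_0_iff_AE) auto
  then show "AE \<omega> in M. I t \<omega> = J t \<omega>" by eventually_elim simp
qed (use I J in \<open>auto simp: wiener_integral_def\<close>)

lemma wiener_integral_L2:
  fixes H :: "real \<Rightarrow> real ^ 'n ^ 'm"
  assumes I: "wiener_integral H I" and H: "continuous_on {0..T} H"
  shows "\<exists>B. \<forall>t\<in>{0..T}. (\<integral>\<^sup>+ \<omega>. ennreal ((norm (I t \<omega>))\<^sup>2) \<partial>M) \<le> ennreal B"
proof -
  interpret FW: brownian_wrt M T W FW by (rule brownian_wrt_FW)
  obtain B where B: "\<And>t. t \<in> {0..T} \<Longrightarrow> norm (H t) \<le> B" using continuous_bounded[OF H] by blast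
  have B0: "0 \<le> B" using order_trans[OF norm_ge_zero B[of 0]] T_pos by simp
  \<comment> \<open>The first 2 stems from a step integral whose squared distance to
    \<open>I t\<close> is below 1; the second term is twice the isometry bound of that step
    integral, uniform in t.\<close>
  have "(\<integral>\<^sup>+ \<omega>. ennreal ((norm (I t \<omega>))\<^sup>2) \<partial>M) \<le> ennreal (2 + 2 * (B\<^sup>2 * T))" if t: "t \<in> {0..T}" for t
  proof -
    let ?f = "\<lambda>k. \<integral>\<^sup>+ \<omega>. ennreal ((norm (I t \<omega> - simple_integral W (step_list T H k) t \<omega>))\<^sup>2) \<partial>M"
    have m: "I t \<in> borel_measurable M"
      using I t measurable_FW_M[OF t] unfolding wiener_integral_def adapted_def by blast
    have "?f \<longlonglongrightarrow> 0" using I t unfolding wiener_integral_def by auto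
    then have "\<forall>\<^sub>F k in sequentially. ?f k < 1" by (rule order_tendstoD) simp
    then obtain k where k: "?f k < 1" using eventually_happens by force
    have "(\<integral>\<^sup>+ \<omega>. ennreal ((norm (simple_integral W (step_list T H k) t \<omega>))\<^sup>2) \<partial>M) \<le> ennreal (B\<^sup>2 * T)"
      by (intro order_trans[OF FW.simple_isometry_le H2_sqnorm_bounded] simple_list_step T_pos t step_process_bound B)
    moreover have "(\<integral>\<^sup>+ \<omega>. ennreal ((norm (I t \<omega>))\<^sup>2) \<partial>M) \<le> 2 * ?f k +
        2 * (\<integral>\<^sup>+ \<omega>. ennreal ((norm (simple_integral W (step_list T H k) t \<omega>))\<^sup>2) \<partial>M)"
      using nn_square_diff_triangle[OF m measurable_FW_M[OF t step_integral_meas[OF t]], of "\<lambda>_. 0" H k] by simp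
    ultimately have "(\<integral>\<^sup>+ \<omega>. ennreal ((norm (I t \<omega>))\<^sup>2) \<partial>M) \<le> 2 * 1 + 2 * ennreal (B\<^sup>2 * T)"
      using k by (meson add_mono mult_left_mono order_trans less_imp_le zero_le)
    also have "\<dots> = ennreal (2 + 2 * (B\<^sup>2 * T))"
      using B0 T_pos by (simp add: ennreal_mult[symmetric] flip: ennreal_numeral ennreal_plus)
    finally show ?thesis .
  qed
  then show ?thesis by blast
qed

lemma wiener_integral_square_integrable:
  fixes H :: "real \<Rightarrow> real ^ 'n ^ 'm"
  assumes I: "wiener_integral H I" and H: "continuous_on {0..T} H" and t: "t \<in> {0..T}"
  shows "(\<lambda>\<omega>. I t \<omega> $ i) \<in> borel_measurable (FW t)" "integrable M (\<lambda>\<omega>. (I t \<omega> $ i)\<^sup>2)"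
proof -
  show m: "(\<lambda>\<omega>. I t \<omega> $ i) \<in> borel_measurable (FW t)"
    using I t unfolding wiener_integral_def adapted_def by (intro borel_measurable_vec_nth) auto
  obtain B where B: "(\<integral>\<^sup>+ \<omega>. ennreal ((norm (I t \<omega>))\<^sup>2) \<partial>M) \<le> ennreal B"
    using wiener_integral_L2[OF I H] t by blast
  have "(\<integral>\<^sup>+ \<omega>. ennreal (norm ((I t \<omega> $ i)\<^sup>2)) \<partial>M) \<le> (\<integral>\<^sup>+ \<omega>. ennreal ((norm (I t \<omega>))\<^sup>2) \<partial>M)"
  proof (intro nn_integral_mono ennreal_leI)
    fix \<omega>
    show "norm ((I t \<omega> $ i)\<^sup>2) \<le> (norm (I t \<omega>))\<^sup>2"
      using power_mono[OF Finite_Cartesian_Product.norm_nth_le[of "I t \<omega>" i] norm_ge_zero, of 2]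
      by (simp add: norm_power)
  qed
  also have "\<dots> < \<infinity>" using B by (rule order.strict_trans1) simp
  finally show "integrable M (\<lambda>\<omega>. (I t \<omega> $ i)\<^sup>2)"
    using measurable_FW_M[OF t m] by (intro integrableI_bounded) auto
qed

lemma step_integral_increment:
  fixes H :: "real \<Rightarrow> real ^ 'n ^ 'm"
  assumes st: "0 \<le> s" "s \<le> t" "t \<le> T" and Z: "Z \<in> borel_measurable (FW s)" "integrable M Z"
  shows "has_bochner_integral M (\<lambda>\<omega>. Z \<omega> *
    (simple_integral W (step_list T H k) t \<omega> $ i - simple_integral W (step_list T H k) s \<omega> $ i)) 0"
proof -
  interpret FW: brownian_wrt M T W FW by (rule brownian_wrt_FW)
  let ?b = "\<lambda>i. T * real (Suc i) / real (Suc k)" and ?a = "\<lambda>i. T * real i / real (Suc k)"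
  have grid: "?a l \<le> ?b l" "0 \<le> ?a l" for l
    using T_pos by (auto intro!: divide_right_mono mult_left_mono)
  \<comment> \<open>The part of a grid cell that lies between s and t is the cell clipped on both
    sides; the cases are the cell before s, across s and after s. Clipped cells start at s or later,
    hence are orthogonal to Z.\<close>
  have inc: "W (min b t) \<omega> $ j - W (min a t) \<omega> $ j - (W (min b s) \<omega> $ j - W (min a s) \<omega> $ j)
      = dW (max s (min a t)) (max s (min b t)) j \<omega>" if "a \<le> b" for a b j \<omega>
  proof -
    consider "b \<le> s" | "a \<le> s" "s \<le> b" | "s \<le> a" using that by linarith
    then show ?thesis
    proof cases
      case 1
      then have "min a t = a" "min b t = b" "min a s = a" "min b s = b" "max s (min a t) = s" "max s (min b t) = s"
        using that st by auto
      then show ?thesis by (simp only: dW_def; simp)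
    next
      case 2
      then have "min a t = a" "min a s = a" "min b s = s" "max s (min a t) = s" "max s (min b t) = min b t"
        using that st by auto
      then show ?thesis by (simp only: dW_def; simp)
    next
      case 3
      then have "min a s = s" "min b s = s" "max s (min a t) = min a t" "max s (min b t) = min b t"
        using that st by auto
      then show ?thesis by (simp only: dW_def; simp)
    qed
  qed
  have "has_bochner_integral M (\<lambda>\<omega>. H (?a l) $ i $ j * (Z \<omega> * dW (max s (min (?a l) t)) (max s (min (?b l) t)) j \<omega>)) (H (?a l) $ i $ j * 0)" for l j
  proof (intro has_bochner_integral_mult_right)
    have "s \<le> max s (min (?a l) t)" "max s (min (?a l) t) \<le> T" "max s (min (?b l) t) \<le> T"
      using st by auto
    moreover have "max s (min (?a l) t) \<le> max s (min (?b l) t)"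
      using grid by (intro max.mono min.mono) auto
    ultimately show "has_bochner_integral M (\<lambda>\<omega>. Z \<omega> * dW (max s (min (?a l) t)) (max s (min (?b l) t)) j \<omega>) 0"
      using FW.dW_orthogonal(1,2)[of "max s (min (?a l) t)" "max s (min (?b l) t)" Z j] Z st
        measurable_FW_mono[OF _ Z(1)] by (auto simp: has_bochner_integral_iff)
  qed
  then have "has_bochner_integral M (\<lambda>\<omega>. \<Sum>l<Suc k. \<Sum>j\<in>UNIV. H (?a l) $ i $ j *
      (Z \<omega> * dW (max s (min (?a l) t)) (max s (min (?b l) t)) j \<omega>)) (\<Sum>l<Suc k. \<Sum>j\<in>UNIV. H (?a l) $ i $ j * 0)"
    by (intro has_bochner_integral_sum)
  moreover have "(\<Sum>l<Suc k. \<Sum>j\<in>UNIV. H (?a l) $ i $ j * (Z \<omega> * dW (max s (min (?a l) t)) (max s (min (?b l) t)) j \<omega>)) =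
      Z \<omega> * (simple_integral W (step_list T H k) t \<omega> $ i - simple_integral W (step_list T H k) s \<omega> $ i)" for \<omega>
    unfolding step_list_nth sum_component sum_subtractf[symmetric] sum_distrib_left
    by (intro sum.cong refl) (simp only: inc[OF grid(1), symmetric] matrix_vector_mult_def vec_lambda_beta
        vector_minus_component sum_distrib_left sum_subtractf[symmetric] algebra_simps)
  ultimately show ?thesis by simp
qed

lemma square_integrable_imp_integrable:
  fixes f :: "'w \<Rightarrow> real"
  assumes "f \<in> borel_measurable M" "integrable M (\<lambda>x. (f x)\<^sup>2)"
  shows "integrable M f"
  using integrable_mult_square[OF assms(1) borel_measurable_const[of 1] assms(2)] by simp

lemma wiener_integral_orthogonal:
  fixes H :: "real \<Rightarrow> real ^ 'n ^ 'm"
  assumes I: "wiener_integral H I" and H: "continuous_on {0..T} H"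
    and st: "0 \<le> s" "s \<le> t" "t \<le> T" and Z: "Z \<in> borel_measurable (FW s)" "integrable M (\<lambda>\<omega>. (Z \<omega>)\<^sup>2)"
  shows "expectation (\<lambda>\<omega>. Z \<omega> * I t \<omega> $ i) = expectation (\<lambda>\<omega>. Z \<omega> * I s \<omega> $ i)"
proof -
  have s: "s \<in> {0..T}" and t: "t \<in> {0..T}" using st by auto
  have Zm: "Z \<in> borel_measurable M" using measurable_FW_M[OF s Z(1)] .
  have Zi: "integrable M Z" using square_integrable_imp_integrable[OF Zm Z(2)] .
  note sq = wiener_integral_square_integrable[OF I H]
  note ZI = integrable_mult_square[OF Zm measurable_FW_M[OF t sq(1)[OF t]] Z(2) sq(2)[OF t]]
    integrable_mult_square[OF Zm measurable_FW_M[OF s sq(1)[OF s]] Z(2) sq(2)[OF s]]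
  define c where "c = expectation (\<lambda>\<omega>. Z \<omega> * (I t \<omega> $ i - I s \<omega> $ i))"
  let ?S = "\<lambda>k t. simple_integral W (step_list T H k) t"
  let ?f = "\<lambda>t k. \<integral>\<^sup>+ \<omega>. ennreal ((norm (I t \<omega> - ?S k t \<omega>))\<^sup>2) \<partial>M"
  have Im: "I t \<in> borel_measurable M" if "t \<in> {0..T}" for t
    using I that measurable_FW_M[OF that] unfolding wiener_integral_def adapted_def by blast
  have Sm: "?S k t \<in> borel_measurable M" if "t \<in> {0..T}" for t k
    by (rule measurable_FW_M[OF that step_integral_meas[OF that]])
  have le: "ennreal (c\<^sup>2) \<le> (\<integral>\<^sup>+ \<omega>. (ennreal \<bar>Z \<omega>\<bar>)\<^sup>2 \<partial>M) * (2 * ?f t k + 2 * ?f s k)" for k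
  proof -
    let ?D = "\<lambda>\<omega>. (I t \<omega> - ?S k t \<omega>) $ i - (I s \<omega> - ?S k s \<omega>) $ i"
    note o = step_integral_increment[OF st Z(1) Zi, of H k i]
    \<comment> \<open>The increment of the step integral is orthogonal to Z, so subtracting it
      leaves c unchanged while the remaining factor becomes small in mean square.\<close>
    have eq: "Z \<omega> * ?D \<omega> = Z \<omega> * (I t \<omega> $ i - I s \<omega> $ i) - Z \<omega> * (?S k t \<omega> $ i - ?S k s \<omega> $ i)" for \<omega>
      by (simp add: algebra_simps)
    have "has_bochner_integral M (\<lambda>\<omega>. Z \<omega> * ?D \<omega>) (c - 0)"
      unfolding eq c_def using ZI
      by (intro has_bochner_integral_diff o has_bochner_integral_integrable) (auto simp: algebra_simps)
    then have c: "integrable M (\<lambda>\<omega>. Z \<omega> * ?D \<omega>)" "c = expectation (\<lambda>\<omega>. Z \<omega> * ?D \<omega>)"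
      by (auto simp: has_bochner_integral_iff)
    have Dm: "?D \<in> borel_measurable M"
      using Im[OF s] Im[OF t] Sm[OF s, of k] Sm[OF t, of k]
      by (intro borel_measurable_diff borel_measurable_vec_nth)
    have "ennreal \<bar>c\<bar> \<le> (\<integral>\<^sup>+ \<omega>. ennreal (norm (Z \<omega> * ?D \<omega>)) \<partial>M)"
      unfolding c(2) real_norm_def[symmetric] by (rule integral_norm_bound_ennreal[OF c(1)])
    also have "\<dots> = (\<integral>\<^sup>+ \<omega>. ennreal \<bar>Z \<omega>\<bar> * ennreal \<bar>?D \<omega>\<bar> \<partial>M)"
      by (simp only: real_norm_def abs_mult ennreal_mult[OF abs_ge_zero abs_ge_zero])
    finally have "(ennreal \<bar>c\<bar>)\<^sup>2 \<le> (\<integral>\<^sup>+ \<omega>. ennreal \<bar>Z \<omega>\<bar> * ennreal \<bar>?D \<omega>\<bar> \<partial>M)\<^sup>2"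
      by (rule power_mono) simp
    also have "\<dots> \<le> (\<integral>\<^sup>+ \<omega>. (ennreal \<bar>Z \<omega>\<bar>)\<^sup>2 \<partial>M) * (\<integral>\<^sup>+ \<omega>. (ennreal \<bar>?D \<omega>\<bar>)\<^sup>2 \<partial>M)"
      using measurable_compose[OF Zm, of "\<lambda>x. ennreal \<bar>x\<bar>" borel] measurable_compose[OF Dm, of "\<lambda>x. ennreal \<bar>x\<bar>" borel]
      by (intro Cauchy_Schwarz_nn_integral) simp_all
    also have "(\<integral>\<^sup>+ \<omega>. (ennreal \<bar>?D \<omega>\<bar>)\<^sup>2 \<partial>M) \<le> (\<integral>\<^sup>+ \<omega>. ennreal ((norm ((I t \<omega> - ?S k t \<omega>) - (I s \<omega> - ?S k s \<omega>)))\<^sup>2) \<partial>M)"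
    proof (rule nn_integral_mono)
      fix \<omega>
      have "\<bar>?D \<omega>\<bar> \<le> norm ((I t \<omega> - ?S k t \<omega>) - (I s \<omega> - ?S k s \<omega>))"
        using Finite_Cartesian_Product.norm_nth_le[of "(I t \<omega> - ?S k t \<omega>) - (I s \<omega> - ?S k s \<omega>)" i] by simp
      then show "(ennreal \<bar>?D \<omega>\<bar>)\<^sup>2 \<le> ennreal ((norm ((I t \<omega> - ?S k t \<omega>) - (I s \<omega> - ?S k s \<omega>)))\<^sup>2)"
        unfolding ennreal_power[OF abs_ge_zero] by (intro ennreal_leI power_mono) auto
    qed
    also have "\<dots> \<le> 2 * ?f t k + 2 * ?f s k"
      using nn_square_diff_triangle[of "\<lambda>\<omega>. I t \<omega> - ?S k t \<omega>" M "\<lambda>_. 0" "\<lambda>\<omega>. I s \<omega> - ?S k s \<omega>"]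
        Im[OF s] Im[OF t] Sm[OF s, of k] Sm[OF t, of k] by (simp add: norm_minus_commute)
    finally show ?thesis
      by (simp add: ennreal_power mult_left_mono)
  qed
  have "(\<integral>\<^sup>+ \<omega>. (ennreal \<bar>Z \<omega>\<bar>)\<^sup>2 \<partial>M) = (\<integral>\<^sup>+ \<omega>. ennreal ((Z \<omega>)\<^sup>2) \<partial>M)"
    by (simp add: ennreal_power)
  also have "\<dots> < top"
    using nn_integral_eq_integral[OF Z(2)] by simp
  finally have fin: "(\<integral>\<^sup>+ \<omega>. (ennreal \<bar>Z \<omega>\<bar>)\<^sup>2 \<partial>M) < top" .
  have "?f t \<longlonglongrightarrow> 0" "?f s \<longlonglongrightarrow> 0"
    using I s t unfolding wiener_integral_def by auto
  then have "(\<lambda>k. 2 * ?f t k + 2 * ?f s k) \<longlonglongrightarrow> 0 + 0"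
    by (intro tendsto_add tendsto_2_ennreal)
  from ennreal_tendsto_cmult[OF fin this]
  have "ennreal (c\<^sup>2) \<le> (\<integral>\<^sup>+ \<omega>. (ennreal \<bar>Z \<omega>\<bar>)\<^sup>2 \<partial>M) * (0 + 0)"
    using le by (intro LIMSEQ_le_const) auto
  then have "c = 0" by simp
  then show ?thesis
    using ZI unfolding c_def by (simp add: right_diff_distrib)
qed

end

section \<open>Square integrable processes\<close>

text \<open>The path I, of which nothing is assumed, cancels in the difference and leaves an
  ordinary linear equation.\<close>

lemma linear_ode_diff:
  fixes a X X' h h' I :: "real \<Rightarrow> real"
  assumes a: "continuous_on {0..T} a"
    and X: "continuous_on {0..T} X" "set_integrable lborel {0..T} h"
      "\<And>t. t \<in> {0..T} \<Longrightarrow> X t = c + (LINT s:{0..t}|lborel. a s * X s + h s) + I t"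
    and X': "continuous_on {0..T} X'" "set_integrable lborel {0..T} h'"
      "\<And>t. t \<in> {0..T} \<Longrightarrow> X' t = c' + (LINT s:{0..t}|lborel. a s * X' s + h' s) + I t"
    and t: "t \<in> {0..T}"
  shows "X t - X' t = int_factor a t *
    ((c - c') + (LINT s:{0..t}|lborel. inverse (int_factor a s) * (h s - h' s)))"
proof (rule linear_ode_unique[OF a _ _ _ t])
  have i: "set_integrable lborel {0..T} (\<lambda>s. a s * X s + h s)" "set_integrable lborel {0..T} (\<lambda>s. a s * X' s + h' s)"
    by (intro set_integral_add set_integrable_mult_continuous continuous_set_integrable a X X')+
  show "set_integrable lborel {0..T} (\<lambda>s. h s - h' s)"
    using X(2) X'(2) by (rule set_integral_diff)
  show "continuous_on {0..T} (\<lambda>t. X t - X' t)"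
    using X(1) X'(1) by (rule continuous_on_diff)
  fix t assume t: "t \<in> {0..T}"
  have "(LINT s:{0..t}|lborel. a s * (X s - X' s) + (h s - h' s)) =
      (LINT s:{0..t}|lborel. (a s * X s + h s) - (a s * X' s + h' s))"
    by (rule set_lebesgue_integral_cong) (auto simp: algebra_simps)
  also have "\<dots> = (LINT s:{0..t}|lborel. a s * X s + h s) - (LINT s:{0..t}|lborel. a s * X' s + h' s)"
    using t by (intro set_integral_diff set_integrable_subset[OF i(1)] set_integrable_subset[OF i(2)]) auto
  finally show "X t - X' t = c - c' + (LINT s:{0..t}|lborel. a s * (X s - X' s) + (h s - h' s))"
    using X(3)[OF t] X'(3)[OF t] by simp
qed

context brownian
begin

abbreviation P where "P \<equiv> M \<Otimes>\<^sub>M lborel_on T"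
abbreviation H2 :: "(real \<Rightarrow> 'w \<Rightarrow> real) set" where "H2 \<equiv> H2_space M T FW"

lemma pair_P: "pair_sigma_finite M (lborel_on T)"
proof -
  interpret L: finite_measure "lborel_on T" by (rule finite_measure_lborel_on)
  show ?thesis by unfold_locales
qed

lemma progressive_jointly_measurable:
  fixes X :: "real \<Rightarrow> 'w \<Rightarrow> 'b::topological_space"
  assumes "progressive T FW X"
  shows "jointly_measurable M T X"
proof -
  have T: "T \<in> {0..T}" using T_pos by simp
  have 1: "(\<lambda>z. z) \<in> measurable M (FW T)"
    using subalgebra_FW[OF T] measurable_ident_sets[OF refl, of "FW T"]
    by (intro measurable_from_subalg[of M "FW T"]) simp_all
  have 2: "(\<lambda>z. z) \<in> measurable (lborel_on T) (restrict_space borel {0..T})"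
    by (rule measurable_ident_sets[OF sets_lborel_on])
  have "(\<lambda>z. (snd z, fst z)) \<in> measurable P (restrict_space borel {0..T} \<Otimes>\<^sub>M FW T)"
    by (intro measurable_Pair measurable_compose[OF measurable_snd 2] measurable_compose[OF measurable_fst 1])
  from measurable_compose[OF this bspec[OF assms[unfolded progressive_def] T]]
  show ?thesis unfolding jointly_measurable_def by (simp add: split_beta')
qed

lemma progressive_adapted:
  fixes X :: "real \<Rightarrow> 'w \<Rightarrow> 'b::topological_space"
  assumes X: "progressive T F X" and t: "t \<in> {0..T}"
  shows "X t \<in> borel_measurable (F t)"
proof -
  have "t \<in> space (restrict_space borel {0..t})" using t by (simp add: space_restrict_space)
  from measurable_compose[OF measurable_Pair1'[OF this] bspec[OF X[unfolded progressive_def] t]]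
  show ?thesis by simp
qed

lemma progressive_compose2:
  assumes X: "progressive T F X" and Y: "progressive T F Y"
    and f: "(\<lambda>(x, y). f x y) \<in> borel_measurable (borel \<Otimes>\<^sub>M borel)"
  shows "progressive T F (\<lambda>t \<omega>. f (X t \<omega>) (Y t \<omega>))"
  unfolding progressive_def
proof
  fix t assume t: "t \<in> {0..T}"
  have "(\<lambda>z. (case z of (s, \<omega>) \<Rightarrow> X s \<omega>, case z of (s, \<omega>) \<Rightarrow> Y s \<omega>)) \<in> measurable (restrict_space borel {0..t} \<Otimes>\<^sub>M F t) (borel \<Otimes>\<^sub>M borel)"
    using X Y t unfolding progressive_def by (intro measurable_Pair) auto
  from measurable_compose[OF this f]
  show "(\<lambda>(s, \<omega>). f (X s \<omega>) (Y s \<omega>)) \<in> borel_measurable (restrict_space borel {0..t} \<Otimes>\<^sub>M F t)"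
    by (simp add: split_beta')
qed

lemma progressive_vec_nth:
  fixes X :: "real \<Rightarrow> 'w \<Rightarrow> real ^ 'm"
  assumes "progressive T F X" shows "progressive T F (\<lambda>t \<omega>. X t \<omega> $ i)"
  using assms unfolding progressive_def split_beta' by (auto intro: borel_measurable_vec_nth)

lemma progressive_arith:
  fixes X Y :: "real \<Rightarrow> 'w \<Rightarrow> real"
  assumes "progressive T F X" "progressive T F Y"
  shows "progressive T F (\<lambda>t \<omega>. X t \<omega> + Y t \<omega>)" "progressive T F (\<lambda>t \<omega>. X t \<omega> * Y t \<omega>)"
  using progressive_compose2[OF assms, of "(+)"] progressive_compose2[OF assms, of "(*)"] by simp_all

lemma H2_iff:
  fixes X :: "real \<Rightarrow> 'w \<Rightarrow> real"
  assumes "progressive T FW X"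
  shows "X \<in> H2 \<longleftrightarrow> integrable P (\<lambda>z. (X (snd z) (fst z))\<^sup>2)"
    and "X \<in> H2 \<Longrightarrow> (H2_norm M T X)\<^sup>2 = (\<integral>z. (X (snd z) (fst z))\<^sup>2 \<partial>P)"
proof -
  have jm: "jointly_measurable M T X" by (rule progressive_jointly_measurable[OF assms])
  have m: "(\<lambda>z. (X (snd z) (fst z))\<^sup>2) \<in> borel_measurable P"
    using jm unfolding jointly_measurable_def split_beta' by measurable
  have eq: "H2_sqnorm M T X = (\<integral>\<^sup>+ z. ennreal ((X (snd z) (fst z))\<^sup>2) \<partial>P)"
    using H2_sqnorm_pair[OF jm] by (simp add: split_beta')
  show iff: "X \<in> H2 \<longleftrightarrow> integrable P (\<lambda>z. (X (snd z) (fst z))\<^sup>2)"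
    using assms m unfolding H2_space_def integrable_iff_bounded by (simp add: eq)
  show "(H2_norm M T X)\<^sup>2 = (\<integral>z. (X (snd z) (fst z))\<^sup>2 \<partial>P)" if "X \<in> H2"
    using nn_integral_eq_integral[of P "\<lambda>z. (X (snd z) (fst z))\<^sup>2"] that iff
    by (simp add: H2_norm_def eq Bochner_Integration.integral_nonneg)
qed

lemma H2D:
  assumes "X \<in> H2"
  shows "progressive T FW X" "(\<lambda>z. X (snd z) (fst z)) \<in> borel_measurable P"
    "integrable P (\<lambda>z. (X (snd z) (fst z))\<^sup>2)" "\<And>t. t \<in> {0..T} \<Longrightarrow> X t \<in> borel_measurable (FW t)"
proof -
  show p: "progressive T FW X" using assms by (simp add: H2_space_def)
  show "(\<lambda>z. X (snd z) (fst z)) \<in> borel_measurable P"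
    using progressive_jointly_measurable[OF p] by (simp add: jointly_measurable_def split_beta')
  show "integrable P (\<lambda>z. (X (snd z) (fst z))\<^sup>2)" using H2_iff(1)[OF p] assms by simp
  show "\<And>t. t \<in> {0..T} \<Longrightarrow> X t \<in> borel_measurable (FW t)" by (rule progressive_adapted[OF p])
qed

lemma H2_mult_integrable: "X \<in> H2 \<Longrightarrow> Y \<in> H2 \<Longrightarrow> integrable P (\<lambda>z. X (snd z) (fst z) * Y (snd z) (fst z))"
  by (intro integrable_mult_square H2D)

lemma H2_add:
  assumes X: "X \<in> H2" and Y: "Y \<in> H2" shows "(\<lambda>t \<omega>. X t \<omega> + Y t \<omega>) \<in> H2"
  using H2_iff(1)[OF progressive_arith(1)[OF H2D(1)[OF X] H2D(1)[OF Y]]]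
    H2D(3)[OF X] H2D(3)[OF Y] H2_mult_integrable[OF X Y]
  by (simp add: power2_sum mult.assoc)

lemma H2_mult_continuous:
  assumes X: "X \<in> H2" and g: "continuous_on {0..T} g" shows "(\<lambda>t \<omega>. g t * X t \<omega>) \<in> H2"
proof -
  have p: "progressive T FW (\<lambda>t \<omega>. g t * X t \<omega>)"
    by (rule progressive_arith(2)[OF progressive_continuous[OF g] H2D(1)[OF X]])
  obtain B where B: "\<And>t. t \<in> {0..T} \<Longrightarrow> norm (g t) \<le> B" using continuous_bounded[OF g] by blast
  have m: "(\<lambda>z. (g (snd z) * X (snd z) (fst z))\<^sup>2) \<in> borel_measurable P"
    using progressive_jointly_measurable[OF p] unfolding jointly_measurable_def split_beta' by measurable
  have "integrable P (\<lambda>z. (g (snd z) * X (snd z) (fst z))\<^sup>2)"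
  proof (rule Bochner_Integration.integrable_bound[OF _ m])
    show "integrable P (\<lambda>z. B\<^sup>2 * (X (snd z) (fst z))\<^sup>2)" using H2D(3)[OF X] by simp
    show "AE z in P. norm ((g (snd z) * X (snd z) (fst z))\<^sup>2) \<le> norm (B\<^sup>2 * (X (snd z) (fst z))\<^sup>2)"
    proof (intro AE_I2)
      fix z assume "z \<in> space P"
      then have "\<bar>g (snd z)\<bar> \<le> B" using B[of "snd z"] by (auto simp: space_pair_measure)
      then have "(g (snd z))\<^sup>2 \<le> B\<^sup>2" using power_mono[of "\<bar>g (snd z)\<bar>" B 2] by simp
      then show "norm ((g (snd z) * X (snd z) (fst z))\<^sup>2) \<le> norm (B\<^sup>2 * (X (snd z) (fst z))\<^sup>2)"
        by (simp add: power_mult_distrib mult_right_mono)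
    qed
  qed
  then show ?thesis using H2_iff(1)[OF p] by simp
qed

lemma H2_cmult: "X \<in> H2 \<Longrightarrow> (\<lambda>t \<omega>. c * X t \<omega>) \<in> H2"
  by (rule H2_mult_continuous) auto

lemma H2_diff: "X \<in> H2 \<Longrightarrow> Y \<in> H2 \<Longrightarrow> (\<lambda>t \<omega>. X t \<omega> - Y t \<omega>) \<in> H2"
  using H2_add[OF _ H2_cmult[of Y "- 1"]] by simp

lemma H2_zero: "(\<lambda>t \<omega>. 0) \<in> H2"
  using H2_iff(1)[OF progressive_continuous[OF continuous_on_const]] by simp

lemma H2_continuous: "continuous_on {0..T} g \<Longrightarrow> (\<lambda>t \<omega>. g t) \<in> H2"
proof -
  have "(\<lambda>t \<omega>. 1 :: real) \<in> H2"
  proof -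
    interpret L: finite_measure "lborel_on T" by (rule finite_measure_lborel_on)
    interpret PF: finite_measure P by (rule finite_measure_pair_measure; unfold_locales)
    show ?thesis using H2_iff(1)[OF progressive_continuous[OF continuous_on_const]] by simp
  qed
  from H2_mult_continuous[OF this] show "continuous_on {0..T} g \<Longrightarrow> (\<lambda>t \<omega>. g t) \<in> H2" by simp
qed

lemma H2_sum: "(\<And>i. i \<in> A \<Longrightarrow> X i \<in> H2) \<Longrightarrow> (\<lambda>t \<omega>. \<Sum>i\<in>A. X i t \<omega>) \<in> H2"
  by (induction A rule: infinite_finite_induct) (auto intro: H2_add H2_zero)

lemma H2_vec_nth:
  assumes "X \<in> H2_space M T FW" shows "(\<lambda>t \<omega>. X t \<omega> $ i :: real) \<in> H2"
proof -
  have "H2_sqnorm M T (\<lambda>t \<omega>. X t \<omega> $ i) \<le> H2_sqnorm M T X"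
    unfolding H2_sqnorm_def
    by (intro nn_integral_mono mult_right_mono ennreal_leI power_mono Finite_Cartesian_Product.norm_nth_le) auto
  then show ?thesis
    using assms unfolding H2_space_def by (auto intro: progressive_vec_nth order.strict_trans1)
qed

text \<open>Fubini on the product measure. Integrability of the path itself comes from its product
  with the constant process 1, which belongs to H2 as the time interval is finite.\<close>

lemma H2_paths:
  assumes "X \<in> H2"
  shows "AE \<omega> in M. set_integrable lborel {0..T} (\<lambda>t. (X t \<omega>)\<^sup>2) \<and> set_integrable lborel {0..T} (\<lambda>t. X t \<omega>)"
proof -
  interpret pair_sigma_finite M "lborel_on T" by (rule pair_P)
  have 1: "AE \<omega> in M. integrable (lborel_on T) (\<lambda>t. (X t \<omega>)\<^sup>2)"
    using AE_integrable_fst[of "\<lambda>\<omega> t. (X t \<omega>)\<^sup>2"] H2D(3)[OF assms] by (simp add: split_beta')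
  have 2: "AE \<omega> in M. integrable (lborel_on T) (\<lambda>t. X t \<omega>)"
    using AE_integrable_fst[of "\<lambda>\<omega> t. X t \<omega>"] H2_mult_integrable[OF H2_continuous[of "\<lambda>_. 1"] assms]
    by (simp add: split_beta')
  from 1 2 show ?thesis unfolding set_integrable_lborel_on by eventually_elim simp
qed

text \<open>Rounding time down to multiples of 1 / (n + 1) turns the process into a countable
  patchwork of adapted variables; path continuity carries measurability to the limit.\<close>

lemma continuous_adapted_progressive:
  fixes X :: "real \<Rightarrow> 'w \<Rightarrow> real"
  assumes ad: "adapted T FW X" and c: "\<And>\<omega>. \<omega> \<in> space M \<Longrightarrow> continuous_on {0..T} (\<lambda>t. X t \<omega>)"
  shows "progressive T FW X"
  unfolding progressive_def
proof
  fix t assume t: "t \<in> {0..T}"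
  let ?N = "restrict_space borel {0..t} \<Otimes>\<^sub>M FW t"
  let ?g = "\<lambda>n (s :: real). nat \<lfloor>real (Suc n) * s\<rfloor>"
  have sp: "space ?N = {0..t} \<times> space M" by (auto simp: space_pair_measure space_restrict_space)
  show "(\<lambda>(s, \<omega>). X s \<omega>) \<in> borel_measurable ?N"
  proof (rule borel_measurable_LIMSEQ_metric)
    fix n
    show "(\<lambda>z. X (min t (real (?g n (fst z)) / real (Suc n))) (snd z)) \<in> borel_measurable ?N"
    proof (rule measurable_compose_countable[where f="\<lambda>j z. X (min t (real j / real (Suc n))) (snd z)"])
      fix j :: nat
      have "X (min t (real j / real (Suc n))) \<in> borel_measurable (FW t)"
        using t by (intro measurable_FW_mono[of "min t (real j / real (Suc n))" t] bspec[OF ad[unfolded adapted_def]]) auto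
      then show "(\<lambda>z. X (min t (real j / real (Suc n))) (snd z)) \<in> borel_measurable ?N"
        by (rule measurable_compose[OF measurable_snd])
    next
      have "?g n \<in> measurable (restrict_space borel {0..t}) (count_space UNIV)"
        by (intro measurable_restrict_space1) measurable
      then show "(\<lambda>z. ?g n (fst z)) \<in> measurable ?N (count_space UNIV)"
        by (rule measurable_compose[OF measurable_fst])
    qed
  next
    fix z assume "z \<in> space ?N"
    then obtain s \<omega> where z: "z = (s, \<omega>)" "s \<in> {0..t}" "\<omega> \<in> space M" unfolding sp by auto
    let ?x = "\<lambda>n. min t (real (?g n s) / real (Suc n))"
    have le: "real (?g n s) / real (Suc n) \<le> s" "s - 1 / real (Suc n) \<le> real (?g n s) / real (Suc n)" for n
    proof -
      have "real (?g n s) = of_int \<lfloor>real (Suc n) * s\<rfloor>" using z by simp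
      then have "real (?g n s) \<le> real (Suc n) * s" "real (Suc n) * s - 1 \<le> real (?g n s)" by linarith+
      moreover have "x \<le> N * s \<Longrightarrow> 0 < N \<Longrightarrow> x / N \<le> s" "N * s - 1 \<le> x \<Longrightarrow> 0 < N \<Longrightarrow> s - 1 / N \<le> x / N"
        for x N :: real
        using divide_right_mono[of "N * s - 1" x N] by (simp_all add: pos_divide_le_eq mult.commute diff_divide_distrib)
      moreover have "0 < real (Suc n)" by simp
      ultimately show "real (?g n s) / real (Suc n) \<le> s" "s - 1 / real (Suc n) \<le> real (?g n s) / real (Suc n)"
        by blast+
    qed
    have lim: "(\<lambda>n. s - 1 / real (Suc n)) \<longlonglongrightarrow> s"
      using tendsto_diff[OF tendsto_const LIMSEQ_Suc[OF lim_1_over_n], of s] by simp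
    have bounds: "s - 1 / real (Suc n) \<le> ?x n" "?x n \<le> s" for n
    proof -
      have "s - 1 / real (Suc n) \<le> s" by simp
      also have "s \<le> t" using z(2) by simp
      finally show "s - 1 / real (Suc n) \<le> ?x n" using le(2)[of n] by (rule min.boundedI)
      show "?x n \<le> s" using le(1)[of n] by (rule min.coboundedI2)
    qed
    have "?x \<longlonglongrightarrow> s"
      by (rule tendsto_sandwich[OF always_eventually[OF allI[OF bounds(1)]] always_eventually[OF allI[OF bounds(2)]] lim tendsto_const])
    moreover have "?x n \<in> {0..T}" for n using t by auto
    ultimately have "(\<lambda>n. X (?x n) \<omega>) \<longlonglongrightarrow> X s \<omega>"
      using c[OF z(3)] z(2) t unfolding continuous_on_sequentially comp_def by auto
    then show "(\<lambda>n. X (min t (real (?g n (fst z)) / real (Suc n))) (snd z)) \<longlonglongrightarrow> (case z of (s, \<omega>) \<Rightarrow> X s \<omega>)"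
      by (simp add: z)
  qed
qed

text \<open>Second moments bounded uniformly in time. Unlike membership in \<open>H2\<close>, this
  permits evaluation at the single time T, which the terminal cost requires.\<close>

definition L2cont :: "(real \<Rightarrow> 'w \<Rightarrow> real) \<Rightarrow> bool" where
  "L2cont X \<longleftrightarrow> adapted T FW X \<and> (\<forall>\<omega>\<in>space M. continuous_on {0..T} (\<lambda>t. X t \<omega>)) \<and>
    (\<exists>B. \<forall>t\<in>{0..T}. (\<integral>\<^sup>+ \<omega>. ennreal ((X t \<omega>)\<^sup>2) \<partial>M) \<le> ennreal B)"

lemma L2contI:
  assumes "\<And>t. t \<in> {0..T} \<Longrightarrow> X t \<in> borel_measurable (FW t)"
    and "\<And>\<omega>. \<omega> \<in> space M \<Longrightarrow> continuous_on {0..T} (\<lambda>t. X t \<omega>)"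
    and "\<And>t. t \<in> {0..T} \<Longrightarrow> (\<integral>\<^sup>+ \<omega>. ennreal ((X t \<omega>)\<^sup>2) \<partial>M) \<le> ennreal B"
  shows "L2cont X"
  using assms unfolding L2cont_def adapted_def by blast

lemma L2cont_path: "L2cont X \<Longrightarrow> \<omega> \<in> space M \<Longrightarrow> continuous_on {0..T} (\<lambda>t. X t \<omega>)"
  by (simp add: L2cont_def)

lemma L2contD:
  assumes "L2cont X" "t \<in> {0..T}"
  shows "X t \<in> borel_measurable (FW t)" "X t \<in> borel_measurable M" "integrable M (\<lambda>\<omega>. (X t \<omega>)\<^sup>2)" "integrable M (X t)"
proof -
  show 1: "X t \<in> borel_measurable (FW t)" using assms by (auto simp: L2cont_def adapted_def)
  then show 2: "X t \<in> borel_measurable M" using measurable_FW_M assms by blast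
  obtain B where "(\<integral>\<^sup>+ \<omega>. ennreal ((X t \<omega>)\<^sup>2) \<partial>M) \<le> ennreal B"
    using assms unfolding L2cont_def by blast
  then have "(\<integral>\<^sup>+ \<omega>. ennreal ((X t \<omega>)\<^sup>2) \<partial>M) < \<infinity>"
    by (rule order.strict_trans1) simp
  with 2 show 3: "integrable M (\<lambda>\<omega>. (X t \<omega>)\<^sup>2)"
    by (intro integrableI_bounded) auto
  show "integrable M (X t)" by (rule square_integrable_imp_integrable[OF 2 3])
qed

lemma L2cont_H2:
  assumes "L2cont X" shows "X \<in> H2"
proof -
  interpret pair_sigma_finite M "lborel_on T" by (rule pair_P)
  have p: "progressive T FW X" using assms by (intro continuous_adapted_progressive) (auto simp: L2cont_def)
  have jm: "jointly_measurable M T X" by (rule progressive_jointly_measurable[OF p])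
  then have m: "(\<lambda>z. ennreal ((X (snd z) (fst z))\<^sup>2)) \<in> borel_measurable P"
    unfolding jointly_measurable_def split_beta' by measurable
  obtain B where B: "\<And>t. t \<in> {0..T} \<Longrightarrow> (\<integral>\<^sup>+ \<omega>. ennreal ((X t \<omega>)\<^sup>2) \<partial>M) \<le> ennreal B"
    using assms unfolding L2cont_def by blast
  have "H2_sqnorm M T X = (\<integral>\<^sup>+ t. (\<integral>\<^sup>+ \<omega>. ennreal ((X t \<omega>)\<^sup>2) \<partial>M) \<partial>lborel_on T)"
    using H2_sqnorm_pair[OF jm] nn_integral_snd[OF m] by (simp add: split_beta')
  also have "\<dots> \<le> (\<integral>\<^sup>+ t. ennreal B \<partial>lborel_on T)"
    by (intro nn_integral_mono B) simp
  also have "\<dots> < \<infinity>"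
    by (simp add: emeasure_restrict_space ennreal_mult_less_top emeasure_lborel_Icc_eq)
  finally show ?thesis using p by (simp add: H2_space_def)
qed

text \<open>Transfers the property from a solution built explicitly to another solution, such as one
  chosen by \<open>SOME\<close>, once uniqueness identifies the two almost surely at each
  time.\<close>

lemma L2cont_AE:
  assumes X: "L2cont X" and Y: "\<And>\<omega>. \<omega> \<in> space M \<Longrightarrow> continuous_on {0..T} (\<lambda>t. Y t \<omega>)"
    and ae: "\<And>t. t \<in> {0..T} \<Longrightarrow> AE \<omega> in M. Y t \<omega> = X t \<omega>"
  shows "L2cont Y"
proof -
  have "(\<integral>\<^sup>+ \<omega>. ennreal ((Y t \<omega>)\<^sup>2) \<partial>M) = (\<integral>\<^sup>+ \<omega>. ennreal ((X t \<omega>)\<^sup>2) \<partial>M)" if "t \<in> {0..T}" for t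
    by (intro nn_integral_cong_AE) (use ae[OF that] in auto)
  then show ?thesis
    using X Y measurable_FW_AE[OF L2contD(1)[OF X] ae] unfolding L2cont_def adapted_def by auto
qed

lemma L2cont_add:
  assumes X: "L2cont X" and Y: "L2cont Y" shows "L2cont (\<lambda>t \<omega>. X t \<omega> + Y t \<omega>)"
proof -
  obtain B where B: "\<And>t. t \<in> {0..T} \<Longrightarrow> (\<integral>\<^sup>+ \<omega>. ennreal ((X t \<omega>)\<^sup>2) \<partial>M) \<le> ennreal B"
    using X unfolding L2cont_def by blast
  obtain B' where B': "\<And>t. t \<in> {0..T} \<Longrightarrow> (\<integral>\<^sup>+ \<omega>. ennreal ((Y t \<omega>)\<^sup>2) \<partial>M) \<le> ennreal B'"
    using Y unfolding L2cont_def by blast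
  \<comment> \<open>The given bounds are arbitrary reals, and \<open>ennreal\<close> truncates
    negative ones to 0; hence \<open>max 0\<close>.\<close>
  have "(\<integral>\<^sup>+ \<omega>. ennreal ((X t \<omega> + Y t \<omega>)\<^sup>2) \<partial>M) \<le> ennreal (2 * max 0 B + 2 * max 0 B')" if t: "t \<in> {0..T}" for t
  proof -
    have "(\<integral>\<^sup>+ \<omega>. ennreal ((X t \<omega> + Y t \<omega>)\<^sup>2) \<partial>M) \<le> 2 * (\<integral>\<^sup>+ \<omega>. ennreal ((X t \<omega>)\<^sup>2) \<partial>M) + 2 * (\<integral>\<^sup>+ \<omega>. ennreal ((Y t \<omega>)\<^sup>2) \<partial>M)"
      using nn_square_diff_triangle[of "X t" M "\<lambda>_. 0" "\<lambda>\<omega>. - Y t \<omega>"] L2contD(2)[OF X t] L2contD(2)[OF Y t] by simp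
    also have "\<dots> \<le> 2 * ennreal (max 0 B) + 2 * ennreal (max 0 B')"
      using B[OF t] B'[OF t] by (intro add_mono mult_left_mono) (auto intro: order_trans simp: ennreal_leI)
    also have "\<dots> = ennreal (2 * max 0 B + 2 * max 0 B')"
      unfolding ennreal_numeral[symmetric] by (simp add: ennreal_mult del: ennreal_numeral)
    finally show ?thesis .
  qed
  then show ?thesis
    using X Y by (intro L2contI[of _ "2 * max 0 B + 2 * max 0 B'"] continuous_on_add borel_measurable_add)
      (simp_all add: L2contD L2cont_path)
qed

lemma L2cont_mult_continuous:
  assumes X: "L2cont X" and g: "continuous_on {0..T} g" shows "L2cont (\<lambda>t \<omega>. g t * X t \<omega>)"
proof -
  obtain B where B: "\<And>t. t \<in> {0..T} \<Longrightarrow> (\<integral>\<^sup>+ \<omega>. ennreal ((X t \<omega>)\<^sup>2) \<partial>M) \<le> ennreal B"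
    using X unfolding L2cont_def by blast
  obtain C where C: "\<And>t. t \<in> {0..T} \<Longrightarrow> norm (g t) \<le> C" using continuous_bounded[OF g] by blast
  have "(\<integral>\<^sup>+ \<omega>. ennreal ((g t * X t \<omega>)\<^sup>2) \<partial>M) \<le> ennreal (C\<^sup>2 * B)" if t: "t \<in> {0..T}" for t
  proof -
    have "(g t)\<^sup>2 \<le> C\<^sup>2" using power_mono[OF C[OF t], of 2] by simp
    have "(\<integral>\<^sup>+ \<omega>. ennreal ((g t * X t \<omega>)\<^sup>2) \<partial>M) = ennreal ((g t)\<^sup>2) * (\<integral>\<^sup>+ \<omega>. ennreal ((X t \<omega>)\<^sup>2) \<partial>M)"
      using L2contD(2)[OF X t] by (subst nn_integral_cmult[symmetric]) (auto simp: power_mult_distrib ennreal_mult)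
    also have "\<dots> \<le> ennreal (C\<^sup>2) * ennreal B"
      using B[OF t] \<open>(g t)\<^sup>2 \<le> C\<^sup>2\<close> by (intro mult_mono) (auto intro: ennreal_leI)
    also have "\<dots> = ennreal (C\<^sup>2 * B)" by (simp add: ennreal_mult')
    finally show ?thesis .
  qed
  then show ?thesis
    using X g by (intro L2contI continuous_on_mult borel_measurable_times) (auto intro: L2contD L2cont_path)
qed

lemma L2cont_continuous:
  assumes g: "continuous_on {0..T} g" shows "L2cont (\<lambda>t \<omega>. g t)"
proof -
  obtain C where C: "\<And>t. t \<in> {0..T} \<Longrightarrow> norm (g t) \<le> C" using continuous_bounded[OF g] by blast
  have "(\<integral>\<^sup>+ \<omega>. ennreal ((g t)\<^sup>2) \<partial>M) \<le> ennreal (C\<^sup>2)" if t: "t \<in> {0..T}" for t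
    using power_mono[OF C[OF t], of 2] by (simp add: emeasure_space_1 ennreal_leI)
  then show ?thesis using g by (intro L2contI) auto
qed

lemma L2cont_sum: "(\<And>i. i \<in> A \<Longrightarrow> L2cont (X i)) \<Longrightarrow> L2cont (\<lambda>t \<omega>. \<Sum>i\<in>A. X i t \<omega>)"
  by (induction A rule: infinite_finite_induct) (auto intro: L2cont_add L2cont_continuous)

end

section \<open>Linear equations driven by processes\<close>

context brownian
begin

text \<open>The solution of y' = a y + h with y(0) = 0, encoded by variation of constants so that
  uniqueness is built in. The integral equation is recovered in
  \<open>ode_process_eq\<close>.\<close>

definition ode_process :: "(real \<Rightarrow> real) \<Rightarrow> (real \<Rightarrow> 'w \<Rightarrow> real) \<Rightarrow> (real \<Rightarrow> 'w \<Rightarrow> real) \<Rightarrow> bool" where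
  "ode_process a h y \<longleftrightarrow> (\<forall>\<omega>\<in>space M. continuous_on {0..T} (\<lambda>t. y t \<omega>)) \<and>
    (AE \<omega> in M. \<forall>t\<in>{0..T}. y t \<omega> = int_factor a t * (LINT s:{0..t}|lborel. inverse (int_factor a s) * h s \<omega>))"

lemma progressive_integral_measurable:
  fixes h :: "real \<Rightarrow> 'w \<Rightarrow> real"
  assumes h: "progressive T FW h" and t: "t \<in> {0..T}"
  shows "(\<lambda>\<omega>. LINT s:{0..t}|lborel. h s \<omega>) \<in> borel_measurable (FW t)"
proof -
  interpret L: finite_measure "lborel_on t" by (rule finite_measure_lborel_on)
  have 2: "(\<lambda>z. z) \<in> measurable (lborel_on t) (restrict_space borel {0..t})"
    by (rule measurable_ident_sets[OF sets_lborel_on])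
  have "(\<lambda>z. (snd z, fst z)) \<in> measurable (FW t \<Otimes>\<^sub>M lborel_on t) (restrict_space borel {0..t} \<Otimes>\<^sub>M FW t)"
    by (intro measurable_Pair measurable_compose[OF measurable_snd 2]) simp
  from measurable_compose[OF this bspec[OF h[unfolded progressive_def] t]]
  have "(\<lambda>(\<omega>, s). h s \<omega>) \<in> borel_measurable (FW t \<Otimes>\<^sub>M lborel_on t)"
    by (simp add: split_beta')
  then show ?thesis
    unfolding LINT_lborel_on by (rule L.borel_measurable_lebesgue_integral)
qed

lemma H2_integral_square:
  assumes h: "h \<in> H2"
  shows "integrable M (\<lambda>\<omega>. LINT s:{0..T}|lborel. (h s \<omega>)\<^sup>2)"
    "expectation (\<lambda>\<omega>. LINT s:{0..T}|lborel. (h s \<omega>)\<^sup>2) = (H2_norm M T h)\<^sup>2"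
proof -
  interpret pair_sigma_finite M "lborel_on T" by (rule pair_P)
  have i: "integrable P (\<lambda>(\<omega>, s). (h s \<omega>)\<^sup>2)" using H2D(3)[OF h] by (simp add: split_beta')
  show "integrable M (\<lambda>\<omega>. LINT s:{0..T}|lborel. (h s \<omega>)\<^sup>2)"
    unfolding LINT_lborel_on by (rule integrable_fst[OF i])
  show "expectation (\<lambda>\<omega>. LINT s:{0..T}|lborel. (h s \<omega>)\<^sup>2) = (H2_norm M T h)\<^sup>2"
    unfolding LINT_lborel_on using integral_fst[OF i] H2_iff(2)[OF H2D(1)[OF h] h] by (simp add: split_beta')
qed

lemma ode_process_bound:
  assumes a: "continuous_on {0..T} a"
  shows "\<exists>B\<ge>0. \<forall>h y. h \<in> H2 \<and> ode_process a h y \<longrightarrow>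
    (\<forall>t\<in>{0..T}. (\<integral>\<^sup>+ \<omega>. ennreal ((y t \<omega>)\<^sup>2) \<partial>M) \<le> ennreal (B * (H2_norm M T h)\<^sup>2))"
proof -
  obtain B where B: "0 \<le> B" "\<And>h y t. \<lbrakk>set_integrable lborel {0..T} h; set_integrable lborel {0..T} (\<lambda>s. (h s)\<^sup>2);
      t \<in> {0..T}; y t = int_factor a t * (LINT s:{0..t}|lborel. inverse (int_factor a s) * h s)\<rbrakk> \<Longrightarrow>
      (y t :: real)\<^sup>2 \<le> B * (LINT s:{0..T}|lborel. (h s)\<^sup>2)"
    using linear_ode_bound[OF a] by blast
  show ?thesis
  proof (intro exI[of _ B] conjI allI impI ballI B(1))
    fix h y t assume "h \<in> H2 \<and> ode_process a h y" and t: "t \<in> {0..T}"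
    then have h: "h \<in> H2" and y: "ode_process a h y" by auto
    have "(\<integral>\<^sup>+ \<omega>. ennreal ((y t \<omega>)\<^sup>2) \<partial>M) \<le> (\<integral>\<^sup>+ \<omega>. ennreal (B * (LINT s:{0..T}|lborel. (h s \<omega>)\<^sup>2)) \<partial>M)"
    proof (rule nn_integral_mono_AE)
      show "AE \<omega> in M. ennreal ((y t \<omega>)\<^sup>2) \<le> ennreal (B * (LINT s:{0..T}|lborel. (h s \<omega>)\<^sup>2))"
        using H2_paths[OF h] conjunct2[OF y[unfolded ode_process_def]]
      proof eventually_elim
        case (elim \<omega>)
        then show ?case using t by (intro ennreal_leI B(2)[of "\<lambda>s. h s \<omega>" t "\<lambda>t. y t \<omega>"]) auto
      qed
    qed
    also have "\<dots> = ennreal (B * (H2_norm M T h)\<^sup>2)"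
    proof -
      have "0 \<le> (LINT s:{0..T}|lborel. (h s \<omega>)\<^sup>2)" for \<omega>
        unfolding set_lebesgue_integral_def by (intro Bochner_Integration.integral_nonneg) simp
      then show ?thesis
        using nn_integral_eq_integral[of M "\<lambda>\<omega>. B * (LINT s:{0..T}|lborel. (h s \<omega>)\<^sup>2)"] H2_integral_square[OF h] B(1)
        by simp
    qed
    finally show "(\<integral>\<^sup>+ \<omega>. ennreal ((y t \<omega>)\<^sup>2) \<partial>M) \<le> ennreal (B * (H2_norm M T h)\<^sup>2)" .
  qed
qed

lemma ode_process_exists:
  assumes a: "continuous_on {0..T} a" and h: "h \<in> H2"
  shows "\<exists>y. ode_process a h y \<and> L2cont y"
proof -
  let ?E = "int_factor a"
  \<comment> \<open>Paths along which h is not integrable get the default 0, because continuity is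
    demanded at every sample point and not merely almost surely.\<close>
  define y where "y t \<omega> = (if set_integrable lborel {0..T} (\<lambda>s. h s \<omega>)
    then ?E t * (LINT s:{0..t}|lborel. inverse (?E s) * h s \<omega>) else 0)" for t \<omega>
  have ae: "AE \<omega> in M. y t \<omega> = ?E t * (LINT s:{0..t}|lborel. inverse (?E s) * h s \<omega>)" for t
    using H2_paths[OF h] by eventually_elim (simp add: y_def)
  have "AE \<omega> in M. \<forall>t\<in>{0..T}. y t \<omega> = ?E t * (LINT s:{0..t}|lborel. inverse (?E s) * h s \<omega>)"
    using H2_paths[OF h] by eventually_elim (simp add: y_def)
  moreover have c: "continuous_on {0..T} (\<lambda>t. y t \<omega>)" for \<omega>
  proof (cases "set_integrable lborel {0..T} (\<lambda>s. h s \<omega>)")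
    case True
    show ?thesis by (rule linear_ode_solution(1)[OF a True, of _ 0]) (use True in \<open>simp add: y_def\<close>)
  qed (simp add: y_def)
  ultimately have od: "ode_process a h y" by (simp add: ode_process_def)
  have m: "y t \<in> borel_measurable (FW t)" if t: "t \<in> {0..T}" for t
  proof (rule measurable_FW_AE[OF _ ae])
    have "progressive T FW (\<lambda>s \<omega>. inverse (?E s) * h s \<omega>)"
      by (intro progressive_arith progressive_continuous continuous_on_inverse_int_factor a H2D(1)[OF h])
    from progressive_integral_measurable[OF this t]
    show "(\<lambda>\<omega>. ?E t * (LINT s:{0..t}|lborel. inverse (?E s) * h s \<omega>)) \<in> borel_measurable (FW t)"
      by measurable
  qed
  obtain B where "\<And>t. t \<in> {0..T} \<Longrightarrow> (\<integral>\<^sup>+ \<omega>. ennreal ((y t \<omega>)\<^sup>2) \<partial>M) \<le> ennreal (B * (H2_norm M T h)\<^sup>2)"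
    using ode_process_bound[OF a] od h by blast
  then have "L2cont y" by (intro L2contI m c)
  with od show ?thesis by blast
qed

lemma ode_process_L2cont:
  assumes a: "continuous_on {0..T} a" and h: "h \<in> H2" and y: "ode_process a h y"
  shows "L2cont y"
proof -
  obtain y' where y': "ode_process a h y'" "L2cont y'" using ode_process_exists[OF a h] by blast
  have "AE \<omega> in M. y t \<omega> = y' t \<omega>" if "t \<in> {0..T}" for t
    using conjunct2[OF y[unfolded ode_process_def]] conjunct2[OF y'(1)[unfolded ode_process_def]]
    by eventually_elim (use that in simp)
  then show ?thesis
    using y by (intro L2cont_AE[OF y'(2)]) (auto simp: ode_process_def)
qed

lemma ode_process_eq:
  assumes a: "continuous_on {0..T} a" and h: "h \<in> H2" and y: "ode_process a h y"
  shows "AE \<omega> in M. \<forall>t\<in>{0..T}. y t \<omega> = (LINT s:{0..t}|lborel. a s * y s \<omega> + h s \<omega>)"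
  using H2_paths[OF h] conjunct2[OF y[unfolded ode_process_def]]
proof eventually_elim
  case (elim \<omega>)
  then show ?case using linear_ode_solution(2)[OF a, of "\<lambda>s. h s \<omega>" "\<lambda>t. y t \<omega>" 0] by simp
qed

text \<open>One component of a state equation with linear drift, forcing h and additive noise path
  I. The forcing is not asked to be adapted: in the upper block of the lifted state it contains the
  factor \<open>r\<close>.\<close>

definition lin_process :: "(real \<Rightarrow> real) \<Rightarrow> real \<Rightarrow> (real \<Rightarrow> 'w \<Rightarrow> real) \<Rightarrow> (real \<Rightarrow> 'w \<Rightarrow> real) \<Rightarrow> (real \<Rightarrow> 'w \<Rightarrow> real) \<Rightarrow> bool" where
  "lin_process a c h I X \<longleftrightarrow> (\<forall>\<omega>\<in>space M. continuous_on {0..T} (\<lambda>t. X t \<omega>)) \<and>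
    (AE \<omega> in M. set_integrable lborel {0..T} (\<lambda>t. h t \<omega>)) \<and>
    (AE \<omega> in M. \<forall>t\<in>{0..T}. X t \<omega> = c + (LINT s:{0..t}|lborel. a s * X s \<omega> + h s \<omega>) + I t \<omega>)"

text \<open>X - I is absolutely continuous and solves an ordinary linear equation with forcing a I +
  h. So the stochastic equation is solved path by path; \<open>int_factor a t * c\<close> carries
  the initial value.\<close>

lemma lin_process_exists:
  assumes a: "continuous_on {0..T} a" and h: "h \<in> H2" and I: "L2cont I"
  shows "\<exists>X. lin_process a c h I X \<and> L2cont X"
proof -
  have k: "(\<lambda>t \<omega>. a t * I t \<omega> + h t \<omega>) \<in> H2"
    by (intro H2_add L2cont_H2 L2cont_mult_continuous I a h)
  then obtain y where y: "ode_process a (\<lambda>t \<omega>. a t * I t \<omega> + h t \<omega>) y" "L2cont y"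
    using ode_process_exists[OF a] by blast
  define X where "X t \<omega> = (int_factor a t * c + y t \<omega>) + I t \<omega>" for t \<omega>
  have L: "L2cont X"
    unfolding X_def
    by (intro L2cont_add L2cont_continuous y(2) I continuous_intros continuous_on_int_factor a)
  have "AE \<omega> in M. \<forall>t\<in>{0..T}. X t \<omega> = c + (LINT s:{0..t}|lborel. a s * X s \<omega> + h s \<omega>) + I t \<omega>"
    using H2_paths[OF k] conjunct2[OF y(1)[unfolded ode_process_def]]
  proof eventually_elim
    case (elim \<omega>)
    show ?case
    proof
      fix t assume t: "t \<in> {0..T}"
      have "X t \<omega> - I t \<omega> = c + (LINT s:{0..t}|lborel. a s * (X s \<omega> - I s \<omega>) + (a s * I s \<omega> + h s \<omega>))"
        using elim by (intro linear_ode_solution(2)[OF a _ _ t]) (auto simp: X_def algebra_simps)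
      then show "X t \<omega> = c + (LINT s:{0..t}|lborel. a s * X s \<omega> + h s \<omega>) + I t \<omega>"
        by (simp add: algebra_simps)
    qed
  qed
  moreover have "AE \<omega> in M. set_integrable lborel {0..T} (\<lambda>t. h t \<omega>)"
    using H2_paths[OF h] by eventually_elim simp
  ultimately show ?thesis using L by (auto simp: lin_process_def L2cont_def)
qed

lemma lin_process_diff:
  assumes a: "continuous_on {0..T} a" and X: "lin_process a c h I X" and X': "lin_process a c h' I X'"
  shows "ode_process a (\<lambda>t \<omega>. h t \<omega> - h' t \<omega>) (\<lambda>t \<omega>. X t \<omega> - X' t \<omega>)"
  unfolding ode_process_def
proof (intro conjI ballI)
  show "continuous_on {0..T} (\<lambda>t. X t \<omega> - X' t \<omega>)" if "\<omega> \<in> space M" for \<omega>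
    using X X' that by (intro continuous_on_diff) (auto simp: lin_process_def)
  note * = X[unfolded lin_process_def] X'[unfolded lin_process_def]
  show "AE \<omega> in M. \<forall>t\<in>{0..T}. X t \<omega> - X' t \<omega> =
      int_factor a t * (LINT s:{0..t}|lborel. inverse (int_factor a s) * (h s \<omega> - h' s \<omega>))"
    using AE_space conjunct1[OF conjunct2[OF *(1)]] conjunct2[OF conjunct2[OF *(1)]]
      conjunct1[OF conjunct2[OF *(2)]] conjunct2[OF conjunct2[OF *(2)]]
  proof eventually_elim
    case (elim \<omega>)
    show ?case
    proof
      fix t assume t: "t \<in> {0..T}"
      show "X t \<omega> - X' t \<omega> = int_factor a t * (LINT s:{0..t}|lborel. inverse (int_factor a s) * (h s \<omega> - h' s \<omega>))"
        using linear_ode_diff[OF a, of "\<lambda>t. X t \<omega>" "\<lambda>t. h t \<omega>" c "\<lambda>t. I t \<omega>" "\<lambda>t. X' t \<omega>" "\<lambda>t. h' t \<omega>" c t]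
          elim t * by auto
    qed
  qed
qed

lemma lin_process_unique:
  assumes a: "continuous_on {0..T} a" and X: "lin_process a c h I X" and X': "lin_process a c h I X'"
  shows "AE \<omega> in M. \<forall>t\<in>{0..T}. X t \<omega> = X' t \<omega>"
  using conjunct2[OF lin_process_diff[OF a X X', unfolded ode_process_def]]
  by eventually_elim simp

section \<open>Integration by parts in expectation\<close>

lemma integrable_fst_P: "integrable M f \<Longrightarrow> integrable P (\<lambda>z. f (fst z) :: real)"
proof -
  assume f: "integrable M f"
  interpret pair_sigma_finite M "lborel_on T" by (rule pair_P)
  show ?thesis
  proof (rule Fubini_integrable)
    show "(\<lambda>z. f (fst z)) \<in> borel_measurable P"
      using f by (auto intro: measurable_compose[OF measurable_fst])
    show "integrable M (\<lambda>x. \<integral>y. norm (f (fst (x, y))) \<partial>lborel_on T)"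
      using f by simp
    show "AE x in M. integrable (lborel_on T) (\<lambda>y. f (fst (x, y)))"
      unfolding fst_conv by (intro AE_I2 finite_measure.integrable_const[OF finite_measure_lborel_on])
  qed
qed

text \<open>Fubini moves the expectation under the time integral, and at each time s the variable
  z_s itself serves as test variable in the martingale property, replacing J_T by J_s.\<close>

lemma martingale_duality:
  assumes z: "z \<in> H2" and J: "L2cont J"
    and mart: "\<And>s Z. s \<in> {0..T} \<Longrightarrow> Z \<in> borel_measurable (FW s) \<Longrightarrow> integrable M (\<lambda>\<omega>. (Z \<omega>)\<^sup>2) \<Longrightarrow>
      expectation (\<lambda>\<omega>. Z \<omega> * J T \<omega>) = expectation (\<lambda>\<omega>. Z \<omega> * J s \<omega>)"
  shows "has_bochner_integral M (\<lambda>\<omega>. (LINT s:{0..T}|lborel. z s \<omega>) * J T \<omega>)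
    (\<integral>w. z (snd w) (fst w) * J (snd w) (fst w) \<partial>P)"
proof -
  interpret pair_sigma_finite M "lborel_on T" by (rule pair_P)
  have T: "T \<in> {0..T}" using T_pos by simp
  have m: "(\<lambda>w. J T (fst w)) \<in> borel_measurable P"
    using L2contD(2)[OF J T] by (rule measurable_compose[OF measurable_fst])
  have i: "integrable P (\<lambda>w. z (snd w) (fst w) * J T (fst w))"
    using integrable_fst_P[OF L2contD(3)[OF J T]] by (intro integrable_mult_square H2D(2,3)[OF z] m)
  have i2: "integrable P (\<lambda>w. z (snd w) (fst w) * J (snd w) (fst w))"
    by (rule H2_mult_integrable[OF z L2cont_H2[OF J]])
  have "integrable M (\<lambda>\<omega>. \<integral>s. z s \<omega> * J T \<omega> \<partial>lborel_on T)"
    using integrable_fst[of "\<lambda>\<omega> s. z s \<omega> * J T \<omega>"] i by (simp add: split_beta')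
  then have int: "integrable M (\<lambda>\<omega>. (LINT s:{0..T}|lborel. z s \<omega>) * J T \<omega>)"
    by (simp add: LINT_lborel_on)
  have "expectation (\<lambda>\<omega>. (LINT s:{0..T}|lborel. z s \<omega>) * J T \<omega>) = (\<integral>\<omega>. (\<integral>s. z s \<omega> * J T \<omega> \<partial>lborel_on T) \<partial>M)"
    by (simp add: LINT_lborel_on)
  also have "\<dots> = (\<integral>s. (\<integral>\<omega>. z s \<omega> * J T \<omega> \<partial>M) \<partial>lborel_on T)"
    using Fubini_integral[of "\<lambda>\<omega> s. z s \<omega> * J T \<omega>"] i by (simp add: split_beta')
  also have "\<dots> = (\<integral>s. (\<integral>\<omega>. z s \<omega> * J s \<omega> \<partial>M) \<partial>lborel_on T)"
  proof (rule integral_cong_AE)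
    have swap: "(\<lambda>s. \<integral>\<omega>. f \<omega> s \<partial>M) \<in> borel_measurable (lborel_on T)"
      if "integrable P (\<lambda>w. f (fst w) (snd w))" for f :: "'w \<Rightarrow> real \<Rightarrow> real"
      using integrable_snd[of f] that by (auto simp: split_beta' dest: borel_measurable_integrable)
    show "(\<lambda>s. \<integral>\<omega>. z s \<omega> * J T \<omega> \<partial>M) \<in> borel_measurable (lborel_on T)"
      by (rule swap) (rule i)
    show "(\<lambda>s. \<integral>\<omega>. z s \<omega> * J s \<omega> \<partial>M) \<in> borel_measurable (lborel_on T)"
      by (rule swap) (rule i2)
    \<comment> \<open>Fubini yields square integrability of z_s only for almost every s, so the two
      inner integrals are compared almost everywhere in time.\<close>
    have "AE s in lborel_on T. integrable M (\<lambda>\<omega>. (z s \<omega>)\<^sup>2)"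
      using AE_integrable_snd[of "\<lambda>\<omega> s. (z s \<omega>)\<^sup>2"] H2D(3)[OF z] by (simp add: split_beta')
    then show "AE s in lborel_on T. (\<integral>\<omega>. z s \<omega> * J T \<omega> \<partial>M) = (\<integral>\<omega>. z s \<omega> * J s \<omega> \<partial>M)"
      using AE_space
    proof eventually_elim
      case (elim s)
      then show ?case by (intro mart H2D(4)[OF z]) auto
    qed
  qed
  also have "\<dots> = (\<integral>w. z (snd w) (fst w) * J (snd w) (fst w) \<partial>P)"
    using integral_snd[of "\<lambda>\<omega> s. z s \<omega> * J s \<omega>"] i2 by (simp add: split_beta')
  finally show ?thesis using int by (simp add: has_bochner_integral_iff)
qed

lemma has_bochner_integral_LINT:
  fixes f :: "real \<Rightarrow> 'w \<Rightarrow> real"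
  assumes i: "integrable P (\<lambda>w. f (snd w) (fst w))"
  shows "has_bochner_integral M (\<lambda>\<omega>. LINT s:{0..T}|lborel. f s \<omega>) (\<integral>w. f (snd w) (fst w) \<partial>P)"
proof -
  interpret pair_sigma_finite M "lborel_on T" by (rule pair_P)
  show ?thesis
    using integrable_fst[of "\<lambda>\<omega> s. f s \<omega>"] integral_fst[of "\<lambda>\<omega> s. f s \<omega>"] i
    by (simp add: LINT_lborel_on has_bochner_integral_iff split_beta')
qed

text \<open>Takes the place of the stochastic product rule. With z = K y, the product z (F - J)
  consists of absolutely continuous factors and obeys the pathwise rule, while z_T J_T is covered by
  \<open>martingale_duality\<close>. The two contributions z' (F - J) and z' J recombine to z' F,
  and no initial term appears because y starts at 0.\<close>

lemma product_expectation:
  assumes y: "L2cont y" "y' \<in> H2" "AE \<omega> in M. \<forall>t\<in>{0..T}. y t \<omega> = (LINT s:{0..t}|lborel. y' s \<omega>)"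
    and K: "continuous_on {0..T} K'" "\<And>t. t \<in> {0..T} \<Longrightarrow> (K has_vector_derivative K' t) (at t within {0..T})"
    and F: "L2cont F" "b \<in> H2" "AE \<omega> in M. \<forall>t\<in>{0..T}. F t \<omega> = f0 + (LINT s:{0..t}|lborel. b s \<omega>) + J t \<omega>"
    and J: "L2cont J"
    and mart: "\<And>s Z. s \<in> {0..T} \<Longrightarrow> Z \<in> borel_measurable (FW s) \<Longrightarrow> integrable M (\<lambda>\<omega>. (Z \<omega>)\<^sup>2) \<Longrightarrow>
      expectation (\<lambda>\<omega>. Z \<omega> * J T \<omega>) = expectation (\<lambda>\<omega>. Z \<omega> * J s \<omega>)"
  shows "has_bochner_integral M (\<lambda>\<omega>. y T \<omega> * (K T * F T \<omega>))
    (\<integral>w. (K (snd w) * y' (snd w) (fst w) + K' (snd w) * y (snd w) (fst w)) * F (snd w) (fst w) +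
      (K (snd w) * y (snd w) (fst w)) * b (snd w) (fst w) \<partial>P)"
proof -
  have T: "T \<in> {0..T}" using T_pos by simp
  have Kc: "continuous_on {0..T} K"
    using continuous_on_vector_derivative[of "{0..T}" K K'] K(2) by blast
  define z where "z t \<omega> = K t * y t \<omega>" for t \<omega>
  define z' where "z' t \<omega> = K t * y' t \<omega> + K' t * y t \<omega>" for t \<omega>
  have z'H: "z' \<in> H2" unfolding z'_def
    by (intro H2_add H2_mult_continuous y L2cont_H2 Kc K(1))
  have zL: "L2cont z" unfolding z_def by (intro L2cont_mult_continuous y Kc)
  have BL: "(\<lambda>t \<omega>. F t \<omega> - J t \<omega>) \<in> H2" by (intro H2_diff L2cont_H2 F J)
  have i1: "integrable P (\<lambda>w. z' (snd w) (fst w) * (F (snd w) (fst w) - J (snd w) (fst w)) + z (snd w) (fst w) * b (snd w) (fst w))"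
    by (intro Bochner_Integration.integrable_add H2_mult_integrable z'H BL[unfolded split_beta'] L2cont_H2 zL F(2) H2_diff J F(1))
  note A = has_bochner_integral_LINT[where f="\<lambda>t \<omega>. z' t \<omega> * (F t \<omega> - J t \<omega>) + z t \<omega> * b t \<omega>", OF i1]
  have B: "has_bochner_integral M (\<lambda>\<omega>. (LINT s:{0..T}|lborel. z' s \<omega>) * J T \<omega>)
      (\<integral>w. z' (snd w) (fst w) * J (snd w) (fst w) \<partial>P)"
    by (rule martingale_duality[OF z'H J]) (rule mart)
  have "has_bochner_integral M (\<lambda>\<omega>. y T \<omega> * (K T * F T \<omega>))
    ((\<integral>w. z' (snd w) (fst w) * (F (snd w) (fst w) - J (snd w) (fst w)) + z (snd w) (fst w) * b (snd w) (fst w) \<partial>P) +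
      (\<integral>w. z' (snd w) (fst w) * J (snd w) (fst w) \<partial>P))"
  proof (rule has_bochner_integral_cong_AE[THEN iffD1, OF _ _ _ has_bochner_integral_add[OF A B]])
    show "AE \<omega> in M. (LINT s:{0..T}|lborel. z' s \<omega> * (F s \<omega> - J s \<omega>) + z s \<omega> * b s \<omega>) +
        (LINT s:{0..T}|lborel. z' s \<omega>) * J T \<omega> = y T \<omega> * (K T * F T \<omega>)"
      using y(3) F(3) H2_paths[OF y(2)] H2_paths[OF F(2)] H2_paths[OF z'H] AE_space
    proof eventually_elim
      case (elim \<omega>)
      have z: "z t \<omega> = 0 + (LINT s:{0..t}|lborel. z' s \<omega>)" if t: "t \<in> {0..T}" for t
      proof -
        have K0: "K s = K 0 + (LINT r:{0..s}|lborel. K' r)" if "s \<in> {0..T}" for s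
        proof (rule LINT_FTC(1))
          show "continuous_on {0..s} K'" using that by (intro continuous_on_subset[OF K(1)]) auto
          show "(K has_vector_derivative K' r) (at r within {0..s})" if "r \<in> {0..s}" for r
            using that \<open>s \<in> {0..T}\<close> by (intro has_vector_derivative_within_subset[OF K(2)]) auto
        qed (use that in auto)
        have iK: "set_integrable lborel {0..t} K'"
          using t by (intro set_integrable_subset[OF continuous_set_integrable[OF K(1)]]) auto
        have iy: "set_integrable lborel {0..t} (\<lambda>s. y' s \<omega>)"
          using t by (intro set_integrable_subset[OF conjunct2[OF elim(3)]]) auto
        have "z t \<omega> = (0 + (LINT s:{0..t}|lborel. y' s \<omega>)) * (K 0 + (LINT s:{0..t}|lborel. K' s))"
          using elim t K0[OF t] by (simp add: z_def mult.commute)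
        also have "\<dots> = 0 * K 0 + (LINT s:{0..t}|lborel. y' s \<omega> * (K 0 + (LINT r:{0..s}|lborel. K' r)) +
            (0 + (LINT r:{0..s}|lborel. y' r \<omega>)) * K' s)"
          by (rule LINT_mult_by_parts[OF iy iK])
        also have "\<dots> = 0 + (LINT s:{0..t}|lborel. z' s \<omega>)"
          unfolding mult_zero_left
        proof (intro arg_cong[where f="(+) 0"] set_lebesgue_integral_cong allI impI)
          fix s assume "s \<in> {0..t}"
          then have s: "s \<in> {0..T}" using t by auto
          show "y' s \<omega> * (K 0 + (LINT r:{0..s}|lborel. K' r)) + (0 + (LINT r:{0..s}|lborel. y' r \<omega>)) * K' s = z' s \<omega>"
            using K0[OF s] elim(1) s by (simp add: z'_def mult.commute)
        qed simp
        finally show ?thesis .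
      qed
      have "z T \<omega> * (F T \<omega> - J T \<omega>) = (0 + (LINT s:{0..T}|lborel. z' s \<omega>)) * (f0 + (LINT s:{0..T}|lborel. b s \<omega>))"
        using z[OF T] elim(2) T by simp
      also have "\<dots> = 0 * f0 + (LINT s:{0..T}|lborel. z' s \<omega> * (f0 + (LINT r:{0..s}|lborel. b r \<omega>)) +
            (0 + (LINT r:{0..s}|lborel. z' r \<omega>)) * b s \<omega>)"
        using elim by (intro LINT_mult_by_parts) auto
      also have "\<dots> = (LINT s:{0..T}|lborel. z' s \<omega> * (F s \<omega> - J s \<omega>) + z s \<omega> * b s \<omega>)"
        unfolding mult_zero_left add_0_left
      proof (intro set_lebesgue_integral_cong allI impI)
        fix s assume s: "s \<in> {0..T}"
        show "z' s \<omega> * (f0 + (LINT r:{0..s}|lborel. b r \<omega>)) + (LINT r:{0..s}|lborel. z' r \<omega>) * b s \<omega> =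
            z' s \<omega> * (F s \<omega> - J s \<omega>) + z s \<omega> * b s \<omega>"
          using z[OF s] elim(2) s by simp
      qed simp
      finally have "(LINT s:{0..T}|lborel. z' s \<omega> * (F s \<omega> - J s \<omega>) + z s \<omega> * b s \<omega>) = z T \<omega> * (F T \<omega> - J T \<omega>)" ..
      moreover have "(LINT s:{0..T}|lborel. z' s \<omega>) = z T \<omega>" using z[OF T] by simp
      ultimately show ?case by (simp only: z_def) (simp add: algebra_simps)
    qed
    show "(\<lambda>\<omega>. y T \<omega> * (K T * F T \<omega>)) \<in> borel_measurable M"
      using L2contD(2)[OF y(1) T] L2contD(2)[OF F(1) T] by measurable
  qed (auto intro!: borel_measurable_integrable Bochner_Integration.integrable_add integrable.intros[OF A] integrable.intros[OF B])
  moreover have "(\<integral>w. z' (snd w) (fst w) * (F (snd w) (fst w) - J (snd w) (fst w)) + z (snd w) (fst w) * b (snd w) (fst w) \<partial>P) +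
      (\<integral>w. z' (snd w) (fst w) * J (snd w) (fst w) \<partial>P) =
      (\<integral>w. z' (snd w) (fst w) * F (snd w) (fst w) + z (snd w) (fst w) * b (snd w) (fst w) \<partial>P)"
    by (subst Bochner_Integration.integral_add[symmetric, OF i1 H2_mult_integrable[OF z'H L2cont_H2[OF J]]])
      (simp add: algebra_simps)
  ultimately show ?thesis by (simp add: z_def z'_def)
qed

end

section \<open>Block matrices of the lifted system\<close>

lemma UNIV_sum_split:
  fixes f :: "'a::finite + 'b::finite \<Rightarrow> 'c::comm_monoid_add"
  shows "(\<Sum>k\<in>UNIV. f k) = (\<Sum>k\<in>UNIV. f (Inl k)) + (\<Sum>k\<in>UNIV. f (Inr k))"
  unfolding UNIV_sum[symmetric] 
  by (subst UNIV_Plus_UNIV[symmetric], subst sum.Plus) auto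

lemma vcat_nth [simp]: "vcat P R $ Inl k = P $ k" "vcat P R $ Inr l = R $ l"
  by (simp_all add: vcat_def)

lemma hcat_nth [simp]: "hcat P R $ i $ Inl k = P $ i $ k" "hcat P R $ i $ Inr l = R $ i $ l"
  by (simp_all add: hcat_def)

lemma vec_eq_split: "v = w \<longleftrightarrow> (\<forall>i. v $ Inl i = w $ Inl i) \<and> (\<forall>i. v $ Inr i = w $ Inr i)"
  unfolding vec_eq_iff by (metis sum.exhaust)

lemma hcat_mult_vec: "hcat P R *v v = P *v (\<chi> k. v $ Inl k) + R *v (\<chi> k. v $ Inr k)"
  for P :: "real ^ 'a ^ 'm" and R :: "real ^ 'b ^ 'm"
  by (simp add: vec_eq_iff matrix_vector_mult_def UNIV_sum_split)

lemma diagm_mult_vec: "(diagm f *v v) $ i = f i * v $ i"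
  by (simp add: matrix_vector_mult_def diagm_def if_distrib[of "\<lambda>x. x * _"] cong: if_cong)

lemma matA_mult_vec [simp]:
  "(matA a t *v v) $ Inl i = a i t * v $ Inl i" "(matA a t *v v) $ Inr i = a i t * v $ Inr i"
proof -
  have "(matA a t *v v) $ Inl i = (diagm (\<lambda>i. a i t) *v (\<chi> k. v $ Inl k)) $ i"
    "(matA a t *v v) $ Inr i = (diagm (\<lambda>i. a i t) *v (\<chi> k. v $ Inr k)) $ i"
    by (simp_all add: matA_def block_diag_def matrix_vector_mult_def UNIV_sum_split)
  then show "(matA a t *v v) $ Inl i = a i t * v $ Inl i" "(matA a t *v v) $ Inr i = a i t * v $ Inr i"
    by (simp_all add: diagm_mult_vec)
qed

lemma matAA_mult_vec: "matAA a t *v v = vcat (matA a t *v (\<chi> k. v $ Inl k)) (matA a t *v (\<chi> k. v $ Inr k))"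
  by (simp add: matAA_def block_diag_def vec_eq_split matrix_vector_mult_def UNIV_sum_split)

lemma transpose_matA: "transpose (matA a t) = matA a t"
  unfolding transpose_def matA_def block_diag_def vec_eq_split by (auto simp: vec_eq_split diagm_def)

lemma matI_mult_vec [simp]: "(matI r *v v) $ Inl i = r * v $ i" "(matI r *v v) $ Inr i = v $ i"
proof -
  have "(matI r *v v) $ Inl i = ((r *\<^sub>R mat 1) *v v) $ i" "(matI r *v v) $ Inr i = (mat 1 *v v) $ i"
    by (simp_all add: matI_def matrix_vector_mult_def)
  then show "(matI r *v v) $ Inl i = r * v $ i" "(matI r *v v) $ Inr i = v $ i"
    by (simp_all add: scaleR_matrix_vector_assoc[symmetric])
qed

lemma Itilde_mult_vec: "(Itilde *v v) $ i =
    1/2 * v $ Inl (Inl i) + v $ Inl (Inr i) + 1/3 * v $ Inr (Inl i) + 1/2 * v $ Inr (Inr i)"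
  by (simp add: Itilde_def hcat_mult_vec scaleR_matrix_vector_assoc[symmetric])

lemma Itilde_vector_mult [simp]:
  "(v v* Itilde) $ Inl (Inl i) = 1/2 * v $ i" "(v v* Itilde) $ Inl (Inr i) = v $ i"
  "(v v* Itilde) $ Inr (Inl i) = 1/3 * v $ i" "(v v* Itilde) $ Inr (Inr i) = 1/2 * v $ i"
proof -
  have "v $ j * (c *\<^sub>R mat 1) $ j $ i = (if j = i then c * v $ i else 0)" for c j
    by (simp add: mat_def)
  then have e: "(\<Sum>j\<in>UNIV. v $ j * (c *\<^sub>R mat 1) $ j $ i) = c * v $ i" for c by simp
  show "(v v* Itilde) $ Inl (Inl i) = 1/2 * v $ i" "(v v* Itilde) $ Inl (Inr i) = v $ i"
    "(v v* Itilde) $ Inr (Inl i) = 1/3 * v $ i" "(v v* Itilde) $ Inr (Inr i) = 1/2 * v $ i"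
    unfolding vector_matrix_mult_def Itilde_def vec_lambda_beta hcat_nth
    using e[of "1/2"] e[of 1] e[of "1/3"] by simp_all
qed

lemma matQ_mult_vec [simp]:
  "(matQ q *v v) $ Inl i = (transpose (matQtilde q) *v (\<chi> k. v $ Inr k)) $ i"
  "(matQ q *v v) $ Inr i = (matQtilde q *v (\<chi> k. v $ Inl k)) $ i"
  by (simp_all add: matQ_def block_antidiag_def matrix_vector_mult_def UNIV_sum_split)

lemma matQbar_mult_vec [simp]:
  "(matQbar \<gamma> *v v) $ Inl i = \<gamma> i * v $ Inr i" "(matQbar \<gamma> *v v) $ Inr i = \<gamma> i * v $ Inl i"
proof -
  have "(matQbar \<gamma> *v v) $ Inl i = (diagm \<gamma> *v (\<chi> k. v $ Inr k)) $ i"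
    "(matQbar \<gamma> *v v) $ Inr i = (diagm \<gamma> *v (\<chi> k. v $ Inl k)) $ i"
    by (simp_all add: matQbar_def block_antidiag_def matrix_vector_mult_def UNIV_sum_split)
  then show "(matQbar \<gamma> *v v) $ Inl i = \<gamma> i * v $ Inr i" "(matQbar \<gamma> *v v) $ Inr i = \<gamma> i * v $ Inl i"
    by (simp_all add: diagm_mult_vec)
qed

lemma matK_mult_vec: "(matK M0 M1 t *v v) $ i =
    (M0 t *v (\<chi> k. v $ Inl k)) $ Inr i + (M0 t *v (\<chi> k. v $ Inr k)) $ Inl i + (Itilde *v (M1 t *v v)) $ i"
  by (simp add: matK_def matrix_vector_mult_add_rdistrib hcat_mult_vec matrix_vector_mul_assoc[symmetric])

lemma Itilde_matAA: "(Itilde *v (matAA a t *v v)) $ i = a i t * (Itilde *v v) $ i"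
  by (simp add: Itilde_mult_vec matAA_mult_vec algebra_simps)

lemma inner_matrix_sym:
  fixes S :: "real ^ 'k ^ 'k"
  assumes "transpose S = S" shows "(S *v v) \<bullet> w = v \<bullet> (S *v w)"
  using dot_lmul_matrix[of w S v] assms by (simp add: inner_commute vector_transpose_matrix[symmetric])

text \<open>Tested against z, the \<open>M0\<close> part is a combination of values of the bilinear
  form of \<open>M0\<close> at vectors supported in the upper or the lower block. The two mixed
  values both carry the weight 1/2, so exchanging w and z merely permutes them; the pure values and
  the \<open>M1\<close> part are symmetric since \<open>M0\<close> and \<open>M1\<close>
  are.\<close>

lemma matK_Itilde_symmetric:
  fixes M0 :: "real \<Rightarrow> real ^ ('n::finite + 'n) ^ ('n + 'n)"
  assumes M0: "transpose (M0 t) = M0 t" and M1: "transpose (M1 t) = M1 t"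
  shows "matK M0 M1 t *v (transpose Itilde *v w) = Itilde *v (transpose (matK M0 M1 t) *v w)"
proof -
  let ?K = "matK M0 M1 t"
  have inner_sum: "v \<bullet> w = (\<chi> k. v $ Inl k) \<bullet> (\<chi> k. w $ Inl k) + (\<chi> k. v $ Inr k) \<bullet> (\<chi> k. w $ Inr k)"
    for v w :: "real ^ ('a::finite + 'b::finite)"
    by (simp add: inner_vec_def UNIV_sum_split)
  have S: "(?K *v (transpose Itilde *v w)) \<bullet> z = w \<bullet> (?K *v (transpose Itilde *v z))" for w z :: "real ^ 'n"
  proof -
    let ?a = "\<lambda>w. vcat ((1/2) *\<^sub>R w) w :: real ^ ('n + 'n)" and ?b = "\<lambda>w. vcat ((1/3) *\<^sub>R w) ((1/2) *\<^sub>R w) :: real ^ ('n + 'n)"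
    have ab: "(\<chi> k. (w v* Itilde) $ Inl k) = ?a w" "(\<chi> k. (w v* Itilde) $ Inr k) = ?b w" for w :: "real ^ 'n"
      by (simp_all add: vec_eq_split)
    have K: "(?K *v (transpose Itilde *v w)) \<bullet> z = (M0 t *v ?a w) \<bullet> vcat 0 z + (M0 t *v ?b w) \<bullet> vcat z 0 +
        (M1 t *v (transpose Itilde *v w)) \<bullet> (transpose Itilde *v z)" for w z :: "real ^ 'n"
    proof -
      have "(Itilde *v (M1 t *v (transpose Itilde *v w))) \<bullet> z = (M1 t *v (transpose Itilde *v w)) \<bullet> (transpose Itilde *v z)"
        using dot_lmul_matrix[of z Itilde "M1 t *v (transpose Itilde *v w)"] by (simp add: inner_commute)
      then show ?thesis
        by (simp add: inner_vec_def[of "?K *v _"] matK_mult_vec ab sum.distrib distrib_right inner_sum[of "M0 t *v _"])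
          (simp add: inner_vec_def)
    qed
    have lin: "?a w = (1/2) *\<^sub>R vcat w 0 + vcat 0 w" "?b w = (1/3) *\<^sub>R vcat w 0 + (1/2) *\<^sub>R vcat 0 w" for w :: "real ^ 'n"
      by (simp_all add: vec_eq_split)
    show ?thesis
      unfolding inner_commute[of w] K lin
      using inner_matrix_sym[OF M0, of "vcat w 0" "vcat z 0"] inner_matrix_sym[OF M0, of "vcat 0 w" "vcat z 0"]
        inner_matrix_sym[OF M0, of "vcat w 0" "vcat 0 z"] inner_matrix_sym[OF M0, of "vcat 0 w" "vcat 0 z"]
        inner_matrix_sym[OF M1, of "transpose Itilde *v w" "transpose Itilde *v z"]
      by (simp add: matrix_vector_right_distrib matrix_vector_mult_scaleR inner_add_right inner_commute)
  qed
  have "(Itilde *v (transpose ?K *v w)) \<bullet> z = w \<bullet> (?K *v (transpose Itilde *v z))" for z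
    using dot_lmul_matrix[of z Itilde "transpose ?K *v w"] dot_lmul_matrix[of w ?K "transpose Itilde *v z"]
    by (simp add: inner_commute)
  then show ?thesis
    using S by (metis vector_eq_rdot)
qed

text \<open>The equations of \<open>M1\<close> and \<open>M2\<close> together contribute Itilde K^T
  theta, and the feedback in the drift b contributes - K Itilde^T theta; symmetry makes them cancel.
  What survives is transport by A and the source Q of the \<open>M0\<close> equation, whose
  off-diagonal blocks meet the first and the last quarter of F.\<close>

lemma feedback_drift:
  fixes M0 M0' :: "real \<Rightarrow> real ^ ('n::finite + 'n) ^ ('n + 'n)"
  assumes M0: "transpose (M0 t) = M0 t" and M1: "transpose (M1 t) = M1 t"
    and e0: "M0' t + transpose (matA a t) ** M0 t + M0 t ** matA a t + matQ q = 0"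
    and e1: "M1' t + matAA a t ** M1 t + M1 t ** matAA a t - transpose (matK M0 M1 t) ** matK M0 M1 t = 0"
    and e2: "M2' t + matAA a t *v M2 t - transpose (matK M0 M1 t) *v (Itilde *v M2 t) = 0"
    and \<theta>: "\<theta> = matK M0 M1 t *v F + Itilde *v M2 t"
    and b: "b = (matAA a t - transpose Itilde ** matK M0 M1 t) *v F - transpose Itilde *v (Itilde *v M2 t)"
  shows "(matK M0' M1' t *v F + matK M0 M1 t *v b + Itilde *v M2' t) $ i = - (a i t * \<theta> $ i)
    - (matQtilde q *v (\<chi> k. F $ Inl (Inl k)) + transpose (matQtilde q) *v (\<chi> k. F $ Inr (Inr k))) $ i"
proof -
  let ?K = "matK M0 M1 t" and ?A = "matA a t" and ?AA = "matAA a t"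
  let ?Fa = "\<chi> k. F $ Inl k" and ?Fb = "\<chi> k. F $ Inr k"
  have M0': "M0' t *v v = - (?A *v (M0 t *v v)) - M0 t *v (?A *v v) - matQ q *v v" for v
  proof -
    have "M0' t *v v + ?A *v (M0 t *v v) + M0 t *v (?A *v v) + matQ q *v v = 0"
      using arg_cong[OF e0, of "\<lambda>m. m *v v"]
      by (simp add: matrix_vector_mult_add_rdistrib matrix_vector_mul_assoc transpose_matA)
    then show ?thesis by (simp add: algebra_simps eq_neg_iff_add_eq_0)
  qed
  have M1': "M1' t *v v = - (?AA *v (M1 t *v v)) - M1 t *v (?AA *v v) + transpose ?K *v (?K *v v)" for v
  proof -
    have "M1' t *v v + ?AA *v (M1 t *v v) + M1 t *v (?AA *v v) - transpose ?K *v (?K *v v) = 0"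
      using arg_cong[OF e1, of "\<lambda>m. m *v v"]
      by (simp add: matrix_vector_mult_add_rdistrib matrix_vector_mult_diff_rdistrib matrix_vector_mul_assoc)
    then show ?thesis by (simp add: algebra_simps eq_neg_iff_add_eq_0)
  qed
  have M2': "M2' t = - (?AA *v M2 t) + transpose ?K *v (Itilde *v M2 t)"
    using e2 by (simp add: algebra_simps eq_neg_iff_add_eq_0)
  have b': "b = ?AA *v F - transpose Itilde *v \<theta>"
    unfolding b \<theta> by (simp add: matrix_vector_mult_diff_rdistrib matrix_vector_mul_assoc[symmetric] matrix_vector_right_distrib)
  have AF: "(\<chi> k. (?AA *v F) $ Inl k) = ?A *v ?Fa" "(\<chi> k. (?AA *v F) $ Inr k) = ?A *v ?Fb"
    by (simp_all add: matAA_mult_vec vec_eq_iff)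
  have 1: "(matK M0' M1' t *v F) $ i = - (a i t * (?K *v F) $ i) - (?K *v (?AA *v F)) $ i
      - (matQtilde q *v (\<chi> k. F $ Inl (Inl k)) + transpose (matQtilde q) *v (\<chi> k. F $ Inr (Inr k))) $ i
      + (Itilde *v (transpose ?K *v (?K *v F))) $ i"
    unfolding matK_mult_vec[of _ _ _ F] matK_mult_vec[of _ _ _ "?AA *v F"] AF M0' M1'
    by (simp add: matrix_vector_right_distrib matrix_vector_mult_diff_distrib Itilde_matAA algebra_simps)
  have 2: "(?K *v b) $ i = (?K *v (?AA *v F)) $ i - (Itilde *v (transpose ?K *v \<theta>)) $ i"
    unfolding b' using matK_Itilde_symmetric[of M0 t M1 \<theta>, OF M0 M1] by (simp add: matrix_vector_mult_diff_distrib)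
  have 3: "(Itilde *v M2' t) $ i = - (a i t * (Itilde *v M2 t) $ i) + (Itilde *v (transpose ?K *v (Itilde *v M2 t))) $ i"
    unfolding M2' by (simp add: matrix_vector_right_distrib matrix_vector_mult_diff_distrib Itilde_matAA)
  have "(Itilde *v (transpose ?K *v \<theta>)) $ i = (Itilde *v (transpose ?K *v (?K *v F))) $ i + (Itilde *v (transpose ?K *v (Itilde *v M2 t))) $ i"
    unfolding \<theta> by (simp add: matrix_vector_right_distrib)
  then show ?thesis
    using 1 2 3 by (simp add: \<theta> algebra_simps)
qed

text \<open>For the filtered process the two entries of F add up to the state: (X - Y/2) + Y/2 =
  X.\<close>

lemma feedback_terminal:
  assumes "M0 T = matQbar \<gamma>" "M1 T = 0" "M2 T = vcat (vecp \<gamma> d) 0"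
  shows "(matK M0 M1 T *v F + Itilde *v M2 T) $ i = \<gamma> i * (F $ Inl (Inl i) + F $ Inr (Inr i) - d i)"
  by (simp add: matK_mult_vec assms Itilde_mult_vec vecp_def algebra_simps)

text \<open>Row i is half the derivative of the running cost of player i in its own state. In the
  second identity the diagonals cancel, so only the asymmetry of q remains; it is the source of the
  equilibrium gap.\<close>

lemma matQtilde_mult_vec:
  fixes v :: "real ^ 'n::finite"
  shows "(matQtilde q *v v) $ i = (\<Sum>j\<in>UNIV. q i j * (v $ i - v $ j)) / real CARD('n)"
    "(transpose (matQtilde q) *v v - matQtilde q *v v) $ i = (\<Sum>j\<in>UNIV - {i}. (q i j - q j i) * v $ j) / real CARD('n)"
proof -
  have Q: "(matQtilde q *v v) $ i = (\<Sum>k\<in>UNIV - {i}. q i k) / real CARD('n) * v $ i - (\<Sum>j\<in>UNIV - {i}. q i j * v $ j) / real CARD('n)"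
    by (simp add: matrix_vector_mult_def matQtilde_def sum.remove[of UNIV i] sum_negf sum_divide_distrib)
  also have "\<dots> = (\<Sum>j\<in>UNIV. q i j * (v $ i - v $ j)) / real CARD('n)"
    by (simp add: sum.remove[of UNIV i] right_diff_distrib sum_subtractf sum_distrib_right diff_divide_distrib)
  finally show "(matQtilde q *v v) $ i = (\<Sum>j\<in>UNIV. q i j * (v $ i - v $ j)) / real CARD('n)" .
  have "(transpose (matQtilde q) *v v) $ i = (\<Sum>k\<in>UNIV - {i}. q i k) / real CARD('n) * v $ i - (\<Sum>j\<in>UNIV - {i}. q j i * v $ j) / real CARD('n)"
    by (simp add: matrix_vector_mult_def transpose_def matQtilde_def sum.remove[of UNIV i] sum_negf sum_divide_distrib)
  then show "(transpose (matQtilde q) *v v - matQtilde q *v v) $ i = (\<Sum>j\<in>UNIV - {i}. (q i j - q j i) * v $ j) / real CARD('n)"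
    using Q by (simp add: left_diff_distrib sum_subtractf diff_divide_distrib)
qed

section \<open>The state equation\<close>

lemma set_LINT_vec_nth:
  fixes f :: "real \<Rightarrow> real ^ 'm"
  assumes "set_integrable lborel A f"
  shows "set_integrable lborel A (\<lambda>s. f s $ i)" "(LINT s:A|lborel. f s) $ i = (LINT s:A|lborel. f s $ i)"
  using integrable_bounded_linear[OF bounded_linear_vec_nth[of i] assms[unfolded set_integrable_def]]
    integral_bounded_linear[OF bounded_linear_vec_nth[of i] assms[unfolded set_integrable_def]]
  by (simp_all add: set_integrable_def set_lebesgue_integral_def)

lemma set_integrable_vecI:
  fixes f :: "real \<Rightarrow> real ^ 'm"
  assumes "\<And>i. set_integrable lborel A (\<lambda>s. f s $ i)"
  shows "set_integrable lborel A f"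
proof -
  have "integrable lborel (\<lambda>s. \<Sum>i\<in>UNIV. (indicator A s *\<^sub>R f s $ i) *\<^sub>R axis i (1 :: real))"
    using assms unfolding set_integrable_def by (intro Bochner_Integration.integrable_sum integrable_scaleR_left) auto
  moreover have "(\<Sum>i\<in>UNIV. (indicator A s *\<^sub>R f s $ i) *\<^sub>R axis i (1 :: real)) = indicator A s *\<^sub>R f s" for s
    by (simp add: vec_eq_iff axis_def if_distrib[of "\<lambda>x. _ * x"] cong: if_cong)
  ultimately show ?thesis by (simp add: set_integrable_def)
qed

lemma continuous_on_vecI:
  fixes f :: "'a::topological_space \<Rightarrow> 'b::topological_space ^ 'm"
  assumes "\<And>i. continuous_on S (\<lambda>t. f t $ i)"
  shows "continuous_on S f"
  using continuous_on_vec_lambda[of S "\<lambda>i t. f t $ i", OF assms] by simp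

context brownian
begin

lemma wiener_integral_L2cont:
  fixes H :: "real \<Rightarrow> real ^ 'n ^ 'm"
  assumes I: "wiener_integral H I" and H: "continuous_on {0..T} H"
  shows "L2cont (\<lambda>t \<omega>. I t \<omega> $ i)"
proof -
  obtain B where B: "\<And>t. t \<in> {0..T} \<Longrightarrow> (\<integral>\<^sup>+ \<omega>. ennreal ((norm (I t \<omega>))\<^sup>2) \<partial>M) \<le> ennreal B"
    using wiener_integral_L2[OF I H] by blast
  show ?thesis
  proof (rule L2contI)
    fix t assume t: "t \<in> {0..T}"
    show "(\<lambda>\<omega>. I t \<omega> $ i) \<in> borel_measurable (FW t)" by (rule wiener_integral_square_integrable[OF I H t])
    have "(I t \<omega> $ i)\<^sup>2 \<le> (norm (I t \<omega>))\<^sup>2" for \<omega>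
      using power_mono[OF Finite_Cartesian_Product.norm_nth_le[of "I t \<omega>" i] norm_ge_zero, of 2] by simp
    then have "(\<integral>\<^sup>+ \<omega>. ennreal ((I t \<omega> $ i)\<^sup>2) \<partial>M) \<le> (\<integral>\<^sup>+ \<omega>. ennreal ((norm (I t \<omega>))\<^sup>2) \<partial>M)"
      by (intro nn_integral_mono ennreal_leI)
    with B[OF t] show "(\<integral>\<^sup>+ \<omega>. ennreal ((I t \<omega> $ i)\<^sup>2) \<partial>M) \<le> ennreal B" by (rule order_trans[rotated])
  next
    fix \<omega> assume "\<omega> \<in> space M"
    then show "continuous_on {0..T} (\<lambda>t. I t \<omega> $ i)"
      using I by (intro continuous_on_component) (auto simp: wiener_integral_def)
  qed
qed

lemma sde_solution_wiener:
  fixes S :: "real \<Rightarrow> real ^ 'n ^ 'm"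
  assumes "brownian_wrt M T W Fil" and X: "sde_solution M T Fil W b S x0 X" and S: "continuous_on {0..T} S"
  obtains I where "wiener_integral S I"
    "AE \<omega> in M. \<forall>t\<in>{0..T}. set_integrable lborel {0..t} (\<lambda>s. b s \<omega> (X s \<omega>)) \<and>
      X t \<omega> = x0 + (LINT s:{0..t}|lborel. b s \<omega> (X s \<omega>)) + I t \<omega>"
proof -
  obtain I where I: "is_ito_integral M T Fil W (\<lambda>t \<omega>. S t) I"
    "AE \<omega> in M. \<forall>t\<in>{0..T}. set_integrable lborel {0..t} (\<lambda>s. b s \<omega> (X s \<omega>)) \<and>
      X t \<omega> = x0 + (LINT s:{0..t}|lborel. b s \<omega> (X s \<omega>)) + I t \<omega>"
    using X unfolding sde_solution_def by blast
  show ?thesis by (rule that[OF wiener_integralI[OF assms(1) I(1) S] I(2)])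
qed

text \<open>Replaces the solution's own integral by a prescribed version I of the noise, so that
  solutions obtained in different filtrations share one noise path and can be subtracted. The drift
  of component k must involve X through that component only.\<close>

lemma sde_solution_lin_process:
  fixes S :: "real \<Rightarrow> real ^ 'n ^ 'm"
  assumes wrt: "brownian_wrt M T W Fil" and X: "sde_solution M T Fil W b S x0 X" and S: "continuous_on {0..T} S"
    and I: "wiener_integral S I" and h: "AE \<omega> in M. set_integrable lborel {0..T} (\<lambda>t. h t \<omega>)"
    and b: "\<And>t \<omega>. b t \<omega> (X t \<omega>) $ k = a t * X t \<omega> $ k + h t \<omega>"
  shows "lin_process a (x0 $ k) h (\<lambda>t \<omega>. I t \<omega> $ k) (\<lambda>t \<omega>. X t \<omega> $ k)"
  unfolding lin_process_def
proof (intro conjI ballI h)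
  show "continuous_on {0..T} (\<lambda>t. X t \<omega> $ k)" if "\<omega> \<in> space M" for \<omega>
    using X that by (intro continuous_on_component) (auto simp: sde_solution_def)
  obtain I' where I': "wiener_integral S I'" 
    "AE \<omega> in M. \<forall>t\<in>{0..T}. set_integrable lborel {0..t} (\<lambda>s. b s \<omega> (X s \<omega>)) \<and>
      X t \<omega> = x0 + (LINT s:{0..t}|lborel. b s \<omega> (X s \<omega>)) + I' t \<omega>"
    using sde_solution_wiener[OF wrt X S] by blast
  show "AE \<omega> in M. \<forall>t\<in>{0..T}. X t \<omega> $ k = x0 $ k + (LINT s:{0..t}|lborel. a s * X s \<omega> $ k + h s \<omega>) + I t \<omega> $ k"
    using I'(2) wiener_integral_unique[OF I I'(1)]
  proof eventually_elim
    case (elim \<omega>)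
    show ?case
    proof
      fix t assume t: "t \<in> {0..T}"
      then have "X t \<omega> $ k = x0 $ k + (LINT s:{0..t}|lborel. b s \<omega> (X s \<omega>)) $ k + I t \<omega> $ k"
        using elim by (metis vector_add_component)
      then show "X t \<omega> $ k = x0 $ k + (LINT s:{0..t}|lborel. a s * X s \<omega> $ k + h s \<omega>) + I t \<omega> $ k"
        using set_LINT_vec_nth(2)[of "{0..t}" "\<lambda>s. b s \<omega> (X s \<omega>)" k] elim(1) t b by simp
    qed
  qed
qed

lemma sde_solutionI:
  fixes S :: "real \<Rightarrow> real ^ 'n ^ 'm"
  assumes S: "continuous_on {0..T} S" and I: "wiener_integral S I"
    and X: "\<And>k. L2cont (\<lambda>t \<omega>. X t \<omega> $ k)"
    and int: "\<And>k. AE \<omega> in M. set_integrable lborel {0..T} (\<lambda>s. b s \<omega> (X s \<omega>) $ k)"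
    and eq: "\<And>k. AE \<omega> in M. \<forall>t\<in>{0..T}. X t \<omega> $ k = x0 $ k + (LINT s:{0..t}|lborel. b s \<omega> (X s \<omega>) $ k) + I t \<omega> $ k"
  shows "sde_solution M T FW W b S x0 X"
  unfolding sde_solution_def
proof (intro conjI exI[of _ I] wiener_integral_ito I S)
  show "adapted T FW X"
    unfolding adapted_def using L2contD(1)[OF X] by (auto intro: borel_measurable_vecI)
  show "\<forall>\<omega>\<in>space M. continuous_on {0..T} (\<lambda>t. X t \<omega>)"
    using L2cont_path[OF X] by (auto intro: continuous_on_vecI)
  have "AE \<omega> in M. \<forall>k. set_integrable lborel {0..T} (\<lambda>s. b s \<omega> (X s \<omega>) $ k)"
    using int by (intro AE_all_countable[THEN iffD2]) auto
  moreover have "AE \<omega> in M. \<forall>k. \<forall>t\<in>{0..T}. X t \<omega> $ k = x0 $ k + (LINT s:{0..t}|lborel. b s \<omega> (X s \<omega>) $ k) + I t \<omega> $ k"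
    using eq by (intro AE_all_countable[THEN iffD2]) auto
  ultimately show "AE \<omega> in M. \<forall>t\<in>{0..T}. set_integrable lborel {0..t} (\<lambda>s. b s \<omega> (X s \<omega>)) \<and>
      X t \<omega> = x0 + (LINT s:{0..t}|lborel. b s \<omega> (X s \<omega>)) + I t \<omega>"
  proof eventually_elim
    case (elim \<omega>)
    show ?case
    proof
      fix t assume t: "t \<in> {0..T}"
      have i: "set_integrable lborel {0..t} (\<lambda>s. b s \<omega> (X s \<omega>))"
      proof (rule set_integrable_vecI)
        show "set_integrable lborel {0..t} (\<lambda>s. b s \<omega> (X s \<omega>) $ k)" for k
          using t by (intro set_integrable_subset[OF spec[OF elim(1), of k]]) auto
      qed
      then show "set_integrable lborel {0..t} (\<lambda>s. b s \<omega> (X s \<omega>)) \<and>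
          X t \<omega> = x0 + (LINT s:{0..t}|lborel. b s \<omega> (X s \<omega>)) + I t \<omega>"
        using elim(2) t by (simp add: vec_eq_iff set_LINT_vec_nth(2)[OF i])
    qed
  qed
qed

end

locale lq_setting = brownian M T W for M :: "'w measure" and T and W :: "real \<Rightarrow> 'w \<Rightarrow> real ^ 'n" +
  fixes a \<sigma> :: "'n \<Rightarrow> real \<Rightarrow> real" and x :: "real ^ 'n"
  assumes a_cont: "\<And>i. continuous_on {0..T} (a i)" and \<sigma>_cont: "\<And>i. continuous_on {0..T} (\<sigma> i)"
begin

lemma continuous_on_diagm: "continuous_on {0..T} (\<lambda>t. diagm (\<lambda>i. \<sigma> i t))"
  unfolding diagm_def
proof (intro continuous_on_vec_lambda)
  show "continuous_on {0..T} (\<lambda>t. if i = j then \<sigma> i t else 0)" for i j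
    using \<sigma>_cont[of i] by (cases "i = j") simp_all
qed

lemma continuous_on_matSigma: "continuous_on {0..T} (matSigma \<sigma>)"
proof -
  have "continuous_on {0..T} (\<lambda>t. matSigma \<sigma> t $ k)" for k
    using continuous_on_component[OF continuous_on_diagm] by (cases k) (simp_all add: matSigma_def)
  then show ?thesis by (rule continuous_on_vecI)
qed

text \<open>\<open>state\<close> is a choice by \<open>SOME\<close>, so a solution has to be built
  first, component by component from the given noise. Uniqueness then transfers the moment bounds of
  the built solution to the chosen one.\<close>

lemma state_lin_process:
  assumes I: "wiener_integral (\<lambda>t. diagm (\<lambda>i. \<sigma> i t)) I" and u: "\<And>i. (\<lambda>t \<omega>. u t \<omega> $ i) \<in> H2"
  shows "lin_process (a i) (x $ i) (\<lambda>t \<omega>. u t \<omega> $ i) (\<lambda>t \<omega>. I t \<omega> $ i) (\<lambda>t \<omega>. state M T W a \<sigma> x u t \<omega> $ i)"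
    and "L2cont (\<lambda>t \<omega>. state M T W a \<sigma> x u t \<omega> $ i)"
proof -
  have IL: "L2cont (\<lambda>t \<omega>. I t \<omega> $ i)" for i by (rule wiener_integral_L2cont[OF I continuous_on_diagm])
  have ex: "\<exists>X. lin_process (a i) (x $ i) (\<lambda>t \<omega>. u t \<omega> $ i) (\<lambda>t \<omega>. I t \<omega> $ i) X \<and> L2cont X" for i
    by (rule lin_process_exists[OF a_cont u IL])
  then obtain X where X: "\<And>i. lin_process (a i) (x $ i) (\<lambda>t \<omega>. u t \<omega> $ i) (\<lambda>t \<omega>. I t \<omega> $ i) (X i)" "\<And>i. L2cont (X i)"
    by metis
  let ?b = "\<lambda>t \<omega> (y :: real ^ 'n). \<chi> i. a i t * y $ i + u t \<omega> $ i"
  have h: "AE \<omega> in M. set_integrable lborel {0..T} (\<lambda>t. u t \<omega> $ i)" for i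
    using H2_paths[OF u[of i]] by eventually_elim simp
  have "is_state M T W a \<sigma> x u (\<lambda>t \<omega>. \<chi> i. X i t \<omega>)"
    unfolding is_state_def
  proof (rule sde_solutionI[OF continuous_on_diagm I])
    show "L2cont (\<lambda>t \<omega>. (\<chi> i. X i t \<omega>) $ k)" for k using X(2) by simp
    show "AE \<omega> in M. set_integrable lborel {0..T} (\<lambda>s. ?b s \<omega> (\<chi> i. X i s \<omega>) $ k)" for k
      using h[of k] AE_space
    proof eventually_elim
      case (elim \<omega>)
      have "set_integrable lborel {0..T} (\<lambda>s. a k s * X k s \<omega>)"
        by (intro set_integrable_mult_continuous continuous_set_integrable a_cont L2cont_path[OF X(2)] elim(2))
      from set_integral_add(1)[OF this elim(1)] show ?case by simp
    qed
    show "AE \<omega> in M. \<forall>t\<in>{0..T}. (\<chi> i. X i t \<omega>) $ k = x $ k + (LINT s:{0..t}|lborel. ?b s \<omega> (\<chi> i. X i s \<omega>) $ k) + I t \<omega> $ k" for k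
      using X(1)[of k] by (simp add: lin_process_def)
  qed
  then have "is_state M T W a \<sigma> x u (state M T W a \<sigma> x u)"
    unfolding state_def by (rule someI[of "is_state M T W a \<sigma> x u"])
  from sde_solution_lin_process[OF brownian_wrt_FW this[unfolded is_state_def] continuous_on_diagm I h]
  show 1: "lin_process (a i) (x $ i) (\<lambda>t \<omega>. u t \<omega> $ i) (\<lambda>t \<omega>. I t \<omega> $ i) (\<lambda>t \<omega>. state M T W a \<sigma> x u t \<omega> $ i)"
    by simp
  show "L2cont (\<lambda>t \<omega>. state M T W a \<sigma> x u t \<omega> $ i)"
  proof (rule L2cont_AE[OF X(2)[of i]])
    show "continuous_on {0..T} (\<lambda>t. state M T W a \<sigma> x u t \<omega> $ i)" if "\<omega> \<in> space M" for \<omega>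
      using 1 that by (simp add: lin_process_def)
    show "AE \<omega> in M. state M T W a \<sigma> x u t \<omega> $ i = X i t \<omega>" if "t \<in> {0..T}" for t
      using lin_process_unique[OF a_cont 1 X(1)] by eventually_elim (use that in simp)
  qed
qed

end

section \<open>Conditional moments\<close>

lemma matrix_mult_nth: "(A ** B) $ i $ k = (A *v column k B) $ i"
  by (simp add: matrix_matrix_mult_def matrix_vector_mult_def column_def)

lemma Itilde_mult_nth: "(Itilde ** N) $ i $ k =
    1/2 * N $ Inl (Inl i) $ k + N $ Inl (Inr i) $ k + 1/3 * N $ Inr (Inl i) $ k + 1/2 * N $ Inr (Inr i) $ k"
  unfolding matrix_mult_nth Itilde_mult_vec by (simp add: column_def)

lemma matK_nth:
  "matK M0 M1 t $ i $ Inl m = M0 t $ Inr i $ m + (Itilde ** M1 t) $ i $ Inl m"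
  "matK M0 M1 t $ i $ Inr m = M0 t $ Inl i $ m + (Itilde ** M1 t) $ i $ Inr m"
proof -
  have "(hcat (0 :: real ^ 'a ^ 'a) (mat 1) ** M0 t) $ i $ m = M0 t $ Inr i $ m"
    "(hcat (mat 1) (0 :: real ^ 'a ^ 'a) ** M0 t) $ i $ m = M0 t $ Inl i $ m"
    unfolding matrix_mult_nth hcat_mult_vec by (simp_all add: column_def)
  then show "matK M0 M1 t $ i $ Inl m = M0 t $ Inr i $ m + (Itilde ** M1 t) $ i $ Inl m"
    "matK M0 M1 t $ i $ Inr m = M0 t $ Inl i $ m + (Itilde ** M1 t) $ i $ Inr m"
    by (simp_all add: matK_def)
qed

lemma has_vector_derivative_vec_nth:
  "(f has_vector_derivative f') F \<Longrightarrow> ((\<lambda>t. f t $ i) has_vector_derivative f' $ i) F"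
  by (rule bounded_linear.has_vector_derivative[OF bounded_linear_vec_nth])

lemma matK_has_vector_derivative:
  assumes "(M0 has_vector_derivative M0' t) (at t within S)" "(M1 has_vector_derivative M1' t) (at t within S)"
  shows "((\<lambda>t. matK M0 M1 t $ i $ k) has_vector_derivative matK M0' M1' t $ i $ k) (at t within S)"
proof -
  note d = has_vector_derivative_vec_nth[OF has_vector_derivative_vec_nth]
  show ?thesis
    by (cases k)
      (auto simp: matK_nth Itilde_mult_nth intro!: has_vector_derivative_add has_vector_derivative_divide
        d[OF assms(1)] d[OF assms(2)])
qed

lemma continuous_on_matK:
  assumes "continuous_on S M0" "continuous_on S M1"
  shows "continuous_on S (\<lambda>t. matK M0 M1 t $ i $ k)"
  by (cases k) (auto simp: matK_nth Itilde_mult_nth intro!: continuous_intros assms)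

lemma uniform_moment:
  assumes r: "distr M borel r = uniform_measure lborel {0..1}" "r \<in> borel_measurable M"
  shows "integrable M (\<lambda>\<omega>. (r \<omega>) ^ k :: real)" "(\<integral>\<omega>. (r \<omega>) ^ k \<partial>M) = 1 / real (Suc k)"
proof -
  have d: "distr M borel r = density lborel (\<lambda>x. indicator {0..1::real} x)"
    unfolding r(1) uniform_measure_def by (intro density_cong) (auto simp: indicator_def divide_ennreal_def)
  have "((\<lambda>x. x ^ Suc k / real (Suc k)) has_real_derivative x ^ k) (at x)" for x :: real
    using DERIV_cdivide[OF DERIV_pow[of "Suc k" x UNIV], of "real (Suc k)"] by (simp del: of_nat_Suc power_Suc)
  then have "has_bochner_integral lborel (\<lambda>x. x ^ k * indicator {0..1} x) (1 / real (Suc k))"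
    using has_bochner_integral_FTC_Icc_nonneg[where F="\<lambda>x. x ^ Suc k / real (Suc k)" and f="\<lambda>x. x ^ k" and a=0 and b=1]
    by (simp del: of_nat_Suc)
  then have h: "integrable lborel (\<lambda>x :: real. indicator {0..1} x * x ^ k)" "(\<integral>x. indicator {0..1} x * (x :: real) ^ k \<partial>lborel) = 1 / real (Suc k)"
    by (auto simp: has_bochner_integral_iff mult.commute)
  have m: "(\<lambda>x :: real. indicator {0..1} x :: ennreal) = (\<lambda>x. ennreal (indicator {0..1} x))"
    by (auto simp: indicator_def)
  have "integrable (distr M borel r) (\<lambda>x. x ^ k)"
    unfolding d m using h by (subst integrable_real_density) auto
  then show "integrable M (\<lambda>\<omega>. (r \<omega>) ^ k)"
    using r(2) by (subst (asm) integrable_distr_eq) auto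
  have "(\<integral>\<omega>. (r \<omega>) ^ k \<partial>M) = (\<integral>x. x ^ k \<partial>distr M borel r)"
    using r(2) by (subst integral_distr) auto
  also have "\<dots> = 1 / real (Suc k)"
    unfolding d m using h by (subst integral_real_density) auto
  finally show "(\<integral>\<omega>. (r \<omega>) ^ k \<partial>M) = 1 / real (Suc k)" .
qed

context brownian
begin

lemma indep_product_expectation:
  assumes G: "subalgebra M G" and ind: "indep_set (sets G) (sets (FW T))" and t: "t \<in> {0..T}"
    and R: "R \<in> borel_measurable G" "integrable M R" and V: "V \<in> borel_measurable (FW t)" "integrable M V"
  shows "integrable M (\<lambda>\<omega>. R \<omega> * V \<omega> :: real)" "expectation (\<lambda>\<omega>. R \<omega> * V \<omega>) = expectation R * expectation V"
proof -
  have VT: "V \<in> borel_measurable (FW T)" using measurable_FW_mono[of t T] V t by simp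
  have sG: "space G = space M" using G by (simp add: subalgebra_def)
  have "indep_set {R -` A \<inter> space M |A. A \<in> sets borel} {V -` A \<inter> space M |A. A \<in> sets borel}"
    using ind unfolding indep_set_def
    by (elim indep_sets_mono_sets) (use measurable_sets[OF R(1)] measurable_sets[OF VT] sG in \<open>auto split: bool.split\<close>)
  moreover have "Int_stable {X -` A \<inter> space M |A. A \<in> sets borel}" for X :: "'w \<Rightarrow> real"
  proof (safe intro!: Int_stableI)
    fix A B :: "real set" assume "A \<in> sets borel" "B \<in> sets borel"
    then show "\<exists>C. (X -` A \<inter> space M) \<inter> (X -` B \<inter> space M) = (X -` C \<inter> space M) \<and> C \<in> sets borel"
      by (intro exI[of _ "A \<inter> B"]) auto
  qed
  ultimately have "indep_var borel R borel V"
    unfolding indep_var_eq using borel_measurable_integrable[OF R(2)] borel_measurable_integrable[OF V(2)]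
    by (intro conjI indep_set_sigma_sets)
  from indep_var_lebesgue_integral[OF this R(2) V(2)] indep_var_integrable[OF this R(2) V(2)]
  show "integrable M (\<lambda>\<omega>. R \<omega> * V \<omega>)" "expectation (\<lambda>\<omega>. R \<omega> * V \<omega>) = expectation R * expectation V"
    by simp_all
qed

text \<open>The indicator of an event of \<open>FW t\<close> is absorbed into V, and independence of
  R from the Brownian field then factors out its mean.\<close>

lemma cond_exp_independent_factor:
  assumes G: "subalgebra M G" and ind: "indep_set (sets G) (sets (FW T))" and t: "t \<in> {0..T}"
    and R: "R \<in> borel_measurable G" "integrable M R" and V: "V \<in> borel_measurable (FW t)" "integrable M V"
  shows "AE \<omega> in M. real_cond_exp M (FW t) (\<lambda>\<omega>. R \<omega> * V \<omega> :: real) \<omega> = expectation R * V \<omega>"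
proof -
  interpret finite_measure_subalgebra M "FW t"
    by unfold_locales (rule subalgebra_FW[OF t])
  show ?thesis
  proof (rule real_cond_exp_charact)
    fix A assume A: "A \<in> sets (FW t)"
    then have AM: "A \<in> sets M" using subalgebra_FW[OF t] by (auto simp: subalgebra_def)
    have m: "(\<lambda>\<omega>. indicator A \<omega> * V \<omega>) \<in> borel_measurable (FW t)" using A V(1) by measurable
    have i: "integrable M (\<lambda>\<omega>. indicator A \<omega> * V \<omega>)"
      using integrable_mult_indicator[OF AM V(2)] by simp
    have "(\<integral>\<omega>\<in>A. (R \<omega> * V \<omega>) \<partial>M) = expectation (\<lambda>\<omega>. R \<omega> * (indicator A \<omega> * V \<omega>))"
      by (simp add: set_lebesgue_integral_def mult_ac)
    also have "\<dots> = expectation R * expectation (\<lambda>\<omega>. indicator A \<omega> * V \<omega>)"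
      by (rule indep_product_expectation(2)[OF G ind t R m i])
    also have "\<dots> = (\<integral>\<omega>\<in>A. (expectation R * V \<omega>) \<partial>M)"
      by (simp add: set_lebesgue_integral_def mult.left_commute[of "indicator A _"])
    finally show "(\<integral>\<omega>\<in>A. (R \<omega> * V \<omega>) \<partial>M) = (\<integral>\<omega>\<in>A. (expectation R * V \<omega>) \<partial>M)" .
  qed (use indep_product_expectation(1)[OF G ind t R V] V in auto)
qed

text \<open>The lifted state is a polynomial in \<open>r\<close> with \<open>FW t\<close>-measurable
  coefficients, of degree at most 2 even after multiplication by \<open>r\<close>. Conditioning
  replaces the k-th power of \<open>r\<close> by its moment 1 / (k + 1).\<close>

lemma cond_exp_uniform:
  assumes G: "subalgebra M G" and ind: "indep_set (sets G) (sets (FW T))" and t: "t \<in> {0..T}"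
    and r: "r \<in> borel_measurable G" "distr M borel r = uniform_measure lborel {0..1}"
    and V: "\<And>k. V k \<in> borel_measurable (FW t)" "\<And>k. integrable M (V k)"
    and f: "f \<in> borel_measurable M" "AE \<omega> in M. f \<omega> = V 0 \<omega> + r \<omega> * V 1 \<omega> + (r \<omega>)\<^sup>2 * V 2 \<omega>"
  shows "AE \<omega> in M. real_cond_exp M (FW t) f \<omega> = V 0 \<omega> + 1/2 * V 1 \<omega> + 1/3 * V (2 :: nat) \<omega>"
proof -
  interpret finite_measure_subalgebra M "FW t"
    by unfold_locales (rule subalgebra_FW[OF t])
  have rM: "r \<in> borel_measurable M" using r(1) measurable_from_subalg[OF G] by blast
  note mom = uniform_moment[OF r(2) rM]
  have R: "(\<lambda>\<omega>. r \<omega> ^ k) \<in> borel_measurable G" for k using r(1) by measurable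
  have i: "integrable M (\<lambda>\<omega>. r \<omega> ^ k * V k \<omega>)" for k
    by (rule indep_product_expectation(1)[OF G ind t R mom(1) V])
  have c: "AE \<omega> in M. real_cond_exp M (FW t) (\<lambda>\<omega>. r \<omega> ^ k * V k \<omega>) \<omega> = 1 / real (Suc k) * V k \<omega>" for k
    using cond_exp_independent_factor[OF G ind t R mom(1) V] unfolding mom(2) .
  let ?g = "\<lambda>\<omega>. (r \<omega> ^ 0 * V 0 \<omega> + r \<omega> ^ 1 * V 1 \<omega>) + r \<omega> ^ 2 * V 2 \<omega>"
  have "AE \<omega> in M. real_cond_exp M (FW t) f \<omega> = real_cond_exp M (FW t) ?g \<omega>"
  proof (rule real_cond_exp_cong[OF _ f(1)])
    show "AE \<omega> in M. f \<omega> = ?g \<omega>" using f(2) by eventually_elim simp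
    show "?g \<in> borel_measurable M" using i by (intro borel_measurable_integrable Bochner_Integration.integrable_add)
  qed
  moreover have "AE \<omega> in M. real_cond_exp M (FW t) ?g \<omega> =
      real_cond_exp M (FW t) (\<lambda>\<omega>. r \<omega> ^ 0 * V 0 \<omega> + r \<omega> ^ 1 * V 1 \<omega>) \<omega> + real_cond_exp M (FW t) (\<lambda>\<omega>. r \<omega> ^ 2 * V 2 \<omega>) \<omega>"
    by (rule real_cond_exp_add[OF Bochner_Integration.integrable_add[OF i i] i])
  moreover have "AE \<omega> in M. real_cond_exp M (FW t) (\<lambda>\<omega>. r \<omega> ^ 0 * V 0 \<omega> + r \<omega> ^ 1 * V 1 \<omega>) \<omega> =
      real_cond_exp M (FW t) (\<lambda>\<omega>. r \<omega> ^ 0 * V 0 \<omega>) \<omega> + real_cond_exp M (FW t) (\<lambda>\<omega>. r \<omega> ^ 1 * V 1 \<omega>) \<omega>"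
    by (rule real_cond_exp_add[OF i i])
  ultimately show ?thesis
    using c[of 0] c[of 1] c[of 2] by eventually_elim simp
qed

end

section \<open>The closed loop\<close>

context brownian
begin

text \<open>The factor \<open>\<rho>\<close> may be random; it is \<open>r - 1\<close> for the upper block of the lifted state.\<close>

lemma lin_process_combine:
  assumes a: "continuous_on {0..T} a" and X: "lin_process a c h I X" and k: "k \<in> H2" and y: "ode_process a k y"
  shows "lin_process a (c1 * c) (\<lambda>t \<omega>. c1 * h t \<omega> + \<rho> \<omega> * k t \<omega>) (\<lambda>t \<omega>. c1 * I t \<omega>) (\<lambda>t \<omega>. c1 * X t \<omega> + \<rho> \<omega> * y t \<omega>)"
  unfolding lin_process_def
proof (intro conjI ballI)
  show "continuous_on {0..T} (\<lambda>t. c1 * X t \<omega> + \<rho> \<omega> * y t \<omega>)" if "\<omega> \<in> space M" for \<omega>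
    using X y that by (intro continuous_intros) (auto simp: lin_process_def ode_process_def)
  note X' = conjunct1[OF conjunct2[OF X[unfolded lin_process_def]]] conjunct2[OF conjunct2[OF X[unfolded lin_process_def]]]
  show "AE \<omega> in M. set_integrable lborel {0..T} (\<lambda>t. c1 * h t \<omega> + \<rho> \<omega> * k t \<omega>)"
    using X'(1) H2_paths[OF k] by eventually_elim (intro set_integral_add set_integrable_mult_right, auto)
  show "AE \<omega> in M. \<forall>t\<in>{0..T}. c1 * X t \<omega> + \<rho> \<omega> * y t \<omega> =
      c1 * c + (LINT s:{0..t}|lborel. a s * (c1 * X s \<omega> + \<rho> \<omega> * y s \<omega>) + (c1 * h s \<omega> + \<rho> \<omega> * k s \<omega>)) + c1 * I t \<omega>"
    using X' H2_paths[OF k] ode_process_eq[OF a k y] AE_space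
  proof eventually_elim
    case (elim \<omega>)
    have "continuous_on {0..T} (\<lambda>t. X t \<omega>)" "continuous_on {0..T} (\<lambda>t. y t \<omega>)"
      using X y elim by (auto simp: lin_process_def ode_process_def)
    then have "set_integrable lborel {0..T} (\<lambda>s. a s * X s \<omega>)" "set_integrable lborel {0..T} (\<lambda>s. a s * y s \<omega>)"
      by (auto intro: set_integrable_mult_continuous[OF continuous_set_integrable[OF a]])
    then have i: "set_integrable lborel {0..T} (\<lambda>s. a s * X s \<omega> + h s \<omega>)" "set_integrable lborel {0..T} (\<lambda>s. a s * y s \<omega> + k s \<omega>)"
      using elim by (auto intro: set_integral_add)
    show ?case
    proof
      fix t assume t: "t \<in> {0..T}"
      have it: "set_integrable lborel {0..t} (\<lambda>s. a s * X s \<omega> + h s \<omega>)" "set_integrable lborel {0..t} (\<lambda>s. a s * y s \<omega> + k s \<omega>)"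
        using t by (auto intro: set_integrable_subset[OF i(1)] set_integrable_subset[OF i(2)])
      have "(LINT s:{0..t}|lborel. a s * (c1 * X s \<omega> + \<rho> \<omega> * y s \<omega>) + (c1 * h s \<omega> + \<rho> \<omega> * k s \<omega>)) =
          (LINT s:{0..t}|lborel. c1 * (a s * X s \<omega> + h s \<omega>) + \<rho> \<omega> * (a s * y s \<omega> + k s \<omega>))"
        by (rule set_lebesgue_integral_cong) (auto simp: algebra_simps)
      also have "\<dots> = c1 * (LINT s:{0..t}|lborel. a s * X s \<omega> + h s \<omega>) + \<rho> \<omega> * (LINT s:{0..t}|lborel. a s * y s \<omega> + k s \<omega>)"
        by (subst set_integral_add(2)[OF set_integrable_mult_right set_integrable_mult_right]) (simp_all add: it)
      finally show "c1 * X t \<omega> + \<rho> \<omega> * y t \<omega> =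
        c1 * c + (LINT s:{0..t}|lborel. a s * (c1 * X s \<omega> + \<rho> \<omega> * y s \<omega>) + (c1 * h s \<omega> + \<rho> \<omega> * k s \<omega>)) + c1 * I t \<omega>"
        using elim(2,4) t by (simp add: algebra_simps)
    qed
  qed
qed

lemma lin_process_ode:
  assumes a: "continuous_on {0..T} a" and X: "lin_process a 0 h I X" and I: "AE \<omega> in M. \<forall>t\<in>{0..T}. I t \<omega> = 0"
  shows "ode_process a h X"
proof -
  have "lin_process a 0 h (\<lambda>t \<omega>. 0) X"
    unfolding lin_process_def
  proof (intro conjI)
    show "AE \<omega> in M. \<forall>t\<in>{0..T}. X t \<omega> = 0 + (LINT s:{0..t}|lborel. a s * X s \<omega> + h s \<omega>) + 0"
      using conjunct2[OF conjunct2[OF X[unfolded lin_process_def]]] I by eventually_elim simp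
  qed (use X in \<open>auto simp: lin_process_def\<close>)
  moreover have "lin_process a 0 (\<lambda>t \<omega>. 0) (\<lambda>t \<omega>. 0) (\<lambda>t \<omega>. 0)"
    by (simp add: lin_process_def set_integrable_def)
  ultimately show ?thesis using lin_process_diff[OF a] by fastforce
qed

text \<open>The feedback law is known almost surely at each fixed time, but the integral equations
  need it for almost every time along a path. Measurability of the equality set in the product space
  lets Fubini exchange the two quantifiers.\<close>

lemma AE_path_of_AE:
  fixes f g :: "real \<Rightarrow> 'w \<Rightarrow> real"
  assumes f: "f \<in> H2" and g: "g \<in> H2" and ae: "\<And>t. t \<in> {0..T} \<Longrightarrow> AE \<omega> in M. f t \<omega> = g t \<omega>"
  shows "AE \<omega> in M. AE t in lborel_on T. f t \<omega> = g t \<omega>" and "AE z in P. f (snd z) (fst z) = g (snd z) (fst z)"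
proof -
  interpret pair_sigma_finite M "lborel_on T" by (rule pair_P)
  have m: "{z \<in> space P. f (snd z) (fst z) = g (snd z) (fst z)} \<in> sets P"
    using H2D(2)[OF f] H2D(2)[OF g] by measurable
  have "AE t in lborel_on T. AE \<omega> in M. f t \<omega> = g t \<omega>"
    using AE_space by eventually_elim (auto intro: ae)
  then show 1: "AE \<omega> in M. AE t in lborel_on T. f t \<omega> = g t \<omega>"
    using AE_commute[of "\<lambda>\<omega> t. f t \<omega> = g t \<omega>"] m by simp
  show "AE z in P. f (snd z) (fst z) = g (snd z) (fst z)"
    using AE_pair_iff[of "\<lambda>\<omega> t. f t \<omega> = g t \<omega>"] m 1 by (simp add: split_beta')
qed

end

context brownian
begin

lemma cond_exp_uniform3:
  assumes G: "subalgebra M G" and ind: "indep_set (sets G) (sets (FW T))" and t: "t \<in> {0..T}"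
    and r: "r \<in> borel_measurable G" "distr M borel r = uniform_measure lborel {0..1}"
    and V: "V0 \<in> borel_measurable (FW t)" "integrable M V0" "V1 \<in> borel_measurable (FW t)" "integrable M V1"
      "V2 \<in> borel_measurable (FW t)" "integrable M V2"
    and f: "f \<in> borel_measurable M" "AE \<omega> in M. f \<omega> = V0 \<omega> + r \<omega> * V1 \<omega> + (r \<omega>)\<^sup>2 * V2 \<omega>"
  shows "AE \<omega> in M. real_cond_exp M (FW t) f \<omega> = V0 \<omega> + 1/2 * V1 \<omega> + 1/3 * V2 \<omega>"
  using cond_exp_uniform[OF G ind t r, of "\<lambda>k. if k = 0 then V0 else if k = 1 then V1 else V2" f] V f by simp

end

locale lq_closed_loop = lq_setting M T W a \<sigma> x
  for M :: "'w measure" and T and W :: "real \<Rightarrow> 'w \<Rightarrow> real ^ 'n" and a \<sigma> :: "'n \<Rightarrow> real \<Rightarrow> real" and x +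
  fixes G :: "'w measure" and r :: "'w \<Rightarrow> real" and q :: "'n \<Rightarrow> 'n \<Rightarrow> real" and \<gamma> d :: "'n \<Rightarrow> real"
    and M0 M1 M2 and u :: "real \<Rightarrow> 'w \<Rightarrow> real ^ 'n" and Z :: "real \<Rightarrow> 'w \<Rightarrow> real ^ ('n + 'n)"
  assumes G: "subalgebra M G" and indep_G: "indep_set (sets G) (sets (FW T))"
    and r: "r \<in> borel_measurable G" "distr M borel r = uniform_measure lborel {0..1}"
    and M0: "M0_equation T a q \<gamma> M0" and M1: "M1_equation T a M0 M1" and M2: "M2_equation T a \<gamma> d M0 M1 M2"
    and closed_loop: "closed_loop M T W G r a \<sigma> x M0 M1 M2 u Z"
begin

lemma u_H2: "(\<lambda>t \<omega>. u t \<omega> $ i) \<in> H2"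
  using closed_loop by (intro H2_vec_nth) (simp add: closed_loop_def)

abbreviation XS where "XS i t \<omega> \<equiv> state M T W a \<sigma> x u t \<omega> $ i"
abbreviation Y where "Y i t \<omega> \<equiv> Z t \<omega> $ Inr i"

lemma Z_sde: "sde_solution M T (enlarged_filtration FW G) W
    (\<lambda>t \<omega> y. matA a t *v y + matI (r \<omega>) *v u t \<omega>) (matSigma \<sigma>) (vcat x 0) Z"
  using closed_loop by (simp add: closed_loop_def lifted_state_def)

lemma enlarged: "brownian_wrt M T W (enlarged_filtration FW G)"
  by (rule enlarged_wrt(3)[OF G indep_G])

text \<open>The upper block has forcing r u = u + (r - 1) u and the noise and initial value of the
  game state, so uniqueness identifies it as X + (r - 1) Y. The noise of the game is obtained as the
  upper block of the lifted noise, which also settles that such a noise exists.\<close>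

lemma lifted_blocks:
  shows noise_exists: "\<exists>I. wiener_integral (\<lambda>t. diagm (\<lambda>i. \<sigma> i t)) I"
    and Y_ode: "\<And>i. ode_process (a i) (\<lambda>t \<omega>. u t \<omega> $ i) (Y i)"
    and Z_eq: "\<And>i. AE \<omega> in M. \<forall>t\<in>{0..T}. Z t \<omega> $ Inl i = XS i t \<omega> - Y i t \<omega> + r \<omega> * Y i t \<omega>"
proof -
  obtain I where I: "wiener_integral (matSigma \<sigma>) I"
    using sde_solution_wiener[OF enlarged Z_sde continuous_on_matSigma] by blast
  let ?E = "hcat (mat 1 :: real ^ 'n ^ 'n) (0 :: real ^ 'n ^ 'n)" and ?E' = "hcat (0 :: real ^ 'n ^ 'n) (mat 1 :: real ^ 'n ^ 'n)"
  have E: "?E ** matSigma \<sigma> t = diagm (\<lambda>i. \<sigma> i t)" "?E' ** matSigma \<sigma> t = 0" for t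
    by (simp_all add: vec_eq_iff matrix_mult_nth hcat_mult_vec matSigma_def column_def)
  have I0: "wiener_integral (\<lambda>t. diagm (\<lambda>i. \<sigma> i t)) (\<lambda>t \<omega>. ?E *v I t \<omega>)"
    using wiener_integral_linear[OF I, of ?E] by (simp only: E)
  have EI: "(?E *v v) $ i = v $ Inl i" "(?E' *v v) $ i = v $ Inr i" for v i
    by (simp_all add: hcat_mult_vec)
  \<comment> \<open>The lower block of the noise integrates the zero matrix, as does the zero
    process; by uniqueness it vanishes.\<close>
  have "wiener_integral (\<lambda>t. (0 :: real ^ 'n ^ 'n)) (\<lambda>t \<omega>. ?E' *v I t \<omega>)"
    using wiener_integral_linear[OF I, of ?E'] by (simp only: E)
  moreover have "wiener_integral (\<lambda>t. (0 :: real ^ 'n ^ 'n)) (\<lambda>t \<omega>. 0)"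
    using wiener_integral_linear[OF I, of "0 :: real ^ ('n + 'n) ^ 'n"] by simp
  ultimately have "AE \<omega> in M. \<forall>t\<in>{0..T}. ?E' *v I t \<omega> = 0"
    by (rule wiener_integral_unique)
  then have zero: "AE \<omega> in M. \<forall>t\<in>{0..T}. I t \<omega> $ Inr i = 0" for i
    by eventually_elim (metis EI(2) zero_index)
  have h: "AE \<omega> in M. set_integrable lborel {0..T} (\<lambda>t. u t \<omega> $ i)" for i
    using H2_paths[OF u_H2[of i]] by eventually_elim simp
  have hr: "AE \<omega> in M. set_integrable lborel {0..T} (\<lambda>t. r \<omega> * u t \<omega> $ i)" for i
    using h[of i] by eventually_elim simp
  have "lin_process (a i) (vcat x (0 :: real ^ 'n) $ Inr i) (\<lambda>t \<omega>. u t \<omega> $ i) (\<lambda>t \<omega>. I t \<omega> $ Inr i) (Y i)" for i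
    by (rule sde_solution_lin_process[OF enlarged Z_sde continuous_on_matSigma I h]) simp
  then show Y: "ode_process (a i) (\<lambda>t \<omega>. u t \<omega> $ i) (Y i)" for i
    using lin_process_ode[OF a_cont _ zero, of i "\<lambda>t \<omega>. u t \<omega> $ i" i "Y i"] by simp
  have ZL: "lin_process (a i) (vcat x (0 :: real ^ 'n) $ Inl i) (\<lambda>t \<omega>. r \<omega> * u t \<omega> $ i) (\<lambda>t \<omega>. I t \<omega> $ Inl i) (\<lambda>t \<omega>. Z t \<omega> $ Inl i)" for i
    by (rule sde_solution_lin_process[OF enlarged Z_sde continuous_on_matSigma I hr]) simp
  show "\<exists>I. wiener_integral (\<lambda>t. diagm (\<lambda>i. \<sigma> i t)) I" using I0 by blast
  show "AE \<omega> in M. \<forall>t\<in>{0..T}. Z t \<omega> $ Inl i = XS i t \<omega> - Y i t \<omega> + r \<omega> * Y i t \<omega>" for i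
  proof -
    have X: "lin_process (a i) (x $ i) (\<lambda>t \<omega>. u t \<omega> $ i) (\<lambda>t \<omega>. I t \<omega> $ Inl i) (XS i)"
      using state_lin_process(1)[OF I0 u_H2, of i] by (simp only: EI)
    \<comment> \<open>The sum of the game state and the random multiple (r - 1) of Y solves the
      equation of the upper block with the same noise.\<close>
    have "lin_process (a i) (x $ i) (\<lambda>t \<omega>. r \<omega> * u t \<omega> $ i) (\<lambda>t \<omega>. I t \<omega> $ Inl i) (\<lambda>t \<omega>. XS i t \<omega> + (r \<omega> - 1) * Y i t \<omega>)"
      using lin_process_combine[OF a_cont X u_H2 Y, of 1 "\<lambda>\<omega>. r \<omega> - 1"] by (simp add: algebra_simps)
    from lin_process_unique[OF a_cont ZL[simplified] this]
    show ?thesis by eventually_elim (simp add: algebra_simps)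
  qed
qed

lemma Y_L2cont: "L2cont (Y i)"
  by (rule ode_process_L2cont[OF a_cont u_H2 Y_ode])

lemma XS_L2cont: "L2cont (XS i)"
  using noise_exists state_lin_process(2)[OF _ u_H2] by blast

text \<open>A continuous version of the conditional moments. The upper lifted block is (X - Y) + r
  Y; with E r = 1/2 and E r^2 = 1/3 its mean is X - Y/2, and after multiplication by r it is (X -
  Y)/2 + Y/3 = X/2 - Y/6.\<close>

definition F :: "real \<Rightarrow> 'w \<Rightarrow> real ^ (('n + 'n) + ('n + 'n))" where
  "F t \<omega> = vcat (vcat (\<chi> i. XS i t \<omega> - 1/2 * Y i t \<omega>) (\<chi> i. Y i t \<omega>))
    (vcat (\<chi> i. 1/2 * XS i t \<omega> - 1/6 * Y i t \<omega>) (\<chi> i. 1/2 * Y i t \<omega>))"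

lemma F_nth [simp]:
  "F t \<omega> $ Inl (Inl i) = XS i t \<omega> - 1/2 * Y i t \<omega>" "F t \<omega> $ Inl (Inr i) = Y i t \<omega>"
  "F t \<omega> $ Inr (Inl i) = 1/2 * XS i t \<omega> - 1/6 * Y i t \<omega>" "F t \<omega> $ Inr (Inr i) = 1/2 * Y i t \<omega>"
  by (simp_all add: F_def)

lemma L2cont_combine: "L2cont X \<Longrightarrow> L2cont X' \<Longrightarrow> L2cont (\<lambda>t \<omega>. c * X t \<omega> + c' * X' t \<omega>)"
  by (intro L2cont_add L2cont_mult_continuous continuous_on_const)

lemma F_L2cont: "L2cont (\<lambda>t \<omega>. F t \<omega> $ k)"
proof -
  consider i where "k = Inl (Inl i)" | i where "k = Inl (Inr i)" | i where "k = Inr (Inl i)" | i where "k = Inr (Inr i)"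
    by (cases k; metis sum.exhaust)
  then show ?thesis
  proof cases
    case 1 then show ?thesis using L2cont_combine[OF XS_L2cont Y_L2cont, of 1 i "-1/2" i] by simp
  next
    case 2 then show ?thesis using Y_L2cont by simp
  next
    case 3 then show ?thesis using L2cont_combine[OF XS_L2cont Y_L2cont, of "1/2" i "-1/6" i] by simp
  next
    case 4 then show ?thesis using L2cont_combine[OF Y_L2cont Y_L2cont, of "1/2" i 0 i] by simp
  qed
qed

lemma cond_moments_F:
  assumes t: "t \<in> {0..T}"
  shows "AE \<omega> in M. F t \<omega> = cond_moments M W r Z t \<omega>"
proof -
  interpret E: brownian_wrt M T W "enlarged_filtration FW G" by (rule enlarged)
  have rM: "r \<in> borel_measurable M" using r(1) measurable_from_subalg[OF G] by blast
  have ZM: "Z t \<in> borel_measurable M"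
    using conjunct1[OF Z_sde[unfolded sde_solution_def adapted_def]] t by (intro E.measurable_Fil_M[OF t]) blast
  have Zk: "(\<lambda>\<omega>. Z t \<omega> $ k) \<in> borel_measurable M" for k by (rule borel_measurable_vec_nth[OF ZM])
  have LX: "XS i t \<in> borel_measurable (FW t)" "integrable M (XS i t)" for i
    using L2contD[OF XS_L2cont t] by auto
  have LY: "Y i t \<in> borel_measurable (FW t)" "integrable M (Y i t)" for i
    using L2contD[OF Y_L2cont t] by auto
  note ce = cond_exp_uniform3[OF G indep_G t r]
  have eq: "AE \<omega> in M. Z t \<omega> $ Inl i = XS i t \<omega> - Y i t \<omega> + r \<omega> * Y i t \<omega>" for i
    using Z_eq[of i] by eventually_elim (use t in simp)
  have 1: "AE \<omega> in M. F t \<omega> $ Inl (Inl i) = cond_moments M W r Z t \<omega> $ Inl (Inl i)" for i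
  proof -
    have "AE \<omega> in M. real_cond_exp M (FW t) (\<lambda>\<omega>. Z t \<omega> $ Inl i) \<omega> =
        (XS i t \<omega> - Y i t \<omega>) + 1/2 * Y i t \<omega> + 1/3 * 0"
      by (rule ce) (use LX[of i] LY[of i] Zk eq[of i] in simp_all)
    then show ?thesis by eventually_elim (simp add: cond_moments_def cond_exp_vec_def)
  qed
  have 2: "AE \<omega> in M. F t \<omega> $ Inl (Inr i) = cond_moments M W r Z t \<omega> $ Inl (Inr i)" for i
  proof -
    have "AE \<omega> in M. real_cond_exp M (FW t) (Y i t) \<omega> = Y i t \<omega> + 1/2 * 0 + 1/3 * 0"
      by (rule ce) (use LY[of i] Zk in simp_all)
    then show ?thesis by eventually_elim (simp add: cond_moments_def cond_exp_vec_def)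
  qed
  have 3: "AE \<omega> in M. F t \<omega> $ Inr (Inl i) = cond_moments M W r Z t \<omega> $ Inr (Inl i)" for i
  proof -
    \<comment> \<open>Multiplying by \<open>r\<close> raises the degree to 2, so the second moment
      1/3 enters here.\<close>
    have "AE \<omega> in M. r \<omega> * Z t \<omega> $ Inl i = 0 + r \<omega> * (XS i t \<omega> - Y i t \<omega>) + (r \<omega>)\<^sup>2 * Y i t \<omega>"
      using eq[of i] by eventually_elim (simp only:, simp add: algebra_simps power2_eq_square)
    then have "AE \<omega> in M. real_cond_exp M (FW t) (\<lambda>\<omega>. r \<omega> * Z t \<omega> $ Inl i) \<omega> =
        0 + 1/2 * (XS i t \<omega> - Y i t \<omega>) + 1/3 * Y i t \<omega>"
      by (intro ce) (use LX[of i] LY[of i] Zk[of "Inl i"] rM in simp_all)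
    then show ?thesis by eventually_elim (simp add: cond_moments_def cond_exp_vec_def field_simps)
  qed
  have 4: "AE \<omega> in M. F t \<omega> $ Inr (Inr i) = cond_moments M W r Z t \<omega> $ Inr (Inr i)" for i
  proof -
    have "AE \<omega> in M. real_cond_exp M (FW t) (\<lambda>\<omega>. r \<omega> * Y i t \<omega>) \<omega> = 0 + 1/2 * Y i t \<omega> + 1/3 * 0"
      by (rule ce) (use LY[of i] Zk[of "Inr i"] rM in simp_all)
    then show ?thesis by eventually_elim (simp add: cond_moments_def cond_exp_vec_def)
  qed
  have all: "AE \<omega> in M. \<forall>i. Q i \<omega>" if "\<And>i. AE \<omega> in M. Q i \<omega>" for Q :: "'n \<Rightarrow> 'w \<Rightarrow> bool"
    using that by (intro AE_all_countable[THEN iffD2]) auto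
  have "AE \<omega> in M. \<forall>i. F t \<omega> $ Inl (Inl i) = cond_moments M W r Z t \<omega> $ Inl (Inl i)" by (rule all) (rule 1)
  moreover have "AE \<omega> in M. \<forall>i. F t \<omega> $ Inl (Inr i) = cond_moments M W r Z t \<omega> $ Inl (Inr i)" by (rule all) (rule 2)
  moreover have "AE \<omega> in M. \<forall>i. F t \<omega> $ Inr (Inl i) = cond_moments M W r Z t \<omega> $ Inr (Inl i)" by (rule all) (rule 3)
  moreover have "AE \<omega> in M. \<forall>i. F t \<omega> $ Inr (Inr i) = cond_moments M W r Z t \<omega> $ Inr (Inr i)" by (rule all) (rule 4)
  ultimately show ?thesis
  proof eventually_elim
    case (elim \<omega>)
    show ?case
      unfolding vec_eq_iff
    proof
      fix k :: "('n + 'n) + ('n + 'n)"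
      consider i where "k = Inl (Inl i)" | i where "k = Inl (Inr i)" | i where "k = Inr (Inl i)" | i where "k = Inr (Inr i)"
        by (cases k; metis sum.exhaust)
      then show "F t \<omega> $ k = cond_moments M W r Z t \<omega> $ k"
        using elim by cases (simp_all del: F_nth)
    qed
  qed
qed

section \<open>The feedback and the equation of the filtered process\<close>

definition \<theta> :: "real \<Rightarrow> 'w \<Rightarrow> real ^ 'n" where
  "\<theta> t \<omega> = matK M0 M1 t *v F t \<omega> + Itilde *v M2 t"

definition bF :: "real \<Rightarrow> 'w \<Rightarrow> real ^ (('n + 'n) + ('n + 'n))" where
  "bF t \<omega> = (matAA a t - transpose Itilde ** matK M0 M1 t) *v F t \<omega> - transpose Itilde *v (Itilde *v M2 t)"

lemma bF_eq: "bF t \<omega> = matAA a t *v F t \<omega> - transpose Itilde *v \<theta> t \<omega>"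
  unfolding bF_def \<theta>_def
  by (simp add: matrix_vector_mult_diff_rdistrib matrix_vector_mul_assoc[symmetric] matrix_vector_right_distrib)

lemma bF_nth:
  "bF t \<omega> $ Inl (Inl i) = a i t * F t \<omega> $ Inl (Inl i) - 1/2 * \<theta> t \<omega> $ i"
  "bF t \<omega> $ Inl (Inr i) = a i t * F t \<omega> $ Inl (Inr i) - \<theta> t \<omega> $ i"
  "bF t \<omega> $ Inr (Inl i) = a i t * F t \<omega> $ Inr (Inl i) - 1/3 * \<theta> t \<omega> $ i"
  "bF t \<omega> $ Inr (Inr i) = a i t * F t \<omega> $ Inr (Inr i) - 1/2 * \<theta> t \<omega> $ i"
  unfolding bF_eq by (simp_all add: matAA_mult_vec del: F_nth)

lemma C1_continuous: "C1_deriv T f f' \<Longrightarrow> continuous_on {0..T} f"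
  unfolding C1_deriv_def by (rule continuous_on_vector_derivative) auto

lemma matrices_continuous: "continuous_on {0..T} M0" "continuous_on {0..T} M1" "continuous_on {0..T} M2"
  using M0 M1 M2 C1_continuous unfolding M0_equation_def M1_equation_def M2_equation_def by blast+

lemma \<theta>_L2cont: "L2cont (\<lambda>t \<omega>. \<theta> t \<omega> $ i)"
proof -
  have "continuous_on {0..T} (\<lambda>t. (Itilde *v M2 t) $ i)"
    unfolding Itilde_mult_vec by (intro continuous_intros continuous_on_component matrices_continuous)
  moreover have "L2cont (\<lambda>t \<omega>. \<Sum>k\<in>UNIV. matK M0 M1 t $ i $ k * F t \<omega> $ k)"
    by (intro L2cont_sum L2cont_mult_continuous F_L2cont continuous_on_matK matrices_continuous)
  ultimately show ?thesis
    unfolding \<theta>_def vector_add_component matrix_vector_mult_def[of "matK _ _ _"] vec_lambda_beta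
    by (intro L2cont_add L2cont_continuous)
qed

lemma bF_L2cont: "L2cont (\<lambda>t \<omega>. bF t \<omega> $ k)"
proof -
  have *: "L2cont (\<lambda>t \<omega>. a i t * F t \<omega> $ k - c * \<theta> t \<omega> $ i)" for i k c
    using L2cont_add[OF L2cont_mult_continuous[OF F_L2cont a_cont] L2cont_mult_continuous[OF \<theta>_L2cont continuous_on_const[of _ "- c"]]]
    by simp
  consider i where "k = Inl (Inl i)" | i where "k = Inl (Inr i)" | i where "k = Inr (Inl i)" | i where "k = Inr (Inr i)"
    by (cases k; metis sum.exhaust)
  then show ?thesis
    using *[of _ _ "1/2"] *[of _ _ 1] *[of _ _ "1/3"] by cases (simp_all add: bF_nth del: F_nth)
qed

lemma u_feedback: "t \<in> {0..T} \<Longrightarrow> AE \<omega> in M. u t \<omega> = - \<theta> t \<omega>"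
proof -
  assume t: "t \<in> {0..T}"
  have "AE \<omega> in M. u t \<omega> = - (matK M0 M1 t *v cond_moments M W r Z t \<omega>) - Itilde *v M2 t"
    using closed_loop t by (simp add: closed_loop_def)
  with cond_moments_F[OF t] show "AE \<omega> in M. u t \<omega> = - \<theta> t \<omega>"
    by eventually_elim (simp add: \<theta>_def)
qed

lemma u_feedback_AE:
  "AE \<omega> in M. AE t in lborel_on T. u t \<omega> $ i = - \<theta> t \<omega> $ i"
  "AE z in P. u (snd z) (fst z) $ i = - \<theta> (snd z) (fst z) $ i"
proof -
  have "(\<lambda>t \<omega>. - \<theta> t \<omega> $ i) \<in> H2"
    using L2cont_H2[OF L2cont_mult_continuous[OF \<theta>_L2cont continuous_on_const[of _ "- 1"]]] by simp
  moreover have "AE \<omega> in M. u t \<omega> $ i = - \<theta> t \<omega> $ i" if "t \<in> {0..T}" for t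
    using u_feedback[OF that] by eventually_elim simp
  ultimately show "AE \<omega> in M. AE t in lborel_on T. u t \<omega> $ i = - \<theta> t \<omega> $ i"
    "AE z in P. u (snd z) (fst z) $ i = - \<theta> (snd z) (fst z) $ i"
    using AE_path_of_AE[OF u_H2] by blast+
qed

text \<open>All four blocks of \<open>F\<close> are such combinations, with (c1, c2) equal to (1,
  -1/2), (0, 1), (1/2, -1/6) and (0, 1/2). The sums c1 + c2 are 1/2, 1, 1/3, 1/2, which is how the
  weights of \<open>Itilde\<close> appear in the drift. Replacing u by - theta is legitimate because
  the two agree at almost every time and only integrals are involved.\<close>

lemma combined_equation:
  assumes I: "wiener_integral (\<lambda>t. diagm (\<lambda>i. \<sigma> i t)) I"
  shows "AE \<omega> in M. \<forall>t\<in>{0..T}. c1 * XS i t \<omega> + c2 * Y i t \<omega> =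
    c1 * x $ i + (LINT s:{0..t}|lborel. a i s * (c1 * XS i s \<omega> + c2 * Y i s \<omega>) - (c1 + c2) * \<theta> s \<omega> $ i) + c1 * I t \<omega> $ i"
proof -
  have "lin_process (a i) (c1 * x $ i) (\<lambda>t \<omega>. c1 * u t \<omega> $ i + c2 * u t \<omega> $ i) (\<lambda>t \<omega>. c1 * I t \<omega> $ i)
      (\<lambda>t \<omega>. c1 * XS i t \<omega> + c2 * Y i t \<omega>)"
    by (rule lin_process_combine[OF a_cont state_lin_process(1)[OF I u_H2] u_H2 Y_ode])
  then have "AE \<omega> in M. \<forall>t\<in>{0..T}. c1 * XS i t \<omega> + c2 * Y i t \<omega> = c1 * x $ i +
      (LINT s:{0..t}|lborel. a i s * (c1 * XS i s \<omega> + c2 * Y i s \<omega>) + (c1 * u s \<omega> $ i + c2 * u s \<omega> $ i)) + c1 * I t \<omega> $ i"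
    by (simp add: lin_process_def)
  then show ?thesis
    using u_feedback_AE(1)[of i] H2_paths[OF u_H2[of i]] AE_space
  proof eventually_elim
    case (elim \<omega>)
    have ae: "AE s in lborel. s \<in> {0..T} \<longrightarrow> u s \<omega> $ i = - \<theta> s \<omega> $ i"
      using elim(2) by (subst (asm) AE_restrict_space_iff) auto
    show ?case
    proof
      fix t assume t: "t \<in> {0..T}"
      have c: "set_integrable lborel {0..T} (\<lambda>s. a i s * (c1 * XS i s \<omega> + c2 * Y i s \<omega>))"
        using L2cont_path[OF L2cont_combine[OF XS_L2cont Y_L2cont] elim(4)]
        by (intro set_integrable_mult_continuous continuous_set_integrable a_cont)
      have m: "set_borel_measurable lborel {0..T} (\<lambda>s. a i s * (c1 * XS i s \<omega> + c2 * Y i s \<omega>) + (c1 * u s \<omega> $ i + c2 * u s \<omega> $ i))"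
        "set_borel_measurable lborel {0..T} (\<lambda>s. a i s * (c1 * XS i s \<omega> + c2 * Y i s \<omega>) - (c1 + c2) * \<theta> s \<omega> $ i)"
      proof -
        have "set_integrable lborel {0..T} (\<lambda>s. a i s * (c1 * XS i s \<omega> + c2 * Y i s \<omega>) + (c1 * u s \<omega> $ i + c2 * u s \<omega> $ i))"
          using elim(3) by (intro set_integral_add(1)[OF c] set_integral_add(1) set_integrable_mult_right) auto
        then show "set_borel_measurable lborel {0..T} (\<lambda>s. a i s * (c1 * XS i s \<omega> + c2 * Y i s \<omega>) + (c1 * u s \<omega> $ i + c2 * u s \<omega> $ i))"
          unfolding set_integrable_def set_borel_measurable_def by (rule borel_measurable_integrable)
        have "set_integrable lborel {0..T} (\<lambda>s. a i s * (c1 * XS i s \<omega> + c2 * Y i s \<omega>) - (c1 + c2) * \<theta> s \<omega> $ i)"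
          by (intro set_integral_diff(1)[OF c] set_integrable_mult_right continuous_set_integrable L2cont_path[OF \<theta>_L2cont elim(4)])
        then show "set_borel_measurable lborel {0..T} (\<lambda>s. a i s * (c1 * XS i s \<omega> + c2 * Y i s \<omega>) - (c1 + c2) * \<theta> s \<omega> $ i)"
          unfolding set_integrable_def set_borel_measurable_def by (rule borel_measurable_integrable)
      qed
      have "(LINT s:{0..t}|lborel. a i s * (c1 * XS i s \<omega> + c2 * Y i s \<omega>) + (c1 * u s \<omega> $ i + c2 * u s \<omega> $ i)) =
          (LINT s:{0..t}|lborel. a i s * (c1 * XS i s \<omega> + c2 * Y i s \<omega>) - (c1 + c2) * \<theta> s \<omega> $ i)"
        unfolding set_lebesgue_integral_def
      proof (rule integral_cong_AE)
        show "AE s in lborel. indicator {0..t} s *\<^sub>R (a i s * (c1 * XS i s \<omega> + c2 * Y i s \<omega>) + (c1 * u s \<omega> $ i + c2 * u s \<omega> $ i)) =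
            indicator {0..t} s *\<^sub>R (a i s * (c1 * XS i s \<omega> + c2 * Y i s \<omega>) - (c1 + c2) * \<theta> s \<omega> $ i)"
          using ae
        proof eventually_elim
          case (elim s)
          show ?case
          proof (cases "s \<in> {0..t}")
            case True
            then have "u s \<omega> $ i = - \<theta> s \<omega> $ i" using elim t by auto
            then show ?thesis by (simp add: algebra_simps)
          qed simp
        qed
        note sub = set_borel_measurable_subset[of lborel "{0..T}" _ "{0..t}", unfolded set_borel_measurable_def[of _ "{0..t}"]]
        show "(\<lambda>s. indicator {0..t} s *\<^sub>R (a i s * (c1 * XS i s \<omega> + c2 * Y i s \<omega>) + (c1 * u s \<omega> $ i + c2 * u s \<omega> $ i))) \<in> borel_measurable lborel"
          using t by (intro sub[OF m(1)]) auto
        show "(\<lambda>s. indicator {0..t} s *\<^sub>R (a i s * (c1 * XS i s \<omega> + c2 * Y i s \<omega>) - (c1 + c2) * \<theta> s \<omega> $ i)) \<in> borel_measurable lborel"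
          using t by (intro sub[OF m(2)]) auto
      qed
      then show "c1 * XS i t \<omega> + c2 * Y i t \<omega> =
        c1 * x $ i + (LINT s:{0..t}|lborel. a i s * (c1 * XS i s \<omega> + c2 * Y i s \<omega>) - (c1 + c2) * \<theta> s \<omega> $ i) + c1 * I t \<omega> $ i"
        using elim(1) t by simp
    qed
  qed
qed

text \<open>The coefficients 1, 0, 1/2, 0 of the state X in the four blocks of \<open>F\<close>; the
  part Y carries no noise.\<close>

definition Enoise :: "real ^ 'n ^ (('n + 'n) + ('n + 'n))" where
  "Enoise = vcat (vcat (mat 1) 0) (vcat ((1/2) *\<^sub>R mat 1) 0)"

lemma Enoise_mult:
  "Enoise ** diagm (\<lambda>i. \<sigma> i t) = vcat (matSigma \<sigma> t) ((1/2) *\<^sub>R matSigma \<sigma> t)"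
  "(Enoise *v v) $ Inl (Inl i) = v $ i" "(Enoise *v v) $ Inl (Inr i) = 0"
  "(Enoise *v v) $ Inr (Inl i) = 1/2 * v $ i" "(Enoise *v v) $ Inr (Inr i) = 0"
proof -
  have v: "(Enoise *v v) $ Inl (Inl i) = (mat 1 *v v) $ i" "(Enoise *v v) $ Inl (Inr i) = (0 *v v) $ i"
    "(Enoise *v v) $ Inr (Inl i) = (((1/2) *\<^sub>R mat 1) *v v) $ i" "(Enoise *v v) $ Inr (Inr i) = (0 *v v) $ i" for v i
    by (simp_all add: Enoise_def matrix_vector_mult_def)
  then show *: "(Enoise *v v) $ Inl (Inl i) = v $ i" "(Enoise *v v) $ Inl (Inr i) = 0"
    "(Enoise *v v) $ Inr (Inl i) = 1/2 * v $ i" "(Enoise *v v) $ Inr (Inr i) = 0" for v i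
    by (simp_all add: scaleR_matrix_vector_assoc[symmetric])
  show "Enoise ** diagm (\<lambda>i. \<sigma> i t) = vcat (matSigma \<sigma> t) ((1/2) *\<^sub>R matSigma \<sigma> t)"
    unfolding vec_eq_iff[where 'b="('n + 'n) + ('n + 'n)"]
  proof
    fix k :: "('n + 'n) + ('n + 'n)"
    consider i where "k = Inl (Inl i)" | i where "k = Inl (Inr i)" | i where "k = Inr (Inl i)" | i where "k = Inr (Inr i)"
      by (cases k; metis sum.exhaust)
    then show "(Enoise ** diagm (\<lambda>i. \<sigma> i t)) $ k = vcat (matSigma \<sigma> t) ((1/2) *\<^sub>R matSigma \<sigma> t) $ k"
      by cases (simp_all add: vec_eq_iff matrix_mult_nth * matSigma_def column_def)
  qed
qed

lemma F_equation:
  assumes I: "wiener_integral (\<lambda>t. diagm (\<lambda>i. \<sigma> i t)) I"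
  shows "AE \<omega> in M. \<forall>t\<in>{0..T}. F t \<omega> $ k = vcat (vcat x 0) ((1/2) *\<^sub>R vcat x (0 :: real ^ 'n)) $ k +
    (LINT s:{0..t}|lborel. bF s \<omega> $ k) + (Enoise *v I t \<omega>) $ k"
proof -
  consider i where "k = Inl (Inl i)" | i where "k = Inl (Inr i)" | i where "k = Inr (Inl i)" | i where "k = Inr (Inr i)"
    by (cases k; metis sum.exhaust)
  then show ?thesis
  proof cases
    case 1 then show ?thesis using combined_equation[OF I, of 1 i "-1/2"] by (simp add: bF_nth Enoise_mult)
  next
    case 2 then show ?thesis using combined_equation[OF I, of 0 i 1] by (simp add: bF_nth Enoise_mult)
  next
    case 3 then show ?thesis using combined_equation[OF I, of "1/2" i "-1/6"] by (simp add: bF_nth Enoise_mult)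
  next
    case 4 then show ?thesis using combined_equation[OF I, of 0 i "1/2"] by (simp add: bF_nth Enoise_mult)
  qed
qed

lemma continuous_on_noise: "continuous_on {0..T} (\<lambda>t. vcat (matSigma \<sigma> t) ((1/2) *\<^sub>R matSigma \<sigma> t))"
proof (rule continuous_on_vecI)
  show "continuous_on {0..T} (\<lambda>t. vcat (matSigma \<sigma> t) ((1/2) *\<^sub>R matSigma \<sigma> t) $ k)" for k
    by (cases k) (simp_all, (intro continuous_intros continuous_on_component continuous_on_matSigma)+)
qed

lemma F_sde:
  "sde_solution M T FW W
     (\<lambda>t \<omega> y. (matAA a t - transpose Itilde ** matK M0 M1 t) *v y - transpose Itilde *v (Itilde *v M2 t))
     (\<lambda>t. vcat (matSigma \<sigma> t) ((1/2) *\<^sub>R matSigma \<sigma> t))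
     (vcat (vcat x 0) ((1/2) *\<^sub>R vcat x 0)) F"
proof -
  obtain I where I: "wiener_integral (\<lambda>t. diagm (\<lambda>i. \<sigma> i t)) I" using noise_exists by blast
  have J: "wiener_integral (\<lambda>t. vcat (matSigma \<sigma> t) ((1/2) *\<^sub>R matSigma \<sigma> t)) (\<lambda>t \<omega>. Enoise *v I t \<omega>)"
    using wiener_integral_linear[OF I, of Enoise] by (simp only: Enoise_mult(1))
  show ?thesis
  proof (rule sde_solutionI[OF continuous_on_noise J F_L2cont], fold bF_def)
    show "AE \<omega> in M. set_integrable lborel {0..T} (\<lambda>s. bF s \<omega> $ k)" for k
      using H2_paths[OF L2cont_H2[OF bF_L2cont[of k]]] by eventually_elim simp
    show "AE \<omega> in M. \<forall>t\<in>{0..T}. F t \<omega> $ k = vcat (vcat x 0) ((1/2) *\<^sub>R vcat x (0 :: real ^ 'n)) $ k +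
        (LINT s:{0..t}|lborel. bF s \<omega> $ k) + (Enoise *v I t \<omega>) $ k" for k
      by (rule F_equation[OF I])
  qed
qed

end

section \<open>First order condition and the equilibrium\<close>

context brownian
begin

lemma H2_norm_le_square: "X \<in> H2 \<Longrightarrow> H2_norm M T X \<le> L \<Longrightarrow> (\<integral>z. (X (snd z) (fst z))\<^sup>2 \<partial>P) \<le> L\<^sup>2"
  unfolding H2_iff(2)[OF H2D(1), symmetric] by (intro power_mono) (simp_all add: H2_norm_def)

lemma L2cont_integral_le:
  assumes X: "L2cont X" and C: "0 \<le> C" and le: "\<And>t. t \<in> {0..T} \<Longrightarrow> (\<integral>\<^sup>+ \<omega>. ennreal ((X t \<omega>)\<^sup>2) \<partial>M) \<le> ennreal C"
  shows "(\<integral>z. (X (snd z) (fst z))\<^sup>2 \<partial>P) \<le> C * T"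
proof -
  interpret pair_sigma_finite M "lborel_on T" by (rule pair_P)
  note H = H2D[OF L2cont_H2[OF X]]
  have m: "(\<lambda>z. ennreal ((X (snd z) (fst z))\<^sup>2)) \<in> borel_measurable P" using H(2) by measurable
  have "ennreal (\<integral>z. (X (snd z) (fst z))\<^sup>2 \<partial>P) = (\<integral>\<^sup>+ z. ennreal ((X (snd z) (fst z))\<^sup>2) \<partial>P)"
    using nn_integral_eq_integral[OF H(3)] by simp
  also have "\<dots> = (\<integral>\<^sup>+ t. (\<integral>\<^sup>+ \<omega>. ennreal ((X t \<omega>)\<^sup>2) \<partial>M) \<partial>lborel_on T)"
    using nn_integral_snd[OF m] by simp
  also have "\<dots> \<le> (\<integral>\<^sup>+ t. ennreal C \<partial>lborel_on T)"
    by (intro nn_integral_mono le) simp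
  also have "\<dots> = ennreal (C * T)"
    using C T_pos by (simp add: emeasure_restrict_space ennreal_mult)
  finally show ?thesis using C T_pos by (simp add: ennreal_le_iff)
qed

end

section \<open>The cost under a unilateral deviation\<close>

context lq_setting
begin

lemma ode_process_uniform_bound:
  "\<exists>B\<ge>0. \<forall>i h y. h \<in> H2 \<and> ode_process (a i) h y \<longrightarrow> (\<integral>z. (y (snd z) (fst z))\<^sup>2 \<partial>P) \<le> B * (\<integral>z. (h (snd z) (fst z))\<^sup>2 \<partial>P)"
proof -
  obtain B where B: "\<And>i. 0 \<le> B i" "\<And>i h y t. h \<in> H2 \<Longrightarrow> ode_process (a i) h y \<Longrightarrow> t \<in> {0..T} \<Longrightarrow>
      (\<integral>\<^sup>+ \<omega>. ennreal ((y t \<omega>)\<^sup>2) \<partial>M) \<le> ennreal (B i * (H2_norm M T h)\<^sup>2)"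
    using ode_process_bound[OF a_cont] by metis
  \<comment> \<open>The constant must serve all players: the sum over the finite player set
    dominates each \<open>B i\<close>. The factor T integrates a bound that is uniform in
    time.\<close>
  have "(\<integral>z. (y (snd z) (fst z))\<^sup>2 \<partial>P) \<le> ((\<Sum>i\<in>UNIV. B i) * T) * (\<integral>z. (h (snd z) (fst z))\<^sup>2 \<partial>P)"
    if h: "h \<in> H2" and y: "ode_process (a i) h y" for i h y
  proof -
    have nn: "0 \<le> (\<integral>z. (h (snd z) (fst z))\<^sup>2 \<partial>P)" by simp
    have "(\<integral>z. (y (snd z) (fst z))\<^sup>2 \<partial>P) \<le> (B i * (H2_norm M T h)\<^sup>2) * T"
      using B(1) by (intro L2cont_integral_le ode_process_L2cont[OF a_cont h y] B(2)[OF h y]) auto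
    also have "\<dots> = (B i * T) * (\<integral>z. (h (snd z) (fst z))\<^sup>2 \<partial>P)"
      using H2_iff(2)[OF H2D(1)[OF h] h] by simp
    also have "\<dots> \<le> ((\<Sum>i\<in>UNIV. B i) * T) * (\<integral>z. (h (snd z) (fst z))\<^sup>2 \<partial>P)"
      using B(1) T_pos nn by (intro mult_right_mono) (auto intro: member_le_sum)
    finally show ?thesis .
  qed
  moreover have "0 \<le> (\<Sum>i\<in>UNIV. B i) * T" using B(1) T_pos by (simp add: sum_nonneg)
  ultimately show ?thesis by blast
qed

text \<open>Moves the running cost onto the product measure \<open>P\<close>, where two controls can
  be compared almost everywhere; only the terminal term remains an expectation.\<close>

lemma cost_eq:
  fixes u :: "real \<Rightarrow> 'w \<Rightarrow> real ^ 'n"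
  assumes X: "\<And>i. L2cont (\<lambda>t \<omega>. state M T W a \<sigma> x u t \<omega> $ i)" and u: "\<And>i. (\<lambda>t \<omega>. u t \<omega> $ i) \<in> H2"
  defines "X \<equiv> state M T W a \<sigma> x u"
  shows "cost M T W a \<sigma> x q \<gamma> d i u =
      (\<integral>z. (u (snd z) (fst z) $ i)\<^sup>2 + 1 / real CARD('n) * (\<Sum>j\<in>UNIV. q i j * (X (snd z) (fst z) $ i - X (snd z) (fst z) $ j)\<^sup>2) \<partial>P) +
      \<gamma> i * expectation (\<lambda>\<omega>. (X T \<omega> $ i - d i)\<^sup>2)"
    and "integrable P (\<lambda>z. (u (snd z) (fst z) $ i)\<^sup>2 + 1 / real CARD('n) * (\<Sum>j\<in>UNIV. q i j * (X (snd z) (fst z) $ i - X (snd z) (fst z) $ j)\<^sup>2))"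
    and "integrable M (\<lambda>\<omega>. (X T \<omega> $ i - d i)\<^sup>2)"
proof -
  have T: "T \<in> {0..T}" using T_pos by simp
  have D: "(\<lambda>t \<omega>. X t \<omega> $ i - X t \<omega> $ j) \<in> H2" for j
    unfolding X_def by (intro H2_diff L2cont_H2 X)
  show iP: "integrable P (\<lambda>z. (u (snd z) (fst z) $ i)\<^sup>2 + 1 / real CARD('n) * (\<Sum>j\<in>UNIV. q i j * (X (snd z) (fst z) $ i - X (snd z) (fst z) $ j)\<^sup>2))"
    by (intro Bochner_Integration.integrable_add integrable_mult_right Bochner_Integration.integrable_sum
        H2D(3)[OF u] H2D(3)[OF D])
  have "L2cont (\<lambda>t \<omega>. X t \<omega> $ i + - d i)"
    unfolding X_def by (intro L2cont_add X L2cont_continuous continuous_on_const)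
  from L2contD(3)[OF this T] show iM: "integrable M (\<lambda>\<omega>. (X T \<omega> $ i - d i)\<^sup>2)" by simp
  have h1: "has_bochner_integral M (\<lambda>\<omega>. LINT s:{0..T}|lborel. (u s \<omega> $ i)\<^sup>2 + 1 / real CARD('n) * (\<Sum>j\<in>UNIV. q i j * (X s \<omega> $ i - X s \<omega> $ j)\<^sup>2))
      (\<integral>z. (u (snd z) (fst z) $ i)\<^sup>2 + 1 / real CARD('n) * (\<Sum>j\<in>UNIV. q i j * (X (snd z) (fst z) $ i - X (snd z) (fst z) $ j)\<^sup>2) \<partial>P)"
    by (rule has_bochner_integral_LINT) (rule iP)
  have h2: "has_bochner_integral M (\<lambda>\<omega>. \<gamma> i * (X T \<omega> $ i - d i)\<^sup>2) (\<gamma> i * expectation (\<lambda>\<omega>. (X T \<omega> $ i - d i)\<^sup>2))"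
    by (intro has_bochner_integral_mult_right has_bochner_integral_integrable iM)
  show "cost M T W a \<sigma> x q \<gamma> d i u =
      (\<integral>z. (u (snd z) (fst z) $ i)\<^sup>2 + 1 / real CARD('n) * (\<Sum>j\<in>UNIV. q i j * (X (snd z) (fst z) $ i - X (snd z) (fst z) $ j)\<^sup>2) \<partial>P) +
      \<gamma> i * expectation (\<lambda>\<omega>. (X T \<omega> $ i - d i)\<^sup>2)"
    using has_bochner_integral_integral_eq[OF has_bochner_integral_add[OF h1 h2]]
    by (simp add: cost_def Let_def X_def)
qed

text \<open>Convexity in the form of a tangent inequality. The discarded terms are squares with
  weights 1, q_ij / N and gamma_i, which is where the signs of the coefficients enter. The other
  players' states do not move, because each state depends on its own control only.\<close>

lemma cost_deviation:
  fixes u :: "real \<Rightarrow> 'w \<Rightarrow> real ^ 'n"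
  assumes I: "wiener_integral (\<lambda>t. diagm (\<lambda>i. \<sigma> i t)) I" and u: "\<And>i. (\<lambda>t \<omega>. u t \<omega> $ i) \<in> H2" and v: "v \<in> H2"
    and q: "\<And>j. 0 \<le> q i j" and \<gamma>: "0 \<le> \<gamma> i"
  defines "X \<equiv> state M T W a \<sigma> x u"
  obtains y where "ode_process (a i) (\<lambda>t \<omega>. v t \<omega> - u t \<omega> $ i) y"
    "cost M T W a \<sigma> x q \<gamma> d i u +
      2 * (\<integral>z. (v (snd z) (fst z) - u (snd z) (fst z) $ i) * u (snd z) (fst z) $ i +
        y (snd z) (fst z) * (matQtilde q *v X (snd z) (fst z)) $ i \<partial>P) +
      2 * (\<gamma> i * expectation (\<lambda>\<omega>. y T \<omega> * (X T \<omega> $ i - d i)))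
      \<le> cost M T W a \<sigma> x q \<gamma> d i (deviate u i v)"
proof -
  let ?u' = "deviate u i v"
  define X' where "X' = state M T W a \<sigma> x ?u'"
  have T: "T \<in> {0..T}" using T_pos by simp
  have u'i: "(\<lambda>t \<omega>. ?u' t \<omega> $ i) = v" and u'j: "j \<noteq> i \<Longrightarrow> (\<lambda>t \<omega>. ?u' t \<omega> $ j) = (\<lambda>t \<omega>. u t \<omega> $ j)" for j
    by (simp_all add: deviate_def)
  have u': "(\<lambda>t \<omega>. ?u' t \<omega> $ j) \<in> H2" for j
    using v u[of j] u'i u'j[of j] by (cases "j = i") auto
  note sX = state_lin_process[OF I u, folded X_def] and sX' = state_lin_process[OF I u', folded X'_def]
  define y where "y t \<omega> = X' t \<omega> $ i - X t \<omega> $ i" for t \<omega>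
  have y: "ode_process (a i) (\<lambda>t \<omega>. v t \<omega> - u t \<omega> $ i) y"
    using lin_process_diff[OF a_cont sX'(1)[of i] sX(1)[of i]] unfolding y_def using u'i by (simp add: fun_eq_iff)
  have yL: "L2cont y" by (rule ode_process_L2cont[OF a_cont H2_diff[OF v u] y])
  \<comment> \<open>\<open>state\<close> is chosen separately for the two control profiles, so the
    unaffected components agree only up to a null set.\<close>
  have same: "AE z in P. X' (snd z) (fst z) $ j = X (snd z) (fst z) $ j" if "j \<noteq> i" for j
  proof (rule AE_path_of_AE(2)[OF L2cont_H2[OF sX'(2)] L2cont_H2[OF sX(2)]])
    fix t assume t: "t \<in> {0..T}"
    have "lin_process (a j) (x $ j) (\<lambda>t \<omega>. u t \<omega> $ j) (\<lambda>t \<omega>. I t \<omega> $ j) (\<lambda>t \<omega>. X' t \<omega> $ j)"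
      using sX'(1)[of j] by (simp only: u'j[OF that])
    from lin_process_unique[OF a_cont this sX(1)]
    show "AE \<omega> in M. X' t \<omega> $ j = X t \<omega> $ j" by eventually_elim (use t in simp)
  qed
  note c1 = cost_eq(1)[where u="u" and q=q and i=i and \<gamma>=\<gamma> and d=d, folded X_def, OF sX(2) u]
  note c2 = cost_eq(2)[where u="u" and q=q and i=i, folded X_def, OF sX(2) u]
  note c3 = cost_eq(3)[where u="u" and i=i and d=d, folded X_def, OF sX(2) u]
  note c'1 = cost_eq(1)[where u="?u'" and q=q and i=i and \<gamma>=\<gamma> and d=d, folded X'_def, OF sX'(2) u']
  note c'2 = cost_eq(2)[where u="?u'" and q=q and i=i, folded X'_def, OF sX'(2) u']
  note c'3 = cost_eq(3)[where u="?u'" and i=i and d=d, folded X'_def, OF sX'(2) u']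
  let ?N = "real CARD('n)"
  let ?f = "\<lambda>u X z. (u (snd z) (fst z) $ i)\<^sup>2 + 1 / ?N * (\<Sum>j\<in>UNIV. q i j * (X (snd z) (fst z) $ i - X (snd z) (fst z) $ j)\<^sup>2)"
  let ?g = "\<lambda>z. (v (snd z) (fst z) - u (snd z) (fst z) $ i) * u (snd z) (fst z) $ i +
        y (snd z) (fst z) * (matQtilde q *v X (snd z) (fst z)) $ i"
  have QX: "(\<lambda>t \<omega>. (matQtilde q *v X t \<omega>) $ i) \<in> H2"
    unfolding matrix_vector_mult_def vec_lambda_beta by (intro H2_sum H2_cmult L2cont_H2 sX)
  have gi: "integrable P ?g"
    by (intro Bochner_Integration.integrable_add H2_mult_integrable H2_diff v u L2cont_H2[OF yL] QX)
  have "(\<integral>z. ?f u X z + 2 * ?g z \<partial>P) \<le> (\<integral>z. ?f ?u' X' z \<partial>P)"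
  proof (rule integral_mono_AE)
    show "integrable P (\<lambda>z. ?f u X z + 2 * ?g z)"
      by (intro Bochner_Integration.integrable_add[OF c2] integrable_mult_right gi)
    show "integrable P (?f ?u' X')" by (rule c'2)
    have "AE z in P. \<forall>j. j \<noteq> i \<longrightarrow> X' (snd z) (fst z) $ j = X (snd z) (fst z) $ j"
      using same by (subst AE_all_countable) auto
    then show "AE z in P. ?f u X z + 2 * ?g z \<le> ?f ?u' X' z"
    proof eventually_elim
      case (elim z)
      let ?x = "X (snd z) (fst z)" and ?x' = "X' (snd z) (fst z)" and ?y = "y (snd z) (fst z)"
        and ?ui = "u (snd z) (fst z) $ i" and ?v = "v (snd z) (fst z)"
      have y': "?x' $ i = ?x $ i + ?y" by (simp add: y_def)
      have "q i j * (?x $ i - ?x $ j)\<^sup>2 + 2 * (?y * (q i j * (?x $ i - ?x $ j))) \<le> q i j * (?x' $ i - ?x' $ j)\<^sup>2" for j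
      proof (cases "j = i")
        case False
        then have e: "?x' $ i - ?x' $ j = (?x $ i - ?x $ j) + ?y" using elim y' by simp
        have "q i j * (?x' $ i - ?x' $ j)\<^sup>2 = q i j * (?x $ i - ?x $ j)\<^sup>2 + 2 * (?y * (q i j * (?x $ i - ?x $ j))) + q i j * ?y\<^sup>2"
          unfolding e power2_sum by (simp add: algebra_simps)
        then show ?thesis using q[of j] by simp
      qed simp
      then have "(\<Sum>j\<in>UNIV. q i j * (?x $ i - ?x $ j)\<^sup>2 + 2 * (?y * (q i j * (?x $ i - ?x $ j)))) \<le> (\<Sum>j\<in>UNIV. q i j * (?x' $ i - ?x' $ j)\<^sup>2)"
        by (intro sum_mono)
      then have "(\<Sum>j\<in>UNIV. q i j * (?x $ i - ?x $ j)\<^sup>2) + 2 * (?y * (\<Sum>j\<in>UNIV. q i j * (?x $ i - ?x $ j)))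
          \<le> (\<Sum>j\<in>UNIV. q i j * (?x' $ i - ?x' $ j)\<^sup>2)"
        by (simp add: sum.distrib sum_distrib_left)
      then have "1 / ?N * ((\<Sum>j\<in>UNIV. q i j * (?x $ i - ?x $ j)\<^sup>2) + 2 * (?y * (\<Sum>j\<in>UNIV. q i j * (?x $ i - ?x $ j))))
          \<le> 1 / ?N * (\<Sum>j\<in>UNIV. q i j * (?x' $ i - ?x' $ j)\<^sup>2)"
        by (rule mult_left_mono) simp
      moreover have "?ui\<^sup>2 + 2 * ((?v - ?ui) * ?ui) \<le> ?v\<^sup>2"
        using zero_le_power2[of "?v - ?ui"] by (simp add: power2_eq_square algebra_simps)
      moreover have "?u' (snd z) (fst z) $ i = ?v" by (simp add: deviate_def)
      ultimately show ?case
        by (simp add: matQtilde_mult_vec(1) distrib_left)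
    qed
  qed
  then have 1: "(\<integral>z. ?f u X z \<partial>P) + 2 * (\<integral>z. ?g z \<partial>P) \<le> (\<integral>z. ?f ?u' X' z \<partial>P)"
    using Bochner_Integration.integral_add[OF c2 integrable_mult_right[OF gi, of 2]]
    by (simp only: integral_mult_right_zero)
  have yXi: "integrable M (\<lambda>\<omega>. y T \<omega> * (X T \<omega> $ i - d i))"
  proof (rule integrable_mult_square[OF _ _ _ c3])
    show "y T \<in> borel_measurable M" "integrable M (\<lambda>\<omega>. (y T \<omega>)\<^sup>2)" by (rule L2contD[OF yL T])+
    show "(\<lambda>\<omega>. X T \<omega> $ i - d i) \<in> borel_measurable M" using L2contD(2)[OF sX(2)[of i] T] by measurable
  qed
  have "expectation (\<lambda>\<omega>. (X T \<omega> $ i - d i)\<^sup>2 + 2 * (y T \<omega> * (X T \<omega> $ i - d i))) \<le> expectation (\<lambda>\<omega>. (X' T \<omega> $ i - d i)\<^sup>2)"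
  proof (rule integral_mono)
    show "integrable M (\<lambda>\<omega>. (X T \<omega> $ i - d i)\<^sup>2 + 2 * (y T \<omega> * (X T \<omega> $ i - d i)))"
      by (intro Bochner_Integration.integrable_add[OF c3] integrable_mult_right yXi)
    show "(X T \<omega> $ i - d i)\<^sup>2 + 2 * (y T \<omega> * (X T \<omega> $ i - d i)) \<le> (X' T \<omega> $ i - d i)\<^sup>2" for \<omega>
      using zero_le_power2[of "y T \<omega>"] by (simp add: y_def power2_eq_square algebra_simps)
  qed (rule c'3)
  then have "expectation (\<lambda>\<omega>. (X T \<omega> $ i - d i)\<^sup>2) + 2 * expectation (\<lambda>\<omega>. y T \<omega> * (X T \<omega> $ i - d i)) \<le> expectation (\<lambda>\<omega>. (X' T \<omega> $ i - d i)\<^sup>2)"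
    using Bochner_Integration.integral_add[OF c3 integrable_mult_right[OF yXi, of 2]]
    by (simp only: integral_mult_right_zero)
  from mult_left_mono[OF this \<gamma>] 1 show ?thesis
    by (intro that[OF y]) (simp add: c1 c'1 distrib_left)
qed

end

section \<open>First order condition at the feedback control and the resulting gap\<close>

context lq_closed_loop
begin

text \<open>The component theta_i is the sum over k of K_ik F_k plus the deterministic term (Itilde
  M2)_i. Each summand is paired with y by \<open>product_expectation\<close>, and the drifts are
  then added up under the integral, where \<open>feedback_drift\<close> applies.\<close>

lemma first_order_condition:
  assumes h: "h \<in> H2" and y: "ode_process (a i) h y"
  shows "\<gamma> i * expectation (\<lambda>\<omega>. y T \<omega> * (XS i T \<omega> - d i)) +
    (\<integral>z. h (snd z) (fst z) * u (snd z) (fst z) $ i + y (snd z) (fst z) *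
      (matQtilde q *v (\<chi> k. F (snd z) (fst z) $ Inl (Inl k)) + transpose (matQtilde q) *v (\<chi> k. F (snd z) (fst z) $ Inr (Inr k))) $ i \<partial>P) = 0"
proof -
  have T: "T \<in> {0..T}" using T_pos by simp
  obtain I where I: "wiener_integral (\<lambda>t. diagm (\<lambda>i. \<sigma> i t)) I" using noise_exists by blast
  obtain M0' where M0': "C1_deriv T M0 M0'"
    "\<And>t. t \<in> {0..T} \<Longrightarrow> M0' t + transpose (matA a t) ** M0 t + M0 t ** matA a t + matQ q = 0"
    using M0 unfolding M0_equation_def by blast
  obtain M1' where M1': "C1_deriv T M1 M1'" "\<And>t. t \<in> {0..T} \<Longrightarrow> M1' t + matAA a t ** M1 t + M1 t ** matAA a t
      - transpose (matK M0 M1 t) ** matK M0 M1 t = 0"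
    using M1 unfolding M1_equation_def by blast
  obtain M2' where M2': "C1_deriv T M2 M2'" "\<And>t. t \<in> {0..T} \<Longrightarrow> M2' t + matAA a t *v M2 t
      - transpose (matK M0 M1 t) *v (Itilde *v M2 t) = 0"
    using M2 unfolding M2_equation_def by blast
  note C1 = M0'(1)[unfolded C1_deriv_def] M1'(1)[unfolded C1_deriv_def] M2'(1)[unfolded C1_deriv_def]
  have sym: "transpose (M0 t) = M0 t" "transpose (M1 t) = M1 t" if "t \<in> {0..T}" for t
    using M0 M1 that unfolding M0_equation_def M1_equation_def by blast+
  have terminal: "M0 T = matQbar \<gamma>" "M1 T = 0" "M2 T = vcat (vecp \<gamma> d) 0"
    using M0 M1 M2 unfolding M0_equation_def M1_equation_def M2_equation_def by blast+
  have yL: "L2cont y" by (rule ode_process_L2cont[OF a_cont h y])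
  define y' where "y' t \<omega> = a i t * y t \<omega> + h t \<omega>" for t \<omega>
  have y'H: "y' \<in> H2" unfolding y'_def by (intro H2_add H2_mult_continuous L2cont_H2 yL a_cont h)
  have yeq: "AE \<omega> in M. \<forall>t\<in>{0..T}. y t \<omega> = (LINT s:{0..t}|lborel. y' s \<omega>)"
    unfolding y'_def by (rule ode_process_eq[OF a_cont h y])
  let ?J = "\<lambda>t \<omega>. Enoise *v I t \<omega>"
  have J: "wiener_integral (\<lambda>t. vcat (matSigma \<sigma> t) ((1/2) *\<^sub>R matSigma \<sigma> t)) ?J"
    using wiener_integral_linear[OF I, of Enoise] by (simp only: Enoise_mult(1))
  have Jc: "continuous_on {0..T} (\<lambda>t. vcat (matSigma \<sigma> t) ((1/2) *\<^sub>R matSigma \<sigma> t))"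
    by (rule continuous_on_noise)
  let ?K = "\<lambda>k t. matK M0 M1 t $ i $ k" and ?K' = "\<lambda>k t. matK M0' M1' t $ i $ k"
  let ?m = "\<lambda>t. (Itilde *v M2 t) $ i" and ?m' = "\<lambda>t. (Itilde *v M2' t) $ i"
  have Kc: "continuous_on {0..T} (?K k)" "continuous_on {0..T} (?K' k)" for k
    using C1 by (auto intro!: continuous_on_matK matrices_continuous)
  have mc: "continuous_on {0..T} ?m" "continuous_on {0..T} ?m'"
    unfolding Itilde_mult_vec using C1 by (intro continuous_intros continuous_on_component matrices_continuous; simp)+
  let ?A = "\<lambda>k z. (?K k (snd z) * y' (snd z) (fst z) + ?K' k (snd z) * y (snd z) (fst z)) * F (snd z) (fst z) $ k +
      (?K k (snd z) * y (snd z) (fst z)) * bF (snd z) (fst z) $ k"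
  \<comment> \<open>The deterministic summand of theta is handled as a coefficient times the process
    constantly 1, with zero drift and zero noise; the factors 1 and 0 keep the shape of
    \<open>product_expectation\<close>.\<close>
  let ?B = "\<lambda>z. (?m (snd z) * y' (snd z) (fst z) + ?m' (snd z) * y (snd z) (fst z)) * 1 + (?m (snd z) * y (snd z) (fst z)) * 0"
  have A: "has_bochner_integral M (\<lambda>\<omega>. y T \<omega> * (?K k T * F T \<omega> $ k)) (\<integral>z. ?A k z \<partial>P)" for k
  proof (rule product_expectation[OF yL y'H yeq Kc(2) _ F_L2cont L2cont_H2[OF bF_L2cont] F_equation[OF I] wiener_integral_L2cont[OF J Jc]])
    show "(?K k has_vector_derivative ?K' k t) (at t within {0..T})" if "t \<in> {0..T}" for t
      using C1 that by (intro matK_has_vector_derivative) auto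
    show "expectation (\<lambda>\<omega>. Q \<omega> * ?J T \<omega> $ k) = expectation (\<lambda>\<omega>. Q \<omega> * ?J s \<omega> $ k)"
      if "s \<in> {0..T}" "Q \<in> borel_measurable (FW s)" "integrable M (\<lambda>\<omega>. (Q \<omega>)\<^sup>2)" for s Q
      using that by (intro wiener_integral_orthogonal[OF J Jc]) auto
  qed
  have B: "has_bochner_integral M (\<lambda>\<omega>. y T \<omega> * (?m T * 1)) (\<integral>z. ?B z \<partial>P)"
  proof (rule product_expectation[OF yL y'H yeq mc(2) _ L2cont_continuous[OF continuous_on_const] H2_zero _ L2cont_continuous[OF continuous_on_const]])
    show "(?m has_vector_derivative ?m' t) (at t within {0..T})" if "t \<in> {0..T}" for t
      unfolding Itilde_mult_vec using C1 that
      by (intro has_vector_derivative_add has_vector_derivative_mult_right has_vector_derivative_vec_nth) auto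
    show "AE \<omega> in M. \<forall>t\<in>{0..T}. (1 :: real) = 1 + (LINT s:{0..t}|lborel. 0) + 0" by simp
  qed simp
  have Ai: "integrable P (?A k)" for k
  proof -
    have "integrable P (\<lambda>z. (?K k (snd z) * y' (snd z) (fst z) + ?K' k (snd z) * y (snd z) (fst z)) * F (snd z) (fst z) $ k)"
      by (intro H2_mult_integrable[of "\<lambda>t \<omega>. ?K k t * y' t \<omega> + ?K' k t * y t \<omega>"] H2_add H2_mult_continuous y'H L2cont_H2[OF yL] Kc L2cont_H2[OF F_L2cont])
    moreover have "integrable P (\<lambda>z. (?K k (snd z) * y (snd z) (fst z)) * bF (snd z) (fst z) $ k)"
      by (intro H2_mult_integrable[of "\<lambda>t \<omega>. ?K k t * y t \<omega>"] H2_mult_continuous L2cont_H2[OF yL] Kc L2cont_H2[OF bF_L2cont])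
    ultimately show ?thesis by (rule Bochner_Integration.integrable_add)
  qed
  have Bi: "integrable P ?B"
  proof -
    have "(\<lambda>t \<omega>. ?m t * y' t \<omega> + ?m' t * y t \<omega>) \<in> H2"
      by (intro H2_add H2_mult_continuous y'H L2cont_H2[OF yL] mc)
    from H2_mult_integrable[OF this H2_continuous[OF continuous_on_const[of _ 1]]] show ?thesis by simp
  qed
  have "has_bochner_integral M (\<lambda>\<omega>. (\<Sum>k\<in>UNIV. y T \<omega> * (?K k T * F T \<omega> $ k)) + y T \<omega> * (?m T * 1))
      ((\<Sum>k\<in>UNIV. \<integral>z. ?A k z \<partial>P) + (\<integral>z. ?B z \<partial>P))"
    by (intro has_bochner_integral_add has_bochner_integral_sum A B)
  moreover have "(\<Sum>k\<in>UNIV. y T \<omega> * (?K k T * F T \<omega> $ k)) + y T \<omega> * (?m T * 1) = \<gamma> i * (y T \<omega> * (XS i T \<omega> - d i))" for \<omega>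
  proof -
    have "(\<Sum>k\<in>UNIV. y T \<omega> * (?K k T * F T \<omega> $ k)) + y T \<omega> * (?m T * 1) = y T \<omega> * (matK M0 M1 T *v F T \<omega> + Itilde *v M2 T) $ i"
      by (simp only: vector_add_component matrix_vector_mult_def[of "matK _ _ _"] vec_lambda_beta sum_distrib_left distrib_left mult_1_right)
    also have "\<dots> = y T \<omega> * (\<gamma> i * (XS i T \<omega> - d i))"
      unfolding feedback_terminal[of M0 T \<gamma> M1 M2 d "F T \<omega>" i, OF terminal] by simp
    finally show ?thesis by simp
  qed
  moreover have "(\<Sum>k\<in>UNIV. \<integral>z. ?A k z \<partial>P) + (\<integral>z. ?B z \<partial>P) = (\<integral>z. (\<Sum>k\<in>UNIV. ?A k z) + ?B z \<partial>P)"
    using Ai Bi by (simp only: Bochner_Integration.integral_add Bochner_Integration.integral_sum Bochner_Integration.integrable_sum)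
  ultimately have "\<gamma> i * expectation (\<lambda>\<omega>. y T \<omega> * (XS i T \<omega> - d i)) = (\<integral>z. (\<Sum>k\<in>UNIV. ?A k z) + ?B z \<partial>P)"
    by (simp add: has_bochner_integral_iff)
  also have "\<dots> = (\<integral>z. - (h (snd z) (fst z) * u (snd z) (fst z) $ i + y (snd z) (fst z) *
      (matQtilde q *v (\<chi> k. F (snd z) (fst z) $ Inl (Inl k)) + transpose (matQtilde q) *v (\<chi> k. F (snd z) (fst z) $ Inr (Inr k))) $ i) \<partial>P)"
    (is "_ = (\<integral>z. - ?R z \<partial>P)")
  proof (rule integral_cong_AE)
    show "(\<lambda>z. (\<Sum>k\<in>UNIV. ?A k z) + ?B z) \<in> borel_measurable P"
      by (intro borel_measurable_integrable Bochner_Integration.integrable_add Bochner_Integration.integrable_sum Ai Bi)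
    have "(\<lambda>t \<omega>. (matQtilde q *v (\<chi> k. F t \<omega> $ Inl (Inl k)) + transpose (matQtilde q) *v (\<chi> k. F t \<omega> $ Inr (Inr k))) $ i) \<in> H2"
      unfolding vector_add_component matrix_vector_mult_def vec_lambda_beta
      by (intro H2_add H2_sum H2_cmult L2cont_H2 F_L2cont)
    then have "integrable P ?R"
      by (intro Bochner_Integration.integrable_add H2_mult_integrable h u_H2 L2cont_H2[OF yL])
    then show "(\<lambda>z. - ?R z) \<in> borel_measurable P" by (intro borel_measurable_uminus borel_measurable_integrable)
    show "AE z in P. (\<Sum>k\<in>UNIV. ?A k z) + ?B z = - ?R z"
      using u_feedback_AE(2)[of i] AE_space
    proof eventually_elim
      case (elim z)
      obtain \<omega> t where z: "z = (\<omega>, t)" by (cases z)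
      have t: "t \<in> {0..T}" using elim(2) by (simp add: z space_pair_measure)
      let ?D = "(matK M0' M1' t *v F t \<omega> + matK M0 M1 t *v bF t \<omega> + Itilde *v M2' t) $ i"
      have "(\<Sum>k\<in>UNIV. ?A k z) + ?B z = (\<Sum>k\<in>UNIV. y' t \<omega> * (?K k t * F t \<omega> $ k)) + y' t \<omega> * ?m t +
          ((\<Sum>k\<in>UNIV. y t \<omega> * (?K' k t * F t \<omega> $ k)) + (\<Sum>k\<in>UNIV. y t \<omega> * (?K k t * bF t \<omega> $ k)) + y t \<omega> * ?m' t)"
        unfolding z fst_conv snd_conv by (simp only: sum.distrib[symmetric] add.assoc[symmetric]) (simp add: sum.distrib algebra_simps)
      also have "\<dots> = y' t \<omega> * \<theta> t \<omega> $ i + y t \<omega> * ?D"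
        unfolding \<theta>_def by (simp only: vector_add_component matrix_vector_mult_def[of "matK _ _ _"] vec_lambda_beta sum_distrib_left distrib_left)
      also have "?D = - (a i t * \<theta> t \<omega> $ i) - (matQtilde q *v (\<chi> k. F t \<omega> $ Inl (Inl k)) + transpose (matQtilde q) *v (\<chi> k. F t \<omega> $ Inr (Inr k))) $ i"
        by (rule feedback_drift[of M0 t M1 M0' a q M1' M2' M2 "\<theta> t \<omega>" "F t \<omega>" "bF t \<omega>" i,
              OF sym(1)[OF t] sym(2)[OF t] M0'(2)[OF t] M1'(2)[OF t] M2'(2)[OF t] \<theta>_def bF_def])
      \<comment> \<open>The term a_i y theta_i from y' cancels against the one in the drift of
        theta, leaving the forcing h.\<close>
      finally have "(\<Sum>k\<in>UNIV. ?A k z) + ?B z = h t \<omega> * \<theta> t \<omega> $ i - y t \<omega> *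
          (matQtilde q *v (\<chi> k. F t \<omega> $ Inl (Inl k)) + transpose (matQtilde q) *v (\<chi> k. F t \<omega> $ Inr (Inr k))) $ i"
        by (simp add: y'_def algebra_simps)
      moreover have "u t \<omega> $ i = - \<theta> t \<omega> $ i" using elim(1) by (simp add: z)
      ultimately show ?case unfolding z fst_conv snd_conv by simp
    qed
  qed
  also have "\<dots> = - (\<integral>z. ?R z \<partial>P)" by (rule Bochner_Integration.integral_minus)
  finally show ?thesis by (simp only: eq_neg_iff_add_eq_0)
qed

text \<open>The convexity inequality and the first order condition together leave only the
  asymmetric part of q, paired with y and Y_j. Both energies are controlled through the
  admissibility bound L and the constant B, never through the costs, so no cost coefficient enters
  the factor 5/2 B L^2.\<close>

lemma nash_gap:
  assumes v: "v \<in> H2" "H2_norm M T v \<le> L" and uL: "\<And>j. H2_norm M T (\<lambda>t \<omega>. u t \<omega> $ j) \<le> L"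
    and q: "\<And>i j. 0 \<le> q i j" and \<gamma>: "\<And>i. 0 \<le> \<gamma> i"
    and B: "0 \<le> B" "\<And>i h y. h \<in> H2 \<Longrightarrow> ode_process (a i) h y \<Longrightarrow> (\<integral>z. (y (snd z) (fst z))\<^sup>2 \<partial>P) \<le> B * (\<integral>z. (h (snd z) (fst z))\<^sup>2 \<partial>P)"
  shows "cost M T W a \<sigma> x q \<gamma> d i u \<le> cost M T W a \<sigma> x q \<gamma> d i (deviate u i v) +
    5/2 * B * L\<^sup>2 * (1 / real CARD('n)) * (\<Sum>j\<in>UNIV - {i}. \<bar>q j i - q i j\<bar>)"
proof -
  let ?N = "real CARD('n)" and ?X = "state M T W a \<sigma> x u"
  let ?h = "\<lambda>t \<omega>. v t \<omega> - u t \<omega> $ i"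
  obtain I where I: "wiener_integral (\<lambda>t. diagm (\<lambda>i. \<sigma> i t)) I" using noise_exists by blast
  obtain y where y: "ode_process (a i) ?h y"
    and gap: "cost M T W a \<sigma> x q \<gamma> d i u + 2 * (\<integral>z. ?h (snd z) (fst z) * u (snd z) (fst z) $ i +
        y (snd z) (fst z) * (matQtilde q *v ?X (snd z) (fst z)) $ i \<partial>P) +
      2 * (\<gamma> i * expectation (\<lambda>\<omega>. y T \<omega> * (?X T \<omega> $ i - d i))) \<le> cost M T W a \<sigma> x q \<gamma> d i (deviate u i v)"
    using cost_deviation[OF I u_H2 v(1), of q i \<gamma> d] q \<gamma> by blast
  have hH: "?h \<in> H2" by (rule H2_diff[OF v(1) u_H2])
  have yL: "L2cont y" by (rule ode_process_L2cont[OF a_cont hH y])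
  note yH = L2cont_H2[OF yL] and YH = L2cont_H2[OF Y_L2cont]
  let ?G = "\<lambda>z. (matQtilde q *v (\<chi> k. F (snd z) (fst z) $ Inl (Inl k)) + transpose (matQtilde q) *v (\<chi> k. F (snd z) (fst z) $ Inr (Inr k))) $ i"
  let ?S = "\<lambda>z. \<Sum>j\<in>UNIV - {i}. (q i j - q j i) / ?N * (y (snd z) (fst z) * Y j (snd z) (fst z))"
  \<comment> \<open>Inserting the blocks of \<open>F\<close> gives Q (X - Y/2) + Q^T Y/2 = Q X +
    (Q^T - Q) Y/2. The first part is what the cost derivative contains, the second is the
    defect.\<close>
  have G: "y (snd z) (fst z) * ?G z = y (snd z) (fst z) * (matQtilde q *v ?X (snd z) (fst z)) $ i + 1/2 * ?S z" for z
  proof -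
    let ?x = "?X (snd z) (fst z)" and ?Y = "\<chi> k. Y k (snd z) (fst z)"
    have "(\<chi> k. F (snd z) (fst z) $ Inl (Inl k)) = ?x - (1/2) *\<^sub>R ?Y" "(\<chi> k. F (snd z) (fst z) $ Inr (Inr k)) = (1/2) *\<^sub>R ?Y"
      by (simp_all add: vec_eq_iff)
    then have "?G z = (matQtilde q *v (?x - (1/2) *\<^sub>R ?Y) + transpose (matQtilde q) *v ((1/2) *\<^sub>R ?Y)) $ i"
      by (simp only:)
    also have "\<dots> = (matQtilde q *v ?x) $ i + 1/2 * (transpose (matQtilde q) *v ?Y - matQtilde q *v ?Y) $ i"
      by (simp only: matrix_vector_mult_diff_distrib matrix_vector_mult_scaleR vector_add_component
          vector_minus_component vector_scaleR_component real_scaleR_def) (simp add: algebra_simps)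
    also have "(transpose (matQtilde q) *v ?Y - matQtilde q *v ?Y) $ i = (\<Sum>j\<in>UNIV - {i}. (q i j - q j i) * ?Y $ j) / ?N"
      by (rule matQtilde_mult_vec(2))
    finally have "y (snd z) (fst z) * ?G z = y (snd z) (fst z) * (matQtilde q *v ?x) $ i +
        1/2 * (y (snd z) (fst z) * ((\<Sum>j\<in>UNIV - {i}. (q i j - q j i) * ?Y $ j) / ?N))"
      by (simp only: distrib_left mult.left_commute)
    also have "y (snd z) (fst z) * ((\<Sum>j\<in>UNIV - {i}. (q i j - q j i) * ?Y $ j) / ?N) = ?S z"
      by (simp add: sum_divide_distrib sum_distrib_left mult_ac)
    finally show ?thesis .
  qed
  have QX: "(\<lambda>t \<omega>. (matQtilde q *v ?X t \<omega>) $ i) \<in> H2"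
    unfolding matrix_vector_mult_def vec_lambda_beta by (intro H2_sum H2_cmult L2cont_H2 XS_L2cont)
  have i1: "integrable P (\<lambda>z. ?h (snd z) (fst z) * u (snd z) (fst z) $ i + y (snd z) (fst z) * (matQtilde q *v ?X (snd z) (fst z)) $ i)"
    by (intro Bochner_Integration.integrable_add H2_mult_integrable hH u_H2 yH QX)
  have yY: "integrable P (\<lambda>z. y (snd z) (fst z) * Y j (snd z) (fst z))" for j
    by (rule H2_mult_integrable[OF yH YH])
  then have iS: "integrable P ?S"
    by (intro Bochner_Integration.integrable_sum integrable_mult_right)
  have "\<gamma> i * expectation (\<lambda>\<omega>. y T \<omega> * (?X T \<omega> $ i - d i)) +
      (\<integral>z. (?h (snd z) (fst z) * u (snd z) (fst z) $ i + y (snd z) (fst z) * (matQtilde q *v ?X (snd z) (fst z)) $ i) + 1/2 * ?S z \<partial>P) = 0"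
    using first_order_condition[OF hH y] by (simp only: G add.assoc)
  \<comment> \<open>The factor 2 from differentiating squares cancels the 1/2 in front of the
    defect.\<close>
  then have foc: "2 * (\<gamma> i * expectation (\<lambda>\<omega>. y T \<omega> * (?X T \<omega> $ i - d i))) +
      2 * (\<integral>z. ?h (snd z) (fst z) * u (snd z) (fst z) $ i + y (snd z) (fst z) * (matQtilde q *v ?X (snd z) (fst z)) $ i \<partial>P) = - (\<integral>z. ?S z \<partial>P)"
    by (subst (asm) Bochner_Integration.integral_add[OF i1 integrable_mult_right[OF iS]]) simp
  \<comment> \<open>The deviation h = v - u_i is a difference of two admissible controls, and its
    square is at most twice the sum of the squares: 2 L^2 + 2 L^2.\<close>
  have h2: "(\<integral>z. (?h (snd z) (fst z))\<^sup>2 \<partial>P) \<le> 4 * L\<^sup>2"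
  proof -
    have "(\<integral>z. (?h (snd z) (fst z))\<^sup>2 \<partial>P) \<le> (\<integral>z. 2 * (v (snd z) (fst z))\<^sup>2 + 2 * (u (snd z) (fst z) $ i)\<^sup>2 \<partial>P)"
    proof (rule integral_mono)
      show "(?h (snd z) (fst z))\<^sup>2 \<le> 2 * (v (snd z) (fst z))\<^sup>2 + 2 * (u (snd z) (fst z) $ i)\<^sup>2" for z
        using zero_le_power2[of "v (snd z) (fst z) + u (snd z) (fst z) $ i"] by (simp add: power2_eq_square algebra_simps)
    qed (intro H2D(3)[OF hH] Bochner_Integration.integrable_add integrable_mult_right H2D(3)[OF v(1)] H2D(3)[OF u_H2])+
    also have "\<dots> = 2 * (\<integral>z. (v (snd z) (fst z))\<^sup>2 \<partial>P) + 2 * (\<integral>z. (u (snd z) (fst z) $ i)\<^sup>2 \<partial>P)"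
      using H2D(3)[OF v(1)] H2D(3)[OF u_H2[of i]] by simp
    also have "\<dots> \<le> 4 * L\<^sup>2"
      using H2_norm_le_square[OF v] H2_norm_le_square[OF u_H2 uL, of i] by simp
    finally show ?thesis .
  qed
  \<comment> \<open>The energy of y is at most 4 B L^2, being driven by the deviation, and that of
    Y_j at most B L^2, being driven by u_j. Bounding the product by half the sum of squares gives
    5/2.\<close>
  have bound: "\<bar>\<integral>z. y (snd z) (fst z) * Y j (snd z) (fst z) \<partial>P\<bar> \<le> 5/2 * B * L\<^sup>2" for j
  proof -
    have "(\<integral>z. (y (snd z) (fst z))\<^sup>2 \<partial>P) \<le> B * (4 * L\<^sup>2)"
      by (rule order_trans[OF B(2)[OF hH y] mult_left_mono[OF h2 B(1)]])
    moreover have "(\<integral>z. (Y j (snd z) (fst z))\<^sup>2 \<partial>P) \<le> B * L\<^sup>2"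
      by (rule order_trans[OF B(2)[OF u_H2 Y_ode] mult_left_mono[OF H2_norm_le_square[OF u_H2 uL] B(1)]])
    moreover have "\<bar>\<integral>z. y (snd z) (fst z) * Y j (snd z) (fst z) \<partial>P\<bar> \<le>
        (\<integral>z. 1/2 * (y (snd z) (fst z))\<^sup>2 + 1/2 * (Y j (snd z) (fst z))\<^sup>2 \<partial>P)"
    proof (rule order_trans[OF integral_abs_bound integral_mono])
      fix z
      show "\<bar>y (snd z) (fst z) * Y j (snd z) (fst z)\<bar> \<le> 1/2 * (y (snd z) (fst z))\<^sup>2 + 1/2 * (Y j (snd z) (fst z))\<^sup>2"
        using zero_le_power2[of "\<bar>y (snd z) (fst z)\<bar> - \<bar>Y j (snd z) (fst z)\<bar>"]
        by (simp add: power2_diff abs_mult)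
    qed (intro integrable_abs yY Bochner_Integration.integrable_add integrable_mult_right H2D(3)[OF yH] H2D(3)[OF YH])+
    moreover have "(\<integral>z. 1/2 * (y (snd z) (fst z))\<^sup>2 + 1/2 * (Y j (snd z) (fst z))\<^sup>2 \<partial>P) =
        1/2 * (\<integral>z. (y (snd z) (fst z))\<^sup>2 \<partial>P) + 1/2 * (\<integral>z. (Y j (snd z) (fst z))\<^sup>2 \<partial>P)"
      using H2D(3)[OF yH] H2D(3)[OF YH[of j]] by simp
    ultimately show ?thesis by simp
  qed
  have "(\<integral>z. ?S z \<partial>P) = (\<Sum>j\<in>UNIV - {i}. (q i j - q j i) / ?N * (\<integral>z. y (snd z) (fst z) * Y j (snd z) (fst z) \<partial>P))"
    using yY by (subst Bochner_Integration.integral_sum) simp_all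
  also have "\<dots> \<le> (\<Sum>j\<in>UNIV - {i}. \<bar>q j i - q i j\<bar> / ?N * (5/2 * B * L\<^sup>2))"
  proof (rule sum_mono)
    fix j
    have "(q i j - q j i) / ?N * (\<integral>z. y (snd z) (fst z) * Y j (snd z) (fst z) \<partial>P) \<le>
        \<bar>(q i j - q j i) / ?N\<bar> * \<bar>\<integral>z. y (snd z) (fst z) * Y j (snd z) (fst z) \<partial>P\<bar>"
      unfolding abs_mult[symmetric] by (rule abs_ge_self)
    also have "\<dots> \<le> \<bar>(q i j - q j i) / ?N\<bar> * (5/2 * B * L\<^sup>2)"
      by (rule mult_left_mono[OF bound]) simp
    finally show "(q i j - q j i) / ?N * (\<integral>z. y (snd z) (fst z) * Y j (snd z) (fst z) \<partial>P) \<le>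
        \<bar>q j i - q i j\<bar> / ?N * (5/2 * B * L\<^sup>2)"
      by (simp add: abs_minus_commute)
  qed
  also have "\<dots> = 5/2 * B * L\<^sup>2 * (1 / ?N) * (\<Sum>j\<in>UNIV - {i}. \<bar>q j i - q i j\<bar>)"
    unfolding sum_distrib_left by (intro sum.cong refl) (simp add: field_simps)
  finally show ?thesis using gap foc by linarith
qed

end

theorem theorem6p1:
  fixes M :: "'w measure" and T L :: real
    and W :: "real \<Rightarrow> 'w \<Rightarrow> real ^ 'n"
    and a \<sigma> :: "'n \<Rightarrow> real \<Rightarrow> real" and x :: "real ^ 'n"
    and G :: "'w measure" and r :: "'w \<Rightarrow> real"
  assumes "0 < T" and "0 < L"
    and "prob_space M" and "complete_measure M"
    and "brownian_motion M T W"
    and "\<And>i. continuous_on {0..T} (a i)" and "\<And>i. continuous_on {0..T} (\<sigma> i)"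
    and "subalgebra M G"
    and "prob_space.indep_set M (sets G) (sets (brownian_filtration M W T))"
    and "r \<in> borel_measurable G" and "distr M borel r = uniform_measure lborel {0..1}"
  shows "\<exists>C\<ge>0. \<forall>(q :: 'n \<Rightarrow> 'n \<Rightarrow> real) (\<gamma> :: 'n \<Rightarrow> real) (d :: 'n \<Rightarrow> real) M0 M1 M2 u X.
    (\<forall>i j. 0 \<le> q i j) \<and> (\<forall>i. 0 \<le> \<gamma> i) \<and>
    M0_equation T a q \<gamma> M0 \<and> M1_equation T a M0 M1 \<and> M2_equation T a \<gamma> d M0 M1 M2 \<and>
    closed_loop M T W G r a \<sigma> x M0 M1 M2 u X \<and>
    (\<forall>i. H2_norm M T (\<lambda>t \<omega>. u t \<omega> $ i) \<le> L)
    \<longrightarrow>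
    (\<exists>\<alpha>. eps_Nash M T W a \<sigma> x L q \<gamma> d \<alpha> u \<and>
        \<alpha> \<le> C * (1 / real CARD('n)) * (MAX i. \<Sum>j\<in>UNIV - {i}. \<bar>q j i - q i j\<bar>)) \<and>
    (\<exists>F. (\<forall>t\<in>{0..T}. AE \<omega> in M. F t \<omega> = cond_moments M W r X t \<omega>) \<and>
        sde_solution M T (brownian_filtration M W) W
          (\<lambda>t \<omega> y. (matAA a t - transpose Itilde ** matK M0 M1 t) *v y
                     - transpose Itilde *v (Itilde *v M2 t))
          (\<lambda>t. vcat (matSigma \<sigma> t) ((1/2) *\<^sub>R matSigma \<sigma> t))
          (vcat (vcat x 0) ((1/2) *\<^sub>R vcat x 0)) F)"
proof -
  interpret prob_space M by fact
  interpret lq_setting M T W a \<sigma> x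
    by (intro lq_setting.intro brownian.intro brownian_axioms.intro lq_setting_axioms.intro assms)
  obtain B where B: "0 \<le> B" "\<And>i h y. h \<in> H2 \<Longrightarrow> ode_process (a i) h y \<Longrightarrow>
      (\<integral>z. (y (snd z) (fst z))\<^sup>2 \<partial>P) \<le> B * (\<integral>z. (h (snd z) (fst z))\<^sup>2 \<partial>P)"
    using ode_process_uniform_bound by blast
  \<comment> \<open>Fixed before the cost coefficients are introduced: B comes from the dynamics and
    the horizon, L from the admissible sets.\<close>
  let ?C = "5/2 * B * L\<^sup>2"
  show ?thesis
  proof (rule exI[of _ ?C], intro conjI allI impI; (elim conjE)?)
    show "0 \<le> ?C" using B(1) by simp
  next
    fix q :: "'n \<Rightarrow> 'n \<Rightarrow> real" and \<gamma> d :: "'n \<Rightarrow> real" and M0 M1 M2 and u :: "real \<Rightarrow> 'w \<Rightarrow> real ^ 'n" and X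
    assume H: "\<forall>i j. 0 \<le> q i j" "\<forall>i. 0 \<le> \<gamma> i" "M0_equation T a q \<gamma> M0" "M1_equation T a M0 M1" "M2_equation T a \<gamma> d M0 M1 M2"
      "closed_loop M T W G r a \<sigma> x M0 M1 M2 u X" "\<forall>i. H2_norm M T (\<lambda>t \<omega>. u t \<omega> $ i) \<le> L"
    interpret lq_closed_loop M T W a \<sigma> x G r q \<gamma> d M0 M1 M2 u X
      by (intro lq_closed_loop.intro lq_setting_axioms lq_closed_loop_axioms.intro assms H)
    let ?s = "\<lambda>i. \<Sum>j\<in>UNIV - {i}. \<bar>q j i - q i j\<bar>"
    let ?\<alpha> = "?C * (1 / real CARD('n)) * (MAX i. ?s i)"
    have "eps_Nash M T W a \<sigma> x L q \<gamma> d ?\<alpha> u"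
      unfolding eps_Nash_def
    proof (intro conjI allI ballI)
      show "(\<lambda>t \<omega>. u t \<omega> $ i) \<in> admissible M T W L" for i
        using u_H2 H(7) by (simp add: admissible_def)
      fix i v assume "v \<in> admissible M T W L"
      then have "cost M T W a \<sigma> x q \<gamma> d i u \<le> cost M T W a \<sigma> x q \<gamma> d i (deviate u i v) + ?C * (1 / real CARD('n)) * ?s i"
        using H(1,2,7) by (intro nash_gap B) (auto simp: admissible_def)
      also have "?C * (1 / real CARD('n)) * ?s i \<le> ?\<alpha>"
        using B(1) by (intro mult_left_mono Max_ge) auto
      finally show "cost M T W a \<sigma> x q \<gamma> d i u \<le> cost M T W a \<sigma> x q \<gamma> d i (deviate u i v) + ?\<alpha>" by simp
    qed
    then show "\<exists>\<alpha>. eps_Nash M T W a \<sigma> x L q \<gamma> d \<alpha> u \<and> \<alpha> \<le> ?\<alpha>" by blast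
    show "\<exists>F. (\<forall>t\<in>{0..T}. AE \<omega> in M. F t \<omega> = cond_moments M W r X t \<omega>) \<and>
        sde_solution M T (brownian_filtration M W) W
          (\<lambda>t \<omega> y. (matAA a t - transpose Itilde ** matK M0 M1 t) *v y
                     - transpose Itilde *v (Itilde *v M2 t))
          (\<lambda>t. vcat (matSigma \<sigma> t) ((1/2) *\<^sub>R matSigma \<sigma> t))
          (vcat (vcat x 0) ((1/2) *\<^sub>R vcat x 0)) F"
      using cond_moments_F F_sde by blast
  qed
qed

end
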